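(* Let $\mathcal{E}=\mathcal{E}(r_0)\subset\mathscr{C}^n_{Eu}(N)$ be a Euclidean conical end and let $u\in C^2(\mathcal{E})$ be a solution of $$|\Delta u|\le q_1|u|+q_2|\nabla u|$$ for some $0\le q_1,q_2\in C^0(\mathcal{E})$. Let $C_1,C_2$ be non-negative constants. Then $u\equiv 0$ in each of the following situations. (a) $q_1(r,x)=C_1r^{-(2-\frac32\beta)}$, $q_2(r,x)=C_2r^{-(1-\frac12\beta)}$, $0<\beta\le 2$, and $$|u(r,x)|=\mathcal{O}(e^{-\tau r^\beta})\quad\text{for all sufficiently large }\tau.$$ (b) $r_0\ge 1$, $q_1(r,x)=C_1r^{-2}(\log r)^{-(2-\frac32\gamma)}$, $q_2(r,x)=C_2r^{-1}(\log r)^{-(1-\frac12\gamma)}$, $\gamma>1$, and $$|u(r,x)|=\mathcal{O}\big(e^{-\tau(\log r)^\gamma}\big)\quad\text{for all sufficiently large }\tau.$$ (c) $q_1(r,x)=C_1r^{-(2-\frac32\beta)}$, $q_2(r,x)=C_2r^{-(1-\frac12\beta)}$, $\beta>2$, $$|u(r,x)|=\mathcal{O}(e^{-\tau r^\beta})\quad\text{for all sufficiently large }\tau,$$ and $$\int_{\mathcal{E}(r_0)\setminus\mathcal{E}(2r)}|\nabla u|^2e^{2\tau r^\beta}\,d\mu_M=o(r^2)\quad\text{for all sufficiently large }\tau.$$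
   Context: Let $(N,g_N)$ be a compact Riemannian manifold without boundary of dimension $n-1\ge 1$. The Euclidean cone with section $N$ is $\mathscr{C}^n_{Eu}(N)=\big((0,+\infty)\times N,\ g=dr\otimes dr+r^2g_N\big)$. A Euclidean conical end is a subset $\mathcal{E}(r_0)=(r_0,+\infty)\times N\subset\mathscr{C}^n_{Eu}(N)$, $r_0\ge 0$, with the induced metric; $\mathcal{E}(r)=(r,+\infty)\times N$. $\Delta=\operatorname{div}\nabla$, $\nabla$ and $\mu_M$ are the Laplacian, gradient and Riemannian measure of $g$. Points are written $(r,x)$. The symbols $\mathcal{O}$ and $o$ refer to $r\to+\infty$, uniformly in $x\in N$: $v(r,x)=\mathcal{O}(f(r))$ means $\limsup_{r\to+\infty}\sup_x|v(r,x)/f(r)|<+\infty$. In the weight $e^{2\tau r^\beta}$ under the integral, $r$ is the radial coordinate (integration variable), distinct from the parameter $r$ in $\mathcal{E}(2r)$ and $o(r^2)$. *)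

theory Defs
  imports "HOL-Analysis.Analysis"
begin

section \<open>Functions of class $C^k$ on open subsets of Euclidean spaces\<close>

text \<open>The set \<open>S\<close> is meant to be open: derivatives are taken at points of \<open>S\<close> in the full space.\<close>

primrec Ck_on :: "nat \<Rightarrow> ('e::euclidean_space \<Rightarrow> 'f::euclidean_space) \<Rightarrow> 'e set \<Rightarrow> bool" where
  "Ck_on 0 f S \<longleftrightarrow> continuous_on S f"
| "Ck_on (Suc k) f S \<longleftrightarrow>
     (\<forall>y\<in>S. f differentiable (at y)) \<and>
     (\<forall>v. Ck_on k (\<lambda>y. frechet_derivative f (at y) v) S)"

definition smooth_on :: "('e::euclidean_space \<Rightarrow> 'f::euclidean_space) \<Rightarrow> 'e set \<Rightarrow> bool" where
  "smooth_on f S \<longleftrightarrow> (\<forall>k. Ck_on k f S)"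

section \<open>Riemannian manifolds\<close>

text \<open>
  A manifold is a set \<open>points M\<close> with the subspace topology, together with an indexed atlas
  whose charts take values in a Euclidean space \<open>'e\<close>; its dimension is \<open>DIM('e)\<close>.
  Chart \<open>i\<close> identifies the tangent space at a point of \<open>patch M i\<close> with \<open>'e\<close>, so tensor fields
  are given by their components in each chart: \<open>metric M i p v w\<close> is the value of the metric at
  \<open>p\<close> on the two tangent vectors whose components in chart \<open>i\<close> are \<open>v\<close> and \<open>w\<close>.
\<close>

record ('i, 'a, 'e) riem =
  points :: "'a set"
  idx :: "'i set"
  patch :: "'i \<Rightarrow> 'a set"
  chart :: "'i \<Rightarrow> 'a \<Rightarrow> 'e"
  metric :: "'i \<Rightarrow> 'a \<Rightarrow> 'e \<Rightarrow> 'e \<Rightarrow> real"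

definition chart_inv :: "('i, 'a, 'e) riem \<Rightarrow> 'i \<Rightarrow> 'e \<Rightarrow> 'a" where
  "chart_inv M i = inv_into (patch M i) (chart M i)"

definition smooth_manifold ::
  "('i, 'a::{t2_space, second_countable_topology}, 'e::euclidean_space) riem \<Rightarrow> bool" where
  "smooth_manifold M \<longleftrightarrow>
     points M = (\<Union>i\<in>idx M. patch M i) \<and>
     (\<forall>i\<in>idx M.
        openin (top_of_set (points M)) (patch M i) \<and>
        open (chart M i ` patch M i) \<and>
        homeomorphism (patch M i) (chart M i ` patch M i) (chart M i) (chart_inv M i)) \<and>
     (\<forall>i\<in>idx M. \<forall>j\<in>idx M.
        smooth_on (chart M j \<circ> chart_inv M i) (chart M i ` (patch M i \<inter> patch M j)))"

text \<open>The differential at \<open>p\<close> of the transition map from chart \<open>i\<close> to chart \<open>j\<close>.\<close>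

definition transition_deriv ::
  "('i, 'a, 'e::euclidean_space) riem \<Rightarrow> 'i \<Rightarrow> 'i \<Rightarrow> 'a \<Rightarrow> 'e \<Rightarrow> 'e" where
  "transition_deriv M i j p =
     frechet_derivative (chart M j \<circ> chart_inv M i) (at (chart M i p))"

definition riemannian_manifold ::
  "('i, 'a::{t2_space, second_countable_topology}, 'e::euclidean_space) riem \<Rightarrow> bool" where
  "riemannian_manifold M \<longleftrightarrow>
     smooth_manifold M \<and>
     (\<forall>i\<in>idx M. \<forall>p\<in>patch M i.
        bilinear (metric M i p) \<and>
        (\<forall>v w. metric M i p v w = metric M i p w v) \<and>
        (\<forall>v. v \<noteq> 0 \<longrightarrow> metric M i p v v > 0)) \<and>
     (\<forall>i\<in>idx M. \<forall>v w.
        smooth_on (\<lambda>y. metric M i (chart_inv M i y) v w) (chart M i ` patch M i)) \<and>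
     (\<forall>i\<in>idx M. \<forall>j\<in>idx M. \<forall>p\<in>patch M i \<inter> patch M j. \<forall>v w.
        metric M i p v w
          = metric M j p (transition_deriv M i j p v) (transition_deriv M i j p w))"

definition Ck_function ::
  "nat \<Rightarrow> ('i, 'a, 'e::euclidean_space) riem \<Rightarrow> ('a \<Rightarrow> real) \<Rightarrow> bool" where
  "Ck_function k M u \<longleftrightarrow> (\<forall>i\<in>idx M. Ck_on k (u \<circ> chart_inv M i) (chart M i ` patch M i))"

text \<open>
  Scalar quantities are evaluated in an arbitrary chart around the point; on a Riemannian
  manifold they do not depend on this choice.
\<close>

definition chart_at :: "('i, 'a, 'e) riem \<Rightarrow> 'a \<Rightarrow> 'i" where
  "chart_at M p = (SOME i. i \<in> idx M \<and> p \<in> patch M i)"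

text \<open>Components of $\nabla u$ in chart \<open>i\<close>, characterized by $g(\nabla u, w) = du(w)$.\<close>

definition gradient ::
  "('i, 'a, 'e::euclidean_space) riem \<Rightarrow> ('a \<Rightarrow> real) \<Rightarrow> 'i \<Rightarrow> 'a \<Rightarrow> 'e" where
  "gradient M u i p =
     (THE v. \<forall>w. metric M i p v w
        = frechet_derivative (u \<circ> chart_inv M i) (at (chart M i p)) w)"

definition grad_norm ::
  "('i, 'a, 'e::euclidean_space) riem \<Rightarrow> ('a \<Rightarrow> real) \<Rightarrow> 'a \<Rightarrow> real" where
  "grad_norm M u p =
     (let i = chart_at M p in sqrt (metric M i p (gradient M u i p) (gradient M u i p)))"

text \<open>
  $\sqrt{\det (g_{bc})}$ in chart \<open>i\<close>. The index set of the Gram matrix is \<open>Basis :: 'e set\<close>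
  rather than a type, so the determinant is written out by the Leibniz formula.
\<close>

definition gram_det :: "('i, 'a, 'e::euclidean_space) riem \<Rightarrow> 'i \<Rightarrow> 'a \<Rightarrow> real" where
  "gram_det M i p =
     (\<Sum>\<pi> | \<pi> permutes (Basis :: 'e set).
        of_int (sign \<pi>) * (\<Prod>b\<in>Basis. metric M i p b (\<pi> b)))"

definition vol_density :: "('i, 'a, 'e::euclidean_space) riem \<Rightarrow> 'i \<Rightarrow> 'a \<Rightarrow> real" where
  "vol_density M i p = sqrt (gram_det M i p)"

text \<open>
  $\operatorname{div} X = \frac{1}{\sqrt{\det g}} \sum_b \partial_b (\sqrt{\det g}\, X^b)$ for a
  vector field \<open>X\<close> whose components in chart \<open>i\<close> are \<open>X i\<close>.
\<close>

definition divergence ::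
  "('i, 'a, 'e::euclidean_space) riem \<Rightarrow> ('i \<Rightarrow> 'a \<Rightarrow> 'e) \<Rightarrow> 'a \<Rightarrow> real" where
  "divergence M X p =
     (let i = chart_at M p in
      (\<Sum>b\<in>Basis.
         frechet_derivative
           (\<lambda>y. vol_density M i (chart_inv M i y) * (X i (chart_inv M i y) \<bullet> b))
           (at (chart M i p)) b)
      / vol_density M i p)"

definition laplacian ::
  "('i, 'a, 'e::euclidean_space) riem \<Rightarrow> ('a \<Rightarrow> real) \<Rightarrow> 'a \<Rightarrow> real" where
  "laplacian M u = divergence M (gradient M u)"

text \<open>
  The Riemannian measure is the Borel measure with density $\sqrt{\det g}$ in every chart. It
  exists by the change of variables formula, and is unique because countably many charts cover \<open>M\<close>.
\<close>

definition riem_measure ::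
  "('i, 'a::{t2_space, second_countable_topology}, 'e::euclidean_space) riem \<Rightarrow> 'a measure" where
  "riem_measure M =
     (THE \<mu>. space \<mu> = points M \<and>
        sets \<mu> = sets (restrict_space borel (points M)) \<and>
        (\<forall>i\<in>idx M. \<forall>B\<in>sets \<mu>. B \<subseteq> patch M i \<longrightarrow>
           emeasure \<mu> B =
             (\<integral>\<^sup>+ y\<in>chart M i ` B. ennreal (vol_density M i (chart_inv M i y)) \<partial>lborel)))"

definition open_submanifold :: "('i, 'a, 'e) riem \<Rightarrow> 'a set \<Rightarrow> ('i, 'a, 'e) riem" where
  "open_submanifold M U = M\<lparr>points := points M \<inter> U, patch := (\<lambda>i. patch M i \<inter> U)\<rparr>"

section \<open>Euclidean cones and conical ends\<close>

text \<open>The metric is $dr \otimes dr + r^2 g_N$; the charts are $(r, x) \mapsto (r, \varphi_i(x))$.\<close>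

definition eucl_cone :: "('i, 'a, 'e) riem \<Rightarrow> ('i, real \<times> 'a, real \<times> 'e) riem" where
  "eucl_cone N =
     \<lparr>points = {0<..} \<times> points N,
      idx = idx N,
      patch = (\<lambda>i. {0<..} \<times> patch N i),
      chart = (\<lambda>i (r, x). (r, chart N i x)),
      metric = (\<lambda>i (r, x) (a, v) (b, w). a * b + r\<^sup>2 * metric N i x v w)\<rparr>"

definition conical_end ::
  "('i, 'a, 'e) riem \<Rightarrow> real \<Rightarrow> ('i, real \<times> 'a, real \<times> 'e) riem" where
  "conical_end N r0 = open_submanifold (eucl_cone N) ({r0<..} \<times> points N)"

text \<open>$v(r,x) = \mathcal{O}(f(r))$ as $r \to +\infty$, uniformly in \<open>x \<in> S\<close>.\<close>

definition radial_bigo :: "'a set \<Rightarrow> (real \<times> 'a \<Rightarrow> real) \<Rightarrow> (real \<Rightarrow> real) \<Rightarrow> bool" where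
  "radial_bigo S v f \<longleftrightarrow>
     Limsup at_top (\<lambda>r. SUP x\<in>S. ereal \<bar>v (r, x) / f r\<bar>) < \<infinity>"

text \<open>
  $\int_{\mathcal{E}(r_0) \setminus \mathcal{E}(R)} |\nabla u|^2 e^{2 \tau \rho^\beta}\, d\mu$, where
  $\rho$ is the radial coordinate. It takes values in \<open>[0, \<infinity>]\<close>, so a divergent integral is
  \<open>\<infinity>\<close> and not \<open>0\<close>.
\<close>

definition weighted_energy ::
  "('i, 'a::{t2_space, second_countable_topology}, 'e::euclidean_space) riem \<Rightarrow> real \<Rightarrow>
   (real \<times> 'a \<Rightarrow> real) \<Rightarrow> real \<Rightarrow> real \<Rightarrow> real \<Rightarrow> ennreal" where
  "weighted_energy N r0 u \<beta> \<tau> R =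
     (\<integral>\<^sup>+ p\<in>points (conical_end N r0) - points (conical_end N R).
        ennreal ((grad_norm (conical_end N r0) u p)\<^sup>2 * exp (2 * \<tau> * fst p powr \<beta>))
      \<partial>riem_measure (conical_end N r0))"

end

theory Submission
  imports Defs
begin

text \<open>
  In the cylindrical variable \<open>t = ln r\<close> and for \<open>w = exp ((n - 2) t / 2) u\<close> the equation reads
  \<open>\<bar>w'' + \<Delta>\<^sub>N w - c w\<bar> \<le> Q\<^sub>1 \<bar>w\<bar> + Q\<^sub>2 \<bar>\<nabla>w\<bar>\<close> with \<open>c = (n - 2)\<^sup>2 / 4\<close>. For a convex weight \<open>\<phi>(t)\<close>
  (\<open>exp (\<beta> t)\<close> or \<open>t\<^sup>\<gamma>\<close>) and \<open>v = exp (\<tau> \<phi>) w\<close>, integrating the Carleman identity over \<open>N\<close> alone exhibits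
  a boundary term \<open>Z\<^sub>\<tau>(t)\<close>, quadratic in \<open>v\<close>, \<open>v'\<close> and \<open>\<nabla>\<^sub>N v\<close>, that is nonincreasing in \<open>t\<close> once \<open>\<tau>\<close> is
  large. The decay of \<open>u\<close> and a Caccioppoli estimate make \<open>Z\<^sub>\<tau>\<close> tend to \<open>0\<close> along a sequence, so
  \<open>Z\<^sub>\<tau>(t) \<ge> 0\<close>; no cutoff function is needed. As a polynomial in \<open>\<tau>\<close>, the quantity
  \<open>exp (- 2 \<tau> \<phi>(t)) Z\<^sub>\<tau>(t)\<close> has leading term \<open>- 4 \<tau>\<^sup>3 \<phi>'(t)\<^sup>3 \<integral>\<^sub>N w\<^sup>2\<close>, whence \<open>w = 0\<close>.
\<close>

section \<open>Change of variables in Euclidean spaces\<close>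

text \<open>The exponents of the statement are those for which the Carleman estimate absorbs the
  lower-order terms. For \<open>t = ln r\<close> the coefficients become Q1 = r^2 q1 and Q2 = r q2,
  and absorption needs Q1^2 to be at most a multiple of \<phi>'' \<phi>'^2 and Q2^2 at most a
  multiple of \<phi>''. With \<phi> = exp (\<beta> t) this allows exp (3 \<beta> t / 2) and exp
  (\<beta> t / 2), with \<phi> = t^\<gamma> the powers (3 \<gamma> - 4) / 2 and (\<gamma> - 2) / 2
  of t. Since \<open>u\<close> is only C^2, no third derivative may appear. The derivatives in t of
  \<integral> w'^2 and \<integral> |\<nabla>w|^2 both lead to the term \<integral> g(\<nabla>w,
  \<nabla>w'), the first through Green's formula; it cancels in the difference, which is therefore
  the quantity that gets differentiated. Gradient and Laplacian are evaluated in an arbitrarily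
  chosen chart. Integrating by parts over N thus requires their independence of the chart and an
  integral glued from compactly supported pieces, each living in one chart.\<close>

text \<open>
  The library has the change of variables theorem on \<open>real^'n\<close> only. This index type identifies an
  arbitrary Euclidean space \<open>'e\<close> with \<open>real^'e bidx\<close>.
\<close>

typedef (overloaded) ('e::euclidean_space) bidx = "Basis :: 'e set"
  using nonempty_Basis by blast

instance bidx :: (euclidean_space) finite
proof
  have "finite (Abs_bidx ` (Basis :: 'a set))" by simp
  moreover have "(UNIV :: 'a bidx set) \<subseteq> Abs_bidx ` Basis"
    by (metis Abs_bidx_cases imageI subsetI)
  ultimately show "finite (UNIV :: 'a bidx set)" by (rule finite_subset[rotated])
qed

text \<open>The change of variables theorem asks for a finite and well-ordered index type. Any order
  will do; it is pulled back along an enumeration.\<close>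

instantiation bidx :: (euclidean_space) wellorder
begin
definition less_eq_bidx :: "'a bidx \<Rightarrow> 'a bidx \<Rightarrow> bool" where
  "less_eq_bidx x y \<longleftrightarrow> to_nat_on (UNIV :: 'a bidx set) x \<le> to_nat_on UNIV y"
definition less_bidx :: "'a bidx \<Rightarrow> 'a bidx \<Rightarrow> bool" where
  "less_bidx x y \<longleftrightarrow> to_nat_on (UNIV :: 'a bidx set) x < to_nat_on UNIV y"
instance
proof
  have inj: "inj (to_nat_on (UNIV :: 'a bidx set))"
    by (rule inj_on_to_nat_on) simp
  fix x y z :: "'a bidx" and P
  show "x \<le> y \<Longrightarrow> y \<le> x \<Longrightarrow> x = y"
    using inj by (auto simp: less_eq_bidx_def dest: injD)
  show "P a" if *: "\<And>x. (\<And>y. y < x \<Longrightarrow> P y) \<Longrightarrow> P x" for P and a :: "'a bidx"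
    by (induction a rule: measure_induct_rule[of "to_nat_on UNIV"]) (use * in \<open>auto simp: less_bidx_def\<close>)
qed (auto simp: less_eq_bidx_def less_bidx_def)
end

text \<open>\<open>bvec\<close> and \<open>vecb\<close> are mutually inverse and match the standard
  bases, so they carry determinants, boxes and Lebesgue measure over unchanged.\<close>

definition bvec :: "real^'e bidx \<Rightarrow> 'e::euclidean_space" where
  "bvec z = (\<Sum>i\<in>UNIV. z $ i *\<^sub>R Rep_bidx i)"

definition vecb :: "'e::euclidean_space \<Rightarrow> real^'e bidx" where
  "vecb y = (\<chi> i. y \<bullet> Rep_bidx i)"

lemma bij_Rep_bidx: "bij_betw Rep_bidx (UNIV :: 'e::euclidean_space bidx set) Basis"
  unfolding bij_betw_def
  by (simp add: inj_on_def Rep_bidx_inject type_definition.Rep_range[OF type_definition_bidx])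

lemma Rep_bidx_Basis [simp]: "Rep_bidx i \<in> Basis"
  by (rule Rep_bidx)

lemma inner_Rep_bidx: "Rep_bidx i \<bullet> Rep_bidx j = (if i = j then 1 else 0)"
  by (simp add: inner_Basis Rep_bidx_inject)

lemma bvec_vecb [simp]: "bvec (vecb y) = y"
proof -
  have "bvec (vecb y) = (\<Sum>b\<in>Basis. (y \<bullet> b) *\<^sub>R b)"
    unfolding bvec_def vecb_def
    by (simp add: sum.reindex_bij_betw[OF bij_Rep_bidx, of "\<lambda>b. (y \<bullet> b) *\<^sub>R b"])
  then show ?thesis by (simp add: euclidean_representation)
qed

lemma inner_bvec_Rep: "bvec z \<bullet> Rep_bidx i = z $ i"
proof -
  have "bvec z \<bullet> Rep_bidx i = (\<Sum>j\<in>UNIV. z $ j * (if j = i then 1 else 0))"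
    by (simp add: bvec_def inner_sum_left inner_Rep_bidx)
  also have "\<dots> = z $ i"
    by (simp add: if_distrib[of "\<lambda>x. _ * x"] cong: if_cong)
  finally show ?thesis .
qed

lemma vecb_bvec [simp]: "vecb (bvec z) = z"
  by (simp add: vec_eq_iff vecb_def inner_bvec_Rep)

lemma linear_bvec: "linear bvec"
  by (rule linearI) (simp_all add: bvec_def scaleR_add_left sum.distrib scaleR_sum_right)

lemma linear_vecb: "linear vecb"
  by (rule linearI) (simp_all add: vecb_def inner_add_left vec_eq_iff)

lemma bvec_axis: "bvec (axis j 1) = Rep_bidx j"
  by (simp add: bvec_def axis_def if_distrib[of "\<lambda>x. x *\<^sub>R _"] cong: if_cong)

section \<open>Determinants of bilinear forms and of endomorphisms\<close>

definition bdet :: "('e::euclidean_space \<Rightarrow> 'e \<Rightarrow> real) \<Rightarrow> real" where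
  "bdet B = (\<Sum>\<pi> | \<pi> permutes (Basis :: 'e set). of_int (sign \<pi>) * (\<Prod>b\<in>Basis. B b (\<pi> b)))"

definition bmat :: "('e::euclidean_space \<Rightarrow> 'e \<Rightarrow> real) \<Rightarrow> real^'e bidx^'e bidx" where
  "bmat B = (\<chi> i j. B (Rep_bidx i) (Rep_bidx j))"

text \<open>Conjugation by \<open>f\<close> is a sign-preserving bijection between the permutations
  of \<open>A\<close> and those of \<open>B\<close>. It serves both the passage to the index type
  and the embedding of \<open>Basis\<close> into the basis of a product.\<close>

lemma leibniz_reindex:
  fixes F :: "'b \<Rightarrow> 'b \<Rightarrow> real"
  assumes f: "bij_betw f A B" and fin: "finite A"
  shows "(\<Sum>\<pi> | \<pi> permutes B. of_int (sign \<pi>) * (\<Prod>b\<in>B. F b (\<pi> b)))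
    = (\<Sum>\<pi> | \<pi> permutes A. of_int (sign \<pi>) * (\<Prod>a\<in>A. F (f a) (f (\<pi> a))))"
proof -
  let ?m = "map_permutation A f"
  have inj: "inj_on f A" and im: "f ` A = B" using f by (auto simp: bij_betw_def)
  have bij: "bij_betw ?m {p. p permutes A} {p. p permutes B}"
  proof (rule bij_betwI[where g = "map_permutation B (inv_into A f)"])
    show "?m \<in> {p. p permutes A} \<rightarrow> {p. p permutes B}"
      using map_permutation_permutes[OF f] by auto
    show "map_permutation B (inv_into A f) \<in> {p. p permutes B} \<rightarrow> {p. p permutes A}"
      using map_permutation_permutes[OF bij_betw_inv_into[OF f]] by auto
    show "map_permutation B (inv_into A f) (?m x) = x" if "x \<in> {p. p permutes A}" for x
      using that by (intro map_permutation_compose_inv[OF f]) (auto simp: inv_into_f_f[OF inj])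
    show "?m (map_permutation B (inv_into A f) y) = y" if "y \<in> {p. p permutes B}" for y
      using that by (intro map_permutation_compose_inv[OF bij_betw_inv_into[OF f]])
        (auto simp: bij_betw_inv_into_right[OF f])
  qed
  have mp: "?m p (f a) = f (p a)" if "a \<in> A" for p a
    using that im by (auto simp: map_permutation_def restrict_id_def inv_into_f_f[OF inj])
  have "(\<Sum>\<pi> | \<pi> permutes A. of_int (sign \<pi>) * (\<Prod>a\<in>A. F (f a) (f (\<pi> a))))
      = (\<Sum>p | p permutes A. of_int (sign (?m p)) * (\<Prod>b\<in>B. F b (?m p b)))"
  proof (rule sum.cong)
    fix p assume "p \<in> {p. p permutes A}"
    then have "sign (?m p) = sign p"
      using inj fin by (intro sign_map_permutation) auto
    moreover have "(\<Prod>a\<in>A. F (f a) (?m p (f a))) = (\<Prod>b\<in>B. F b (?m p b))"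
      by (rule prod.reindex_bij_betw[OF f])
    ultimately show "of_int (sign p) * (\<Prod>a\<in>A. F (f a) (f (p a))) = of_int (sign (?m p)) * (\<Prod>b\<in>B. F b (?m p b))"
      by (simp add: mp)
  qed simp
  also have "\<dots> = (\<Sum>\<pi> | \<pi> permutes B. of_int (sign \<pi>) * (\<Prod>b\<in>B. F b (\<pi> b)))"
    by (rule sum.reindex_bij_betw[OF bij])
  finally show ?thesis by simp
qed

lemma bdet_eq_det: "bdet B = det (bmat B)"
  unfolding bdet_def det_def bmat_def vec_lambda_beta
  by (rule leibniz_reindex[OF bij_Rep_bidx]) simp

text \<open>\<open>L c \<bullet> b\<close> is the entry of the standard matrix of \<open>L\<close>
  in row \<open>b\<close> and column \<open>c\<close>. The Leibniz sum makes continuity in these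
  entries immediate.\<close>

definition ldet :: "('e::euclidean_space \<Rightarrow> 'e) \<Rightarrow> real" where
  "ldet L = bdet (\<lambda>b c. L c \<bullet> b)"

lemma ldet_eq_det: "ldet L = det (matrix (vecb \<circ> L \<circ> bvec))"
  by (simp add: ldet_def bdet_eq_det bmat_def matrix_def vecb_def bvec_axis)

lemma bilinear_expand:
  fixes B :: "'e::euclidean_space \<Rightarrow> 'e \<Rightarrow> real"
  assumes "bilinear B"
  shows "B v w = (\<Sum>i\<in>UNIV. \<Sum>j\<in>UNIV. (v \<bullet> Rep_bidx i) * (w \<bullet> Rep_bidx j) * B (Rep_bidx i) (Rep_bidx j))"
proof -
  have l1: "linear (\<lambda>v. B v w)" and l2: "linear (B v)" for v w
    using assms by (simp_all add: bilinear_def)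
  have "B (\<Sum>i\<in>UNIV. vecb v $ i *\<^sub>R Rep_bidx i) (\<Sum>j\<in>UNIV. vecb w $ j *\<^sub>R Rep_bidx j)
      = (\<Sum>i\<in>UNIV. \<Sum>j\<in>UNIV. (v \<bullet> Rep_bidx i) * (w \<bullet> Rep_bidx j) * B (Rep_bidx i) (Rep_bidx j))"
    by (simp add: linear_sum[OF l1] linear_cmul[OF l1])
      (simp add: linear_sum[OF l2] linear_cmul[OF l2] vecb_def sum_distrib_left mult.assoc)
  then show ?thesis
    by (simp only: bvec_def[symmetric] bvec_vecb)
qed

text \<open>In matrices, B' is the product of the transpose of A, B and A. Applied to the derivative
  of a transition map it gives the transformation law of \<open>gram_det\<close>.\<close>

lemma bdet_pullback:
  fixes B :: "'e::euclidean_space \<Rightarrow> 'e \<Rightarrow> real"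
  assumes "bilinear B" and "\<And>v w. v \<in> Basis \<Longrightarrow> w \<in> Basis \<Longrightarrow> B' v w = B (L v) (L w)"
  shows "bdet B' = (ldet L)\<^sup>2 * bdet B"
proof -
  let ?A = "matrix (vecb \<circ> L \<circ> bvec)"
  have "bmat B' = transpose ?A ** bmat B ** ?A"
  proof -
    have "bmat B' $ i $ j = (transpose ?A ** bmat B ** ?A) $ i $ j" for i j
    proof -
      have "bmat B' $ i $ j = B (L (Rep_bidx i)) (L (Rep_bidx j))"
        by (simp add: bmat_def assms(2))
      also have "\<dots> = (\<Sum>l\<in>UNIV. \<Sum>k\<in>UNIV. (L (Rep_bidx i) \<bullet> Rep_bidx k) * B (Rep_bidx k) (Rep_bidx l) * (L (Rep_bidx j) \<bullet> Rep_bidx l))"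
        by (subst bilinear_expand[OF assms(1)], subst sum.swap) (simp add: mult_ac)
      also have "\<dots> = (transpose ?A ** bmat B ** ?A) $ i $ j"
        by (simp add: matrix_matrix_mult_def transpose_def matrix_def bmat_def vecb_def bvec_axis sum_distrib_right)
      finally show ?thesis .
    qed
    then show ?thesis by (simp add: vec_eq_iff)
  qed
  then show ?thesis
    by (simp add: bdet_eq_det det_mul ldet_eq_det power2_eq_square)
qed

lemma bmat_mult_vecb:
  fixes B :: "'e::euclidean_space \<Rightarrow> 'e \<Rightarrow> real"
  assumes "bilinear B"
  shows "(bmat B *v vecb v) $ i = B (Rep_bidx i) v"
proof -
  have lin: "linear (B (Rep_bidx i))" using assms by (simp add: bilinear_def)
  have "B (Rep_bidx i) (\<Sum>j\<in>UNIV. vecb v $ j *\<^sub>R Rep_bidx j) = (bmat B *v vecb v) $ i"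
    by (simp add: linear_sum[OF lin] linear_cmul[OF lin] matrix_vector_mult_def bmat_def mult.commute)
  then show ?thesis
    by (simp only: bvec_def[symmetric] bvec_vecb)
qed

lemma bdet_nonzero:
  fixes B :: "'e::euclidean_space \<Rightarrow> 'e \<Rightarrow> real"
  assumes "bilinear B" and "\<And>v. v \<noteq> 0 \<Longrightarrow> B v v > 0"
  shows "bdet B \<noteq> 0"
proof -
  have "x = 0" if "bmat B *v x = 0" for x
  proof -
    let ?v = "bvec x"
    have B0: "B (Rep_bidx i) ?v = 0" for i
      using bmat_mult_vecb[OF assms(1), of ?v i] that by simp
    have lin: "linear (\<lambda>y. B y ?v)" using assms(1) by (simp add: bilinear_def)
    have "B (\<Sum>i\<in>UNIV. x $ i *\<^sub>R Rep_bidx i) ?v = 0"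
      by (simp add: linear_sum[OF lin] linear_cmul[OF lin] B0)
    then have "B ?v ?v = 0"
      by (simp add: bvec_def)
    then have "?v = 0" using assms(2) by force
    then have "vecb ?v = 0" by (simp add: linear_0[OF linear_vecb])
    then show "x = 0" by simp
  qed
  then have "invertible (bmat B)"
    by (simp add: invertible_left_inverse matrix_left_invertible_ker)
  then show ?thesis
    by (simp add: bdet_eq_det invertible_det_nz)
qed

lemma bdet_inner: "bdet (inner :: 'e::euclidean_space \<Rightarrow> 'e \<Rightarrow> real) = 1"
proof -
  have "bmat (inner :: 'e \<Rightarrow> 'e \<Rightarrow> real) = mat 1"
    by (simp add: bmat_def mat_def vec_eq_iff inner_Rep_bidx)
  then show ?thesis by (simp add: bdet_eq_det)
qed

text \<open>The segment from the inner product to \<open>B\<close> consists of positive definite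
  forms, on which \<open>bdet\<close> has no zero. As its value at the inner product is 1, the
  intermediate value theorem excludes a nonpositive value at \<open>B\<close>.\<close>

lemma bdet_pos:
  fixes B :: "'e::euclidean_space \<Rightarrow> 'e \<Rightarrow> real"
  assumes B: "bilinear B" and pos: "\<And>v. v \<noteq> 0 \<Longrightarrow> B v v > 0"
  shows "bdet B > 0"
proof (rule ccontr)
  assume neg: "\<not> bdet B > 0"
  define C where "C t v w = t * B v w + (1 - t) * (v \<bullet> w)" for t :: real and v w
  have bil: "bilinear (C t)" for t
    using B by (auto simp: bilinear_def linear_iff C_def algebra_simps inner_add_left inner_add_right)
  have "bdet (C t) \<noteq> 0" if "0 \<le> t" "t \<le> 1" for t
  proof (rule bdet_nonzero[OF bil])
    fix v :: 'e assume v: "v \<noteq> 0"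
    show "C t v v > 0"
    proof (cases "t = 0")
      case False
      then show ?thesis using that pos[OF v] by (simp add: C_def add_pos_nonneg)
    qed (simp add: C_def v)
  qed
  moreover have "continuous_on {0..1} (\<lambda>t. bdet (C t))"
    unfolding bdet_def C_def by (intro continuous_intros)
  moreover have "bdet (C 0) = 1"
    using bdet_inner[where 'e='e] by (simp add: C_def[abs_def])
  moreover have "bdet (C 1) = bdet B" by (simp add: C_def[abs_def])
  ultimately show False
    using IVT2'[of "\<lambda>t. bdet (C t)" 1 0 0] neg by auto
qed

section \<open>Integrals of compactly supported continuous functions and their change of
  variables\<close>

lemma integral_compact_support:
  fixes f :: "'a::euclidean_space \<Rightarrow> real"
  assumes "open S" "compact K" "K \<subseteq> S" "continuous_on S f" "\<And>x. x \<in> S - K \<Longrightarrow> f x = 0"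
  shows "integrable lborel (\<lambda>x. indicator S x * f x)"
    and "f integrable_on S"
    and "f absolutely_integrable_on S"
    and "integral S f = (\<integral>x. indicator S x * f x \<partial>lborel)"
proof -
  have eq: "(\<lambda>x. indicator S x * f x) = (\<lambda>x. indicator K x *\<^sub>R f x)"
    using assms(3,5) by (auto simp: indicator_def fun_eq_iff)
  show 1: "integrable lborel (\<lambda>x. indicator S x * f x)"
    unfolding eq by (rule borel_integrable_compact) (use assms in \<open>auto intro: continuous_on_subset\<close>)
  then have 2: "set_integrable lborel S f" by (simp add: set_integrable_def)
  then show "f integrable_on S" and "integral S f = (\<integral>x. indicator S x * f x \<partial>lborel)"
    using set_borel_integral_eq_integral[OF 2] by (simp_all add: set_lebesgue_integral_def)
  from 1 show "f absolutely_integrable_on S"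
    by (simp add: set_integrable_def integrable_completion)
qed

text \<open>Preimages of boxes are boxes with the same side lengths, and the values on boxes
  determine \<open>lborel\<close>.\<close>

lemma distr_bvec: "distr lborel borel bvec = (lborel :: 'e::euclidean_space measure)"
proof (rule lborel_eqI[symmetric])
  have meas: "bvec \<in> borel_measurable (lborel :: (real^'e bidx) measure)"
    by simp (intro borel_measurable_continuous_onI linear_continuous_on linear_bvec[unfolded linear_conv_bounded_linear])
  show "sets (distr lborel borel bvec) = sets borel" by simp
  fix l u :: 'e assume lu: "\<And>b. b \<in> Basis \<Longrightarrow> l \<bullet> b \<le> u \<bullet> b"
  have "bvec -` box l u = box (vecb l) (vecb u)"
  proof -
    have "(\<forall>b\<in>Basis. l \<bullet> b < bvec z \<bullet> b \<and> bvec z \<bullet> b < u \<bullet> b) \<longleftrightarrow>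
        (\<forall>i. vecb l $ i < z $ i \<and> z $ i < vecb u $ i)" for z
      using bij_betw_ball[OF bij_Rep_bidx, of "\<lambda>b. l \<bullet> b < bvec z \<bullet> b \<and> bvec z \<bullet> b < u \<bullet> b"]
      by (simp add: inner_bvec_Rep vecb_def)
    moreover have "z \<in> box (vecb l) (vecb u) \<longleftrightarrow> (\<forall>i. vecb l $ i < z $ i \<and> z $ i < vecb u $ i)" for z
      by (rule mem_box_cart)
    ultimately show ?thesis
      by (simp add: set_eq_iff mem_box(1)[of _ l u])
  qed
  then have "emeasure (distr lborel borel bvec) (box l u) = emeasure lborel (box (vecb l) (vecb u))"
    by (subst emeasure_distr[OF meas]) simp_all
  also have "\<dots> = (\<Prod>b\<in>Basis. (vecb u - vecb l) \<bullet> b)"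
  proof (rule emeasure_lborel_box)
    fix b :: "real^'e bidx" assume "b \<in> Basis"
    then obtain i where "b = axis i 1" by (auto simp: Basis_vec_def)
    then show "vecb l \<bullet> b \<le> vecb u \<bullet> b"
      using lu[of "Rep_bidx i"] by (simp add: inner_axis vecb_def)
  qed
  also have "(\<Prod>b\<in>Basis. (vecb u - vecb l) \<bullet> b) = (\<Prod>i\<in>UNIV. (vecb u - vecb l) $ i)"
  proof -
    have "bij_betw (\<lambda>i. axis i (1::real)) UNIV (Basis :: (real^'e bidx) set)"
      by (auto simp: bij_betw_def Basis_vec_def inj_on_def axis_eq_axis)
    from prod.reindex_bij_betw[OF this, of "\<lambda>b. (vecb u - vecb l) \<bullet> b"] show ?thesis
      by (simp add: inner_axis)
  qed
  also have "\<dots> = (\<Prod>b\<in>Basis. (u - l) \<bullet> b)"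
    using prod.reindex_bij_betw[OF bij_Rep_bidx, of "\<lambda>b. (u - l) \<bullet> b"]
    by (simp add: vecb_def inner_diff_left)
  finally show "emeasure (distr lborel borel bvec) (box l u) = (\<Prod>b\<in>Basis. (u - l) \<bullet> b)" .
qed

lemma continuous_on_bvec [continuous_intros]: "continuous_on S f \<Longrightarrow> continuous_on S (\<lambda>x. bvec (f x))"
  by (rule bounded_linear.continuous_on[OF linear_bvec[unfolded linear_conv_bounded_linear]])

lemma continuous_on_vecb [continuous_intros]: "continuous_on S f \<Longrightarrow> continuous_on S (\<lambda>x. vecb (f x))"
  by (rule bounded_linear.continuous_on[OF linear_vecb[unfolded linear_conv_bounded_linear]])

lemma integral_bvec:
  fixes f :: "'e::euclidean_space \<Rightarrow> real"
  assumes "open S" "compact K" "K \<subseteq> S" "continuous_on S f" "\<And>x. x \<in> S - K \<Longrightarrow> f x = 0"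
  shows "integral S f = integral (vecb ` S) (f \<circ> bvec)"
    and "(f \<circ> bvec) absolutely_integrable_on (vecb ` S)"
proof -
  have im: "vecb ` X = bvec -` X" for X :: "'e set"
    by (auto simp: image_iff) (metis vecb_bvec)
  have *: "open (vecb ` S)" "compact (vecb ` K)" "vecb ` K \<subseteq> vecb ` S" "continuous_on (vecb ` S) (f \<circ> bvec)"
    "\<And>x. x \<in> vecb ` S - vecb ` K \<Longrightarrow> (f \<circ> bvec) x = 0"
  proof -
    show "open (vecb ` S)"
      unfolding im using assms(1) by (intro open_vimage) (auto intro: continuous_intros)
    show "compact (vecb ` K)"
      using assms(2) by (intro compact_continuous_image continuous_intros)
    show "continuous_on (vecb ` S) (f \<circ> bvec)"
      using assms(4) by (intro continuous_on_compose continuous_intros) (auto simp: image_image)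
    show "(f \<circ> bvec) x = 0" if "x \<in> vecb ` S - vecb ` K" for x
      using that assms(5) by (auto simp: im)
  qed (use assms(3) in auto)
  show "(f \<circ> bvec) absolutely_integrable_on (vecb ` S)"
    by (rule integral_compact_support(3)[OF *])
  have meas: "bvec \<in> measurable lborel (borel :: 'e measure)"
    by simp (intro borel_measurable_continuous_onI linear_continuous_on linear_bvec[unfolded linear_conv_bounded_linear])
  have "integral S f = (\<integral>x. indicator S x * f x \<partial>lborel)"
    by (rule integral_compact_support(4)[OF assms])
  also have "\<dots> = (\<integral>x. indicator S x * f x \<partial>distr lborel borel bvec)" by (simp add: distr_bvec)
  also have "\<dots> = (\<integral>z. indicator S (bvec z) * f (bvec z) \<partial>lborel)"
    using borel_measurable_integrable[OF integral_compact_support(1)[OF assms]]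
    by (intro integral_distr meas) simp
  also have "\<dots> = (\<integral>z. indicator (vecb ` S) z * (f \<circ> bvec) z \<partial>lborel)"
    by (simp add: im indicator_def cong: if_cong)
  also have "\<dots> = integral (vecb ` S) (f \<circ> bvec)"
    by (rule integral_compact_support(4)[OF *, symmetric])
  finally show "integral S f = integral (vecb ` S) (f \<circ> bvec)" .
qed

text \<open>Conjugation by \<open>bvec\<close> and \<open>vecb\<close> reduces this to the theorem
  for coordinate spaces; compact support supplies the integrability on both sides.\<close>

lemma change_of_variables_compact_support:
  fixes \<Phi> :: "'e::euclidean_space \<Rightarrow> 'e" and f :: "'e \<Rightarrow> real"
  assumes S: "open S" and T: "open (\<Phi> ` S)"
    and der: "\<And>y. y \<in> S \<Longrightarrow> (\<Phi> has_derivative D y) (at y)"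
    and inv: "\<And>y. y \<in> S \<Longrightarrow> \<Psi> (\<Phi> y) = y" and cont: "continuous_on (\<Phi> ` S) \<Psi>"
    and f: "continuous_on (\<Phi> ` S) f" "compact K" "K \<subseteq> \<Phi> ` S" "\<And>x. x \<in> \<Phi> ` S - K \<Longrightarrow> f x = 0"
    and D: "continuous_on S (\<lambda>y. ldet (D y))"
  shows "integral (\<Phi> ` S) f = integral S (\<lambda>y. \<bar>ldet (D y)\<bar> * f (\<Phi> y))"
proof -
  define g where "g = vecb \<circ> \<Phi> \<circ> bvec"
  define g' where "g' z = vecb \<circ> D (bvec z) \<circ> bvec" for z
  have gim: "g ` (vecb ` S) = vecb ` \<Phi> ` S"
    by (simp add: g_def image_image)
  have derg: "(g has_derivative g' x) (at x within vecb ` S)" if "x \<in> vecb ` S" for x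
  proof -
    have "bvec x \<in> S" using that by auto
    have "(g has_derivative g' x) (at x)"
      unfolding g_def g'_def
      by (intro diff_chain_at linear_imp_has_derivative linear_bvec linear_vecb der[OF \<open>bvec x \<in> S\<close>])
    then show ?thesis by (rule has_derivative_at_withinI)
  qed
  define h where "h y = \<bar>ldet (D y)\<bar> * f (\<Phi> y)" for y
  have contP: "continuous_on S \<Phi>"
    using der by (meson continuous_at_imp_continuous_on has_derivative_continuous)
  have hK: "compact (\<Psi> ` K)" "\<Psi> ` K \<subseteq> S" "continuous_on S h" "\<And>x. x \<in> S - \<Psi> ` K \<Longrightarrow> h x = 0"
  proof -
    show "compact (\<Psi> ` K)"
      using f(2,3) cont by (intro compact_continuous_image) (auto intro: continuous_on_subset)
    show "\<Psi> ` K \<subseteq> S"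
      using f(3) inv by force
    show "continuous_on S h"
      unfolding h_def by (intro continuous_intros D continuous_on_compose2[OF f(1) contP]) auto
    show "h x = 0" if "x \<in> S - \<Psi> ` K" for x
    proof -
      have "\<Phi> x \<notin> K" using that inv[of x] by force
      then show ?thesis using that f(4)[of "\<Phi> x"] by (auto simp: h_def)
    qed
  qed
  \<comment> \<open>The theorem applied below concerns functions with values in a coordinate space,
    so real values are embedded into \<open>real^1\<close>.\<close>
  let ?v = "vec :: real \<Rightarrow> real^1"
  have lin: "linear ?v" by (rule linearI) (simp_all add: vec_eq_iff)
  note bl = lin[unfolded linear_conv_bounded_linear]
  have vint: "(\<lambda>x. ?v (k x)) absolutely_integrable_on X" "integral X (\<lambda>x. ?v (k x)) = ?v (integral X k)"
    if "k absolutely_integrable_on X" for k :: "real^'e bidx \<Rightarrow> real" and X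
    using absolutely_integrable_linear[OF that bl]
      integral_linear[OF set_lebesgue_integral_eq_integral(1)[OF that] bl] by (simp_all add: o_def)
  note If = integral_bvec[OF T f(2,3,1,4)]
  note Ih = integral_bvec[OF S hK]
  have *: "(\<lambda>x. \<bar>det (matrix (g' x))\<bar> *\<^sub>R ?v (f (bvec (g x)))) absolutely_integrable_on vecb ` S \<and>
      integral (vecb ` S) (\<lambda>x. \<bar>det (matrix (g' x))\<bar> *\<^sub>R ?v (f (bvec (g x)))) = ?v (integral (\<Phi> ` S) f)
     \<longleftrightarrow> (\<lambda>z. ?v (f (bvec z))) absolutely_integrable_on g ` (vecb ` S) \<and>
      integral (g ` (vecb ` S)) (\<lambda>z. ?v (f (bvec z))) = ?v (integral (\<Phi> ` S) f)"
  proof (rule has_absolute_integral_change_of_variables_invertible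
      [where f = "\<lambda>z. ?v (f (bvec z))" and h = "\<lambda>x. vecb (\<Psi> (bvec x))", OF derg])
    show "vecb (\<Psi> (bvec (g x))) = x" if "x \<in> vecb ` S" for x
      using that inv by (auto simp: g_def)
    show "continuous_on (g ` vecb ` S) (\<lambda>x. vecb (\<Psi> (bvec x)))"
      unfolding gim
      by (intro continuous_intros continuous_on_compose2[OF cont]) auto
  qed
  have "(\<lambda>z. ?v (f (bvec z))) absolutely_integrable_on g ` (vecb ` S) \<and>
      integral (g ` (vecb ` S)) (\<lambda>z. ?v (f (bvec z))) = ?v (integral (\<Phi> ` S) f)"
    using vint[OF If(2)] If(1) by (simp add: gim)
  with * have "integral (vecb ` S) (\<lambda>x. \<bar>det (matrix (g' x))\<bar> *\<^sub>R ?v (f (bvec (g x)))) = ?v (integral (\<Phi> ` S) f)"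
    by blast
  moreover have "\<bar>det (matrix (g' x))\<bar> *\<^sub>R ?v (f (bvec (g x))) = ?v ((h \<circ> bvec) x)" for x
    by (simp add: h_def ldet_eq_det g_def g'_def vec_eq_iff)
  ultimately have "?v (integral (\<Phi> ` S) f) = ?v (integral (vecb ` S) (h \<circ> bvec))"
    using vint(2)[OF Ih(2)] by simp
  then have "integral (\<Phi> ` S) f = integral (vecb ` S) (h \<circ> bvec)"
    by (simp add: vec_eq_iff)
  then show ?thesis
    using Ih(1) by (simp add: h_def[abs_def])
qed

lemma vecb_eq_iff: "vecb v = z \<longleftrightarrow> v = bvec z"
  by auto

text \<open>Cramer's rule for the Gram matrix. The explicit quotient gives existence and uniqueness
  at once, and shows that the representing vector depends on the base point as regularly as the form
  does.\<close>

lemma represent_functional: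
  fixes B :: "'e::euclidean_space \<Rightarrow> 'e \<Rightarrow> real"
  assumes B: "bilinear B" and sym: "\<And>v w. B v w = B w v" and pos: "\<And>v. v \<noteq> 0 \<Longrightarrow> B v v > 0"
    and l: "linear l"
  shows "(\<forall>w. B v w = l w) \<longleftrightarrow>
    v = bvec (\<chi> k. det (\<chi> i j. if j = k then l (Rep_bidx i) else bmat B $ i $ j) / bdet B)"
proof -
  have d0: "det (bmat B) \<noteq> 0"
    using bdet_nonzero[OF B pos] by (simp add: bdet_eq_det)
  have lin: "linear (B v)" using B by (simp add: bilinear_def)
  have "(\<forall>w. B v w = l w) \<longleftrightarrow> (\<forall>i. B v (Rep_bidx i) = l (Rep_bidx i))"
  proof (intro iffI allI)
    fix w assume *: "\<forall>i. B v (Rep_bidx i) = l (Rep_bidx i)"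
    have "B v (\<Sum>i\<in>UNIV. vecb w $ i *\<^sub>R Rep_bidx i) = l (\<Sum>i\<in>UNIV. vecb w $ i *\<^sub>R Rep_bidx i)"
      using * by (simp add: linear_sum[OF lin] linear_sum[OF l] linear_cmul[OF lin] linear_cmul[OF l])
    then show "B v w = l w" by (simp only: bvec_def[symmetric] bvec_vecb)
  qed auto
  also have "\<dots> \<longleftrightarrow> bmat B *v vecb v = (\<chi> i. l (Rep_bidx i))"
    by (simp add: vec_eq_iff bmat_mult_vecb[OF B] sym[of v])
  also have "\<dots> \<longleftrightarrow> vecb v = (\<chi> k. det (\<chi> i j. if j = k then l (Rep_bidx i) else bmat B $ i $ j) / bdet B)"
    by (subst cramer[OF d0]) (simp add: bdet_eq_det cong: if_cong)
  also have "\<dots> \<longleftrightarrow> v = bvec (\<chi> k. det (\<chi> i j. if j = k then l (Rep_bidx i) else bmat B $ i $ j) / bdet B)"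
    by (rule vecb_eq_iff)
  finally show ?thesis .
qed

section \<open>Continuously differentiable functions\<close>

text \<open>A derivative has to be exhibited, not computed, which keeps the closure properties
  short; \<open>C1_on_iff_Ck_on\<close> links this to \<open>Ck_on\<close>. In finite dimension
  continuity in every fixed direction amounts to continuity of the derivative.\<close>

definition C1_on :: "'e::euclidean_space set \<Rightarrow> ('e \<Rightarrow> 'f::real_normed_vector) \<Rightarrow> bool" where
  "C1_on S f \<longleftrightarrow> (\<exists>f'. (\<forall>y\<in>S. (f has_derivative f' y) (at y)) \<and> (\<forall>v. continuous_on S (\<lambda>y. f' y v)))"

lemma C1_onI:
  assumes "\<And>y. y \<in> S \<Longrightarrow> (f has_derivative f' y) (at y)" "\<And>v. continuous_on S (\<lambda>y. f' y v)"
  shows "C1_on S f"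
  using assms unfolding C1_on_def by blast

lemma C1_on_has_derivative:
  assumes "C1_on S f" "y \<in> S"
  shows "(f has_derivative frechet_derivative f (at y)) (at y)"
  using assms unfolding C1_on_def by (metis frechet_derivative_at)

lemma C1_on_continuous_deriv:
  assumes "C1_on S f"
  shows "continuous_on S (\<lambda>y. frechet_derivative f (at y) v)"
proof -
  obtain f' where f': "\<And>y. y \<in> S \<Longrightarrow> (f has_derivative f' y) (at y)" "\<And>v. continuous_on S (\<lambda>y. f' y v)"
    using assms unfolding C1_on_def by blast
  have "frechet_derivative f (at y) v = f' y v" if "y \<in> S" for y
    using frechet_derivative_at[OF f'(1)[OF that]] by simp
  then show ?thesis using f'(2)[of v] by (simp cong: continuous_on_cong)
qed

lemma C1_on_continuous: "C1_on S f \<Longrightarrow> continuous_on S f"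
  by (auto simp: C1_on_def intro!: continuous_at_imp_continuous_on dest: has_derivative_continuous)

lemma C1_on_iff_Ck_on: "C1_on S f \<longleftrightarrow> Ck_on (Suc 0) f S"
proof
  assume f: "C1_on S f"
  then show "Ck_on (Suc 0) f S"
    by (auto simp: C1_on_continuous_deriv intro!: differentiableI[OF C1_on_has_derivative[OF f]])
next
  assume "Ck_on (Suc 0) f S"
  then show "C1_on S f"
    by (intro C1_onI[where f' = "\<lambda>y. frechet_derivative f (at y)"])
      (simp_all add: frechet_derivative_works[symmetric])
qed

lemma C1_on_cong:
  assumes "C1_on S f" "open S" "\<And>y. y \<in> S \<Longrightarrow> g y = f y"
  shows "C1_on S g"
proof (rule C1_onI)
  show "(g has_derivative frechet_derivative f (at y)) (at y)" if "y \<in> S" for y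
    by (rule has_derivative_transform_within_open[OF C1_on_has_derivative[OF assms(1) that] assms(2) that])
      (simp add: assms(3))
qed (rule C1_on_continuous_deriv[OF assms(1)])

lemma C1_on_Un: "C1_on S f \<Longrightarrow> C1_on T f \<Longrightarrow> open S \<Longrightarrow> open T \<Longrightarrow> C1_on (S \<union> T) f"
  by (rule C1_onI[where f' = "\<lambda>y. frechet_derivative f (at y)"])
    (auto intro: C1_on_has_derivative continuous_on_open_Un C1_on_continuous_deriv)

lemma C1_on_const: "C1_on S (\<lambda>y. c)"
  by (rule C1_onI[where f' = "\<lambda>_ _. 0"]) auto

lemma C1_on_linear:
  assumes "linear l" shows "C1_on S l"
  by (rule C1_onI[where f' = "\<lambda>_. l"]) (use assms in \<open>auto intro: linear_imp_has_derivative\<close>)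

lemma C1_on_add:
  assumes "C1_on S f" "C1_on S g"
  shows "C1_on S (\<lambda>y. f y + g y)"
  by (rule C1_onI[where f' = "\<lambda>y v. frechet_derivative f (at y) v + frechet_derivative g (at y) v"])
    (simp_all add: has_derivative_add continuous_on_add assms[THEN C1_on_has_derivative] assms[THEN C1_on_continuous_deriv])

lemma C1_on_mult:
  fixes f g :: "'e::euclidean_space \<Rightarrow> real"
  assumes "C1_on S f" "C1_on S g"
  shows "C1_on S (\<lambda>y. f y * g y)"
proof (rule C1_onI)
  show "((\<lambda>y. f y * g y) has_derivative (\<lambda>v. f y * frechet_derivative g (at y) v + frechet_derivative f (at y) v * g y)) (at y)"
    if "y \<in> S" for y
    by (intro has_derivative_mult assms[THEN C1_on_has_derivative] that)
qed (intro continuous_intros assms[THEN C1_on_continuous] C1_on_continuous_deriv assms)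

lemma C1_on_scaleR:
  fixes f :: "'e::euclidean_space \<Rightarrow> real" and g :: "'e::euclidean_space \<Rightarrow> 'f::real_normed_vector"
  assumes "C1_on S f" "C1_on S g"
  shows "C1_on S (\<lambda>y. f y *\<^sub>R g y)"
proof (rule C1_onI)
  show "((\<lambda>y. f y *\<^sub>R g y) has_derivative (\<lambda>v. f y *\<^sub>R frechet_derivative g (at y) v + frechet_derivative f (at y) v *\<^sub>R g y)) (at y)"
    if "y \<in> S" for y
    by (intro has_derivative_scaleR assms[THEN C1_on_has_derivative] that)
qed (intro continuous_intros assms[THEN C1_on_continuous] C1_on_continuous_deriv assms)

lemma C1_on_sum: "(\<And>i. i \<in> A \<Longrightarrow> C1_on S (f i)) \<Longrightarrow> C1_on S (\<lambda>y. \<Sum>i\<in>A. f i y)"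
  by (induction A rule: infinite_finite_induct) (auto intro: C1_on_add C1_on_const)

lemma C1_on_prod:
  fixes f :: "'i \<Rightarrow> 'e::euclidean_space \<Rightarrow> real"
  shows "(\<And>i. i \<in> A \<Longrightarrow> C1_on S (f i)) \<Longrightarrow> C1_on S (\<lambda>y. \<Prod>i\<in>A. f i y)"
  by (induction A rule: infinite_finite_induct) (auto intro: C1_on_mult C1_on_const)

lemma C1_on_compose_real:
  fixes f :: "'e::euclidean_space \<Rightarrow> real"
  assumes "C1_on S f" and "\<And>y. y \<in> S \<Longrightarrow> (h has_real_derivative h' (f y)) (at (f y))"
    and "continuous_on (f ` S) h'"
  shows "C1_on S (\<lambda>y. h (f y))"
proof (rule C1_onI)
  show "((\<lambda>y. h (f y)) has_derivative (\<lambda>v. h' (f y) * frechet_derivative f (at y) v)) (at y)" if "y \<in> S" for y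
    using has_derivative_compose[OF C1_on_has_derivative[OF assms(1) that]
        assms(2)[OF that, unfolded has_field_derivative_def]] by simp
  show "continuous_on S (\<lambda>y. h' (f y) * frechet_derivative f (at y) v)" for v
    by (intro continuous_intros C1_on_continuous_deriv assms(1)
        continuous_on_compose2[OF assms(3) C1_on_continuous[OF assms(1)]]) auto
qed

lemma C1_on_divide:
  fixes f g :: "'e::euclidean_space \<Rightarrow> real"
  assumes "C1_on S f" "C1_on S g" "\<And>y. y \<in> S \<Longrightarrow> g y \<noteq> 0"
  shows "C1_on S (\<lambda>y. f y / g y)"
proof -
  have "C1_on S (\<lambda>y. inverse (g y))"
  proof (rule C1_on_compose_real[OF assms(2)])
    show "(inverse has_real_derivative - (inverse (g y))\<^sup>2) (at (g y))" if "y \<in> S" for y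
      using DERIV_inverse[OF assms(3)[OF that]] by (simp add: numeral_2_eq_2)
    show "continuous_on (g ` S) (\<lambda>x. - (inverse x)\<^sup>2)"
      using assms(3) by (intro continuous_intros) auto
  qed
  then show ?thesis
    using C1_on_mult[OF assms(1)] by (simp add: divide_inverse)
qed

lemma C1_on_sqrt:
  fixes f :: "'e::euclidean_space \<Rightarrow> real"
  assumes "C1_on S f" "\<And>y. y \<in> S \<Longrightarrow> f y > 0"
  shows "C1_on S (\<lambda>y. sqrt (f y))"
proof (rule C1_on_compose_real[OF assms(1)])
  show "(sqrt has_real_derivative inverse (sqrt (f y)) / 2) (at (f y))" if "y \<in> S" for y
    by (rule DERIV_real_sqrt[OF assms(2)[OF that]])
  show "continuous_on (f ` S) (\<lambda>x. inverse (sqrt x) / 2)"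
    using assms(2) by (intro continuous_intros) (force dest: assms(2))+
qed

text \<open>The chain rule evaluates the outer derivative at a moving vector, while continuity is
  known only for fixed vectors; expanding the inner derivative in the basis reconciles the
  two.\<close>

lemma C1_on_compose:
  fixes f :: "'f::euclidean_space \<Rightarrow> real" and h :: "'e::euclidean_space \<Rightarrow> 'f"
  assumes f: "C1_on T f" and h: "C1_on S h" and im: "h ` S \<subseteq> T"
  shows "C1_on S (\<lambda>y. f (h y))"
proof (rule C1_onI)
  let ?h' = "\<lambda>y. frechet_derivative h (at y)" and ?f' = "\<lambda>y. frechet_derivative f (at y)"
  have der: "((\<lambda>y. f (h y)) has_derivative (\<lambda>v. ?f' (h y) (?h' y v))) (at y)" if "y \<in> S" for y
    using im that by (intro has_derivative_compose[OF C1_on_has_derivative[OF h that]] C1_on_has_derivative[OF f]) auto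
  have eq: "?f' (h y) (?h' y v) = (\<Sum>b\<in>Basis. (?h' y v \<bullet> b) * ?f' (h y) b)" if "y \<in> S" for y v
  proof -
    have lin: "linear (?f' (h y))"
      using C1_on_has_derivative[OF f] im that by (meson has_derivative_linear image_subset_iff)
    have "?f' (h y) (\<Sum>b\<in>Basis. (?h' y v \<bullet> b) *\<^sub>R b) = (\<Sum>b\<in>Basis. (?h' y v \<bullet> b) * ?f' (h y) b)"
      by (simp add: linear_sum[OF lin] linear_cmul[OF lin])
    then show ?thesis by (simp add: euclidean_representation)
  qed
  show "((\<lambda>y. f (h y)) has_derivative (\<lambda>v. \<Sum>b\<in>Basis. (?h' y v \<bullet> b) * ?f' (h y) b)) (at y)" if "y \<in> S" for y
    using der[OF that] by (simp add: eq[OF that])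
  show "continuous_on S (\<lambda>y. \<Sum>b\<in>Basis. (?h' y v \<bullet> b) * ?f' (h y) b)" for v
    by (intro continuous_intros C1_on_continuous_deriv[OF h]
        continuous_on_compose2[OF C1_on_continuous_deriv[OF f] C1_on_continuous[OF h] im])
qed

section \<open>Integration of derivatives of compactly supported functions\<close>

lemma continuous_on_extend_zero:
  fixes f :: "'a::t2_space \<Rightarrow> 'b::{zero,topological_space}"
  assumes "open S" "compact K" "K \<subseteq> S" "continuous_on S f" "\<And>x. x \<in> S - K \<Longrightarrow> f x = 0"
  shows "continuous_on UNIV (\<lambda>x. if x \<in> S then f x else 0)"
proof -
  have "continuous_on (S \<union> - K) (\<lambda>x. if x \<in> S then f x else 0)"
  proof (rule continuous_on_open_Un)
    show "open (- K)" using assms(2) by (simp add: compact_imp_closed open_Compl)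
    show "continuous_on S (\<lambda>x. if x \<in> S then f x else 0)"
      using assms(4) by (simp cong: continuous_on_cong)
    have "continuous_on (- K) (\<lambda>x. 0 :: 'b)" by simp
    then show "continuous_on (- K) (\<lambda>x. if x \<in> S then f x else 0)"
      by (rule continuous_on_eq) (use assms(5) in auto)
  qed (fact assms(1))
  moreover have "S \<union> - K = UNIV" using assms(3) by auto
  ultimately show ?thesis by simp
qed

lemma integral_translation_lborel:
  fixes f :: "'e::euclidean_space \<Rightarrow> real"
  assumes "f \<in> borel_measurable borel"
  shows "(\<integral>y. f (c + y) \<partial>lborel) = (\<integral>y. f y \<partial>lborel)"
proof -
  have "(\<integral>y. f y \<partial>lborel) = (\<integral>y. f y \<partial>distr lborel borel ((+) c))"
    by (simp add: lborel_distr_plus)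
  also have "\<dots> = (\<integral>y. f (c + y) \<partial>lborel)"
    by (rule integral_distr) (use assms in auto)
  finally show ?thesis by simp
qed

text \<open>Translation invariance kills the integral of every difference quotient.\<close>

lemma integral_derivative_compact_support:
  fixes F :: "'e::euclidean_space \<Rightarrow> real"
  assumes S: "open S" and K: "compact K" "K \<subseteq> S" and F: "C1_on S F" and zero: "\<And>y. y \<in> S - K \<Longrightarrow> F y = 0"
  shows "integral S (\<lambda>y. frechet_derivative F (at y) b) = 0"
proof -
  let ?F' = "\<lambda>y. frechet_derivative F (at y)"
  \<comment> \<open>Extended by zero, \<open>F\<close> is differentiable on the whole space, so it
    may be translated freely.\<close>
  define G where "G y = (if y \<in> S then F y else 0)" for y
  define G' where "G' y = (if y \<in> S then ?F' y else (\<lambda>_. 0))" for y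
  have clK: "open (- K)" using K by (simp add: compact_imp_closed open_Compl)
  have G0: "G y = 0" if "y \<notin> K" for y using that zero by (auto simp: G_def)
  have derG: "(G has_derivative G' y) (at y)" for y
  proof (cases "y \<in> S")
    case True
    show ?thesis
      by (rule has_derivative_transform_within_open[OF _ S True, of F])
        (use C1_on_has_derivative[OF F True] True in \<open>auto simp: G_def G'_def\<close>)
  next
    case False
    show ?thesis
      by (rule has_derivative_transform_within_open[OF _ clK, of "\<lambda>_. 0"])
        (use False K G0 in \<open>auto simp: G'_def\<close>)
  qed
  have F'0: "?F' y b = 0" if "y \<in> S - K" for y
  proof -
    have "(G has_derivative (\<lambda>_. 0)) (at y)"
      by (rule has_derivative_transform_within_open[OF _ clK, of "\<lambda>_. 0"]) (use that G0 in auto)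
    then have "G' y = (\<lambda>_. 0)" by (rule has_derivative_unique[OF derG])
    then show ?thesis using that by (simp add: G'_def fun_eq_iff)
  qed
  define d where "d y = (if y \<in> S then ?F' y b else 0)" for y
  have d: "G' y b = d y" for y by (simp add: G'_def d_def)
  have contd: "continuous_on UNIV d"
    unfolding d_def by (rule continuous_on_extend_zero[OF S K C1_on_continuous_deriv[OF F] F'0])
  have d0: "d y = 0" if "y \<notin> K" for y using that F'0 by (auto simp: d_def)
  have contG: "continuous_on UNIV G"
    using derG by (meson continuous_at_imp_continuous_on has_derivative_continuous)
  have ind: "indicator S x * ?F' x b = d x" "indicator UNIV x * G x = G x" for x
    by (auto simp: d_def)
  have intG: "integrable lborel G"
    using integral_compact_support(1)[OF open_UNIV K(1) _ contG] G0 by simp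
  have eqd: "integral S (\<lambda>y. ?F' y b) = (\<integral>y. d y \<partial>lborel)"
    using integral_compact_support(4)[OF S K C1_on_continuous_deriv[OF F] F'0] by (simp add: ind)
  obtain B where B: "\<And>y. \<bar>d y\<bar> \<le> B" "B \<ge> 0"
  proof -
    have "bounded (d ` K)"
      by (intro compact_imp_bounded compact_continuous_image continuous_on_subset[OF contd] K) auto
    then obtain B where "\<forall>y\<in>K. \<bar>d y\<bar> \<le> B" by (auto simp: bounded_iff)
    then have "\<bar>d y\<bar> \<le> max B 0" for y by (cases "y \<in> K") (auto simp: d0 max.coboundedI1)
    then show ?thesis using that[of "max B 0"] by auto
  qed
  \<comment> \<open>All difference quotients in direction \<open>b\<close> with step in (0, 1]
    vanish outside this union of translates of \<open>K\<close>. On it the mean value theorem bounds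
    them by \<open>B\<close>, which provides an integrable majorant.\<close>
  define K' where "K' = (\<lambda>(y, t::real). y - t *\<^sub>R b) ` (K \<times> {0..1})"
  have K': "compact K'"
    unfolding K'_def by (intro compact_continuous_image compact_Times K) (auto intro!: continuous_intros simp: case_prod_unfold)
  have notK: "y + t *\<^sub>R b \<notin> K" if "y \<notin> K'" "0 \<le> t" "t \<le> 1" for y t
  proof
    assume "y + t *\<^sub>R b \<in> K"
    then have "(\<lambda>(y, t::real). y - t *\<^sub>R b) (y + t *\<^sub>R b, t) \<in> K'"
      unfolding K'_def using that by (intro imageI) auto
    then show False using that by simp
  qed
  define s where "s n y = (G (inverse (real (Suc n)) *\<^sub>R b + y) - G y) / inverse (real (Suc n))" for n y
  have derline: "((\<lambda>t. G (y + t *\<^sub>R b)) has_real_derivative d (y + t *\<^sub>R b)) (at t)" for y t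
  proof -
    have "((\<lambda>t. G (y + t *\<^sub>R b)) has_derivative (\<lambda>h. G' (y + t *\<^sub>R b) (h *\<^sub>R b))) (at t)"
      by (rule has_derivative_compose[OF _ derG]) (auto intro!: derivative_eq_intros)
    moreover have "G' (y + t *\<^sub>R b) (h *\<^sub>R b) = d (y + t *\<^sub>R b) * h" for h
      using linear_cmul[OF has_derivative_linear[OF derG]] by (simp add: d)
    ultimately show ?thesis by (simp add: has_field_derivative_def)
  qed
  have bound: "norm (s n y) \<le> indicator K' y * B" for n y
  proof (cases "y \<in> K'")
    case False
    then have "G (inverse (real (Suc n)) *\<^sub>R b + y) = 0" "G y = 0"
      using notK[OF False, of "inverse (real (Suc n))"] notK[OF False, of 0]
      by (auto intro!: G0 simp: add.commute inverse_le_1_iff)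
    then show ?thesis by (simp add: s_def False)
  next
    case True
    let ?h = "inverse (real (Suc n))"
    have "?h > 0" by simp
    from MVT2[OF this derline[of y]] obtain z where "G (y + ?h *\<^sub>R b) - G y = ?h * d (y + z *\<^sub>R b)"
      by auto
    then have "s n y = d (y + z *\<^sub>R b)" by (simp add: s_def add.commute field_simps)
    then show ?thesis using B True by simp
  qed
  have "(\<lambda>n. \<integral>y. s n y \<partial>lborel) \<longlonglongrightarrow> (\<integral>y. d y \<partial>lborel)"
  proof (rule integral_dominated_convergence)
    show "integrable lborel (\<lambda>y. indicator K' y * B)"
      using borel_integrable_compact[OF K', of "\<lambda>_. B"] by simp
    show "d \<in> borel_measurable lborel" using contd by (simp add: borel_measurable_continuous_onI)
    show "s n \<in> borel_measurable lborel" for n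
      unfolding s_def
      by simp (intro borel_measurable_continuous_onI continuous_intros continuous_on_compose2[OF contG], auto)
    show "AE y in lborel. (\<lambda>n. s n y) \<longlonglongrightarrow> d y"
    proof (rule AE_I2)
      fix y
      have "(\<lambda>h. (G (y + (0 + h) *\<^sub>R b) - G (y + 0 *\<^sub>R b)) / h) \<midarrow>0\<rightarrow> d (y + 0 *\<^sub>R b)"
        using derline[of y 0] by (simp only: DERIV_def)
      then have "(\<lambda>h. (G (h *\<^sub>R b + y) - G y) / h) \<midarrow>0\<rightarrow> d y" by (simp add: add.commute)
      moreover have "filterlim (\<lambda>n. inverse (real (Suc n))) (at 0) sequentially"
        using LIMSEQ_inverse_real_of_nat by (auto simp: filterlim_at)
      ultimately show "(\<lambda>n. s n y) \<longlonglongrightarrow> d y"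
        unfolding s_def by (rule filterlim_compose)
    qed
    show "AE y in lborel. norm (s n y) \<le> indicator K' y * B" for n using bound by simp
  qed
  moreover have "(\<integral>y. s n y \<partial>lborel) = 0" for n
  proof -
    have meas: "G \<in> borel_measurable borel" using contG by (rule borel_measurable_continuous_onI)
    have "integrable lborel (\<lambda>y. G (inverse (real (Suc n)) *\<^sub>R b + y))"
      using integrable_distr[of "(+) (inverse (real (Suc n)) *\<^sub>R b)" lborel borel G] intG
      by (simp add: lborel_distr_plus)
    then show ?thesis
      unfolding s_def using intG integral_translation_lborel[OF meas] by simp
  qed
  ultimately have "(\<integral>y. d y \<partial>lborel) = 0"
    by (simp add: LIMSEQ_const_iff)
  then show ?thesis using eqd by simp
qed

lemma C1_on_inner:
  fixes g :: "'e::euclidean_space \<Rightarrow> 'f::real_inner"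
  assumes "C1_on S g"
  shows "C1_on S (\<lambda>y. g y \<bullet> b)"
proof (rule C1_onI)
  show "((\<lambda>y. g y \<bullet> b) has_derivative (\<lambda>v. frechet_derivative g (at y) v \<bullet> b)) (at y)" if "y \<in> S" for y
    by (rule has_derivative_inner_left[OF C1_on_has_derivative[OF assms that]])
qed (intro continuous_intros C1_on_continuous_deriv assms)

lemma integral_superset_zero:
  fixes f :: "'n::euclidean_space \<Rightarrow> real"
  assumes "S \<subseteq> T" "\<And>x. x \<in> T - S \<Longrightarrow> f x = 0"
  shows "integral T f = integral S f"
proof -
  have "integral T f = integral T (\<lambda>x. if x \<in> S then f x else 0)"
    by (rule integral_cong) (use assms in auto)
  also have "\<dots> = integral (S \<inter> T) f" by (rule integral_restrict_Int)
  also have "S \<inter> T = S" using assms(1) by auto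
  finally show ?thesis .
qed

definition C2_on :: "'e::euclidean_space set \<Rightarrow> ('e \<Rightarrow> real) \<Rightarrow> bool" where
  "C2_on S f \<longleftrightarrow> C1_on S f \<and> (\<forall>v. C1_on S (\<lambda>y. frechet_derivative f (at y) v))"

section \<open>Calculus on a compact Riemannian manifold\<close>

locale compact_riem =
  fixes N :: "('i, 'a::{t2_space, second_countable_topology}, 'e::euclidean_space) riem"
  assumes riem: "riemannian_manifold N" and compact_points: "compact (points N)"
begin

abbreviation U where "U i \<equiv> chart N i ` patch N i"
abbreviation overlap where "overlap i j \<equiv> chart N i ` (patch N i \<inter> patch N j)"
abbreviation trans where "trans i j \<equiv> chart N j \<circ> chart_inv N i"

definition dd :: "'i \<Rightarrow> ('a \<Rightarrow> real) \<Rightarrow> 'a \<Rightarrow> 'e \<Rightarrow> real" where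
  "dd i f p = frechet_derivative (f \<circ> chart_inv N i) (at (chart N i p))"

definition C1_fun :: "('a \<Rightarrow> real) \<Rightarrow> bool" where
  "C1_fun f \<longleftrightarrow> (\<forall>i\<in>idx N. C1_on (U i) (f \<circ> chart_inv N i))"

definition C2_fun :: "('a \<Rightarrow> real) \<Rightarrow> bool" where
  "C2_fun f \<longleftrightarrow> (\<forall>i\<in>idx N. C2_on (U i) (f \<circ> chart_inv N i))"

text \<open>This is g(\<nabla>f, \<nabla>h), written as df(\<nabla>h) so that it is visibly linear
  in df.\<close>

definition pairing :: "'i \<Rightarrow> ('a \<Rightarrow> real) \<Rightarrow> ('a \<Rightarrow> real) \<Rightarrow> 'a \<Rightarrow> real" where
  "pairing i f h p = dd i f p (gradient N h i p)"

text \<open>The formula of \<open>divergence\<close>, applied to the gradient, in a prescribed chart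
  \<open>i\<close> instead of \<open>chart_at\<close>. Its independence of \<open>i\<close> is
  established in \<open>lap_trans\<close>.\<close>

definition lap :: "'i \<Rightarrow> ('a \<Rightarrow> real) \<Rightarrow> 'a \<Rightarrow> real" where
  "lap i h p = (\<Sum>b\<in>Basis. frechet_derivative
     (\<lambda>y. vol_density N i (chart_inv N i y) * (gradient N h i (chart_inv N i y) \<bullet> b)) (at (chart N i p)) b)
     / vol_density N i p"

text \<open>The Riemannian integral over one patch. It is applied to continuous functions with
  compact support in the patch, for which the gauge integral over the chart image raises no
  convergence issue.\<close>

definition chart_integral :: "'i \<Rightarrow> ('a \<Rightarrow> real) \<Rightarrow> real" where
  "chart_integral i f = integral (U i) (\<lambda>y. f (chart_inv N i y) * vol_density N i (chart_inv N i y))"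

lemma smooth: "smooth_manifold N"
  using riem by (simp add: riemannian_manifold_def)

lemma points_eq: "points N = (\<Union>i\<in>idx N. patch N i)"
  using smooth by (simp add: smooth_manifold_def)

lemma patch_subset: "i \<in> idx N \<Longrightarrow> patch N i \<subseteq> points N"
  by (auto simp: points_eq)

context
  fixes i assumes i: "i \<in> idx N"
begin

lemma openin_patch: "openin (top_of_set (points N)) (patch N i)"
  and open_U: "open (U i)"
  and homeo: "homeomorphism (patch N i) (U i) (chart N i) (chart_inv N i)"
  using smooth i unfolding smooth_manifold_def by blast+

lemma chart_inv_chart [simp]: "p \<in> patch N i \<Longrightarrow> chart_inv N i (chart N i p) = p"
  by (rule homeomorphism_apply1[OF homeo])

lemma chart_chart_inv [simp]: "y \<in> U i \<Longrightarrow> chart N i (chart_inv N i y) = y"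
  by (rule homeomorphism_apply2[OF homeo])

lemma chart_inv_in [simp]: "y \<in> U i \<Longrightarrow> chart_inv N i y \<in> patch N i"
  using homeo by (auto simp: homeomorphism_def)

lemma continuous_chart: "continuous_on (patch N i) (chart N i)"
  using homeo by (simp add: homeomorphism_def)

lemma continuous_chart_inv: "continuous_on (U i) (chart_inv N i)"
  using homeo by (simp add: homeomorphism_def)

lemma metric_bilinear: "p \<in> patch N i \<Longrightarrow> bilinear (metric N i p)"
  and metric_sym: "p \<in> patch N i \<Longrightarrow> metric N i p v w = metric N i p w v"
  and metric_pos: "p \<in> patch N i \<Longrightarrow> v \<noteq> 0 \<Longrightarrow> metric N i p v v > 0"
  using riem i unfolding riemannian_manifold_def by blast+

lemma metric_C1: "C1_on (U i) (\<lambda>y. metric N i (chart_inv N i y) v w)"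
  unfolding C1_on_iff_Ck_on using riem i unfolding riemannian_manifold_def smooth_on_def by blast

lemma gram_det_eq: "gram_det N i p = bdet (metric N i p)"
  by (simp add: gram_det_def bdet_def)

lemma gram_det_pos: "p \<in> patch N i \<Longrightarrow> gram_det N i p > 0"
  unfolding gram_det_eq by (rule bdet_pos[OF metric_bilinear metric_pos])

lemma vol_pos: "p \<in> patch N i \<Longrightarrow> vol_density N i p > 0"
  by (simp add: vol_density_def gram_det_pos)

lemma gram_det_C1: "C1_on (U i) (\<lambda>y. gram_det N i (chart_inv N i y))"
  unfolding gram_det_def by (intro C1_on_sum C1_on_mult C1_on_const C1_on_prod metric_C1)

lemma vol_C1: "C1_on (U i) (\<lambda>y. vol_density N i (chart_inv N i y))"
  unfolding vol_density_def by (rule C1_on_sqrt[OF gram_det_C1]) (use gram_det_pos in auto)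

end

text \<open>The covector \<open>b\<close> with its index raised:
  \<open>covec i c p \<bullet> b\<close> is the entry of the inverse Gram matrix at \<open>b\<close>
  and \<open>c\<close>.\<close>

definition covec :: "'i \<Rightarrow> 'e \<Rightarrow> 'a \<Rightarrow> 'e" where
  "covec i b p = (THE v. \<forall>w. metric N i p v w = w \<bullet> b)"

lemma representing_vector:
  assumes i: "i \<in> idx N" and p: "p \<in> patch N i" and l: "linear l"
  shows "\<exists>!v. \<forall>w. metric N i p v w = l w"
  by (simp add: represent_functional[OF metric_bilinear[OF i p] metric_sym[OF i p] metric_pos[OF i p] l])

lemma covec_metric:
  assumes i: "i \<in> idx N" and p: "p \<in> patch N i"
  shows "metric N i p (covec i b p) w = w \<bullet> b"
proof -
  have "linear (\<lambda>w. w \<bullet> b)" by (rule linearI) (simp_all add: inner_add_left)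
  from theI'[OF representing_vector[OF i p this]] show ?thesis by (simp add: covec_def)
qed

text \<open>By \<open>represent_functional\<close> the components are quotients of polynomials in
  the metric components, with denominator \<open>gram_det\<close>.\<close>

lemma covec_C1:
  assumes i: "i \<in> idx N"
  shows "C1_on (U i) (\<lambda>y. covec i b (chart_inv N i y))"
proof -
  let ?c = "\<lambda>y k. det (\<chi> r s. if s = k then Rep_bidx r \<bullet> b else metric N i (chart_inv N i y) (Rep_bidx r) (Rep_bidx s))
      / gram_det N i (chart_inv N i y)"
  have lin: "linear (\<lambda>w. w \<bullet> b)" by (rule linearI) (simp_all add: inner_add_left)
  have eq: "covec i b (chart_inv N i y) = (\<Sum>k\<in>UNIV. ?c y k *\<^sub>R Rep_bidx k)" if "y \<in> U i" for y
  proof -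
    have p: "chart_inv N i y \<in> patch N i" using that i by simp
    have "\<forall>w. metric N i (chart_inv N i y) (covec i b (chart_inv N i y)) w = w \<bullet> b"
      using covec_metric[OF i p] by blast
    from iffD1[OF represent_functional[OF metric_bilinear[OF i p] metric_sym[OF i p] metric_pos[OF i p] lin] this]
    have "covec i b (chart_inv N i y) = bvec (\<chi> k. ?c y k)"
      by (simp add: gram_det_eq[OF i] bmat_def cong: if_cong)
    then show ?thesis by (simp add: bvec_def)
  qed
  have "C1_on (U i) (\<lambda>y. \<Sum>k\<in>UNIV. ?c y k *\<^sub>R Rep_bidx k)"
  proof (intro C1_on_sum C1_on_scaleR C1_on_divide C1_on_const gram_det_C1 i)
    show "gram_det N i (chart_inv N i y) \<noteq> 0" if "y \<in> U i" for y
      using gram_det_pos[OF i, of "chart_inv N i y"] that i by force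
    have ent: "C1_on (U i) (\<lambda>y. if s = k then Rep_bidx r \<bullet> b else metric N i (chart_inv N i y) (Rep_bidx r) (Rep_bidx s))"
      for k r s :: "'e bidx"
      by (cases "s = k") (simp_all add: C1_on_const metric_C1[OF i])
    show "C1_on (U i) (\<lambda>y. det (\<chi> r s. if s = k then Rep_bidx r \<bullet> b else metric N i (chart_inv N i y) (Rep_bidx r) (Rep_bidx s)))" for k
      unfolding det_def vec_lambda_beta
      by (intro C1_on_sum C1_on_mult C1_on_const C1_on_prod ent)
  qed
  then show ?thesis
    by (rule C1_on_cong[OF _ open_U[OF i] eq])
qed

lemma C1_fun_has_derivative:
  assumes "C1_fun f" "i \<in> idx N" "p \<in> patch N i"
  shows "((f \<circ> chart_inv N i) has_derivative dd i f p) (at (chart N i p))"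
  unfolding dd_def using assms by (intro C1_on_has_derivative[of "U i"]) (auto simp: C1_fun_def)

lemma dd_linear: "C1_fun f \<Longrightarrow> i \<in> idx N \<Longrightarrow> p \<in> patch N i \<Longrightarrow> linear (dd i f p)"
  using C1_fun_has_derivative has_derivative_linear by blast

lemma dd_continuous:
  assumes "C1_fun f" "i \<in> idx N"
  shows "continuous_on (patch N i) (\<lambda>p. dd i f p v)"
  unfolding dd_def
  by (rule continuous_on_compose2[OF C1_on_continuous_deriv continuous_chart])
    (use assms in \<open>auto simp: C1_fun_def\<close>)

lemma C1_fun_continuous_patch:
  assumes "C1_fun f" "i \<in> idx N"
  shows "continuous_on (patch N i) f"
proof -
  have "continuous_on (patch N i) (\<lambda>p. (f \<circ> chart_inv N i) (chart N i p))"
    by (rule continuous_on_compose2[OF C1_on_continuous[of "U i"] continuous_chart])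
      (use assms in \<open>simp_all add: C1_fun_def del: o_apply\<close>)
  then show ?thesis
    by (rule continuous_on_eq) (use assms(2) in auto)
qed

lemma continuous_on_points:
  assumes "\<And>i. i \<in> idx N \<Longrightarrow> continuous_on (patch N i) f"
  shows "continuous_on (points N) f"
  unfolding continuous_on_eq_continuous_within
proof
  fix p assume "p \<in> points N"
  then obtain i where i: "i \<in> idx N" "p \<in> patch N i" by (auto simp: points_eq)
  obtain T where T: "open T" "patch N i = points N \<inter> T"
    using openin_patch[OF i(1)] by (auto simp: openin_open)
  have "at p within points N = at p within patch N i"
    by (rule at_within_nhd[OF _ T(1)]) (use i T in auto)
  moreover have "continuous (at p within patch N i) f"
    using assms[OF i(1)] i(2) by (simp add: continuous_on_eq_continuous_within)
  ultimately show "continuous (at p within points N) f" by simp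
qed

lemma C1_fun_continuous: "C1_fun f \<Longrightarrow> continuous_on (points N) f"
  by (intro continuous_on_points C1_fun_continuous_patch)

lemma C2_fun_C1_fun: "C2_fun f \<Longrightarrow> C1_fun f"
  by (simp add: C1_fun_def C2_fun_def C2_on_def)

lemma gradient_eq:
  assumes f: "C1_fun f" and i: "i \<in> idx N" and p: "p \<in> patch N i"
  shows "gradient N f i p = (\<Sum>b\<in>Basis. dd i f p b *\<^sub>R covec i b p)"
proof -
  note lin = dd_linear[OF f i p]
  have l: "linear (\<lambda>v. metric N i p v w)" for w
    using metric_bilinear[OF i p] by (simp add: bilinear_def)
  have "metric N i p (\<Sum>b\<in>Basis. dd i f p b *\<^sub>R covec i b p) w = dd i f p w" for w
  proof -
    have "metric N i p (\<Sum>b\<in>Basis. dd i f p b *\<^sub>R covec i b p) w = dd i f p (\<Sum>b\<in>Basis. (w \<bullet> b) *\<^sub>R b)"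
      by (simp add: linear_sum[OF l] linear_cmul[OF l] linear_sum[OF lin] linear_cmul[OF lin] covec_metric[OF i p] mult.commute)
    then show ?thesis by (simp add: euclidean_representation)
  qed
  then show ?thesis
    unfolding gradient_def dd_def[symmetric]
    by (intro the1_equality[OF representing_vector[OF i p lin]]) auto
qed

lemma gradient_metric:
  assumes f: "C1_fun f" and i: "i \<in> idx N" and p: "p \<in> patch N i"
  shows "metric N i p (gradient N f i p) w = dd i f p w"
  unfolding gradient_def dd_def[symmetric]
  using theI'[OF representing_vector[OF i p dd_linear[OF f i p]]] by blast

lemma gradient_C1:
  assumes f: "C2_fun f" and i: "i \<in> idx N"
  shows "C1_on (U i) (\<lambda>y. gradient N f i (chart_inv N i y))"
proof -
  have "C1_on (U i) (\<lambda>y. \<Sum>b\<in>Basis. frechet_derivative (f \<circ> chart_inv N i) (at y) b *\<^sub>R covec i b (chart_inv N i y))"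
    using f i by (intro C1_on_sum C1_on_scaleR covec_C1) (auto simp: C2_fun_def C2_on_def)
  then show ?thesis
    by (rule C1_on_cong[OF _ open_U[OF i]])
      (auto simp: gradient_eq[OF C2_fun_C1_fun[OF f] i] dd_def i)
qed

lemma gradient_continuous:
  assumes f: "C1_fun f" and i: "i \<in> idx N"
  shows "continuous_on (patch N i) (gradient N f i)"
proof -
  have c: "continuous_on (patch N i) (covec i b)" for b
  proof -
    have "continuous_on (patch N i) (\<lambda>p. covec i b (chart_inv N i (chart N i p)))"
      by (rule continuous_on_compose2[OF C1_on_continuous[OF covec_C1[OF i]] continuous_chart[OF i]]) auto
    then show ?thesis by (rule continuous_on_eq) (use i in auto)
  qed
  have "continuous_on (patch N i) (\<lambda>p. \<Sum>b\<in>Basis. dd i f p b *\<^sub>R covec i b p)"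
    by (intro continuous_intros c dd_continuous f i)
  then show ?thesis
    by (rule continuous_on_eq) (simp add: gradient_eq[OF f i])
qed

lemma pairing_eq:
  assumes "C1_fun f" "C1_fun h" "i \<in> idx N" "p \<in> patch N i"
  shows "pairing i f h p = (\<Sum>b\<in>Basis. \<Sum>c\<in>Basis. dd i f p b * dd i h p c * (covec i c p \<bullet> b))"
proof -
  note lin = dd_linear[OF assms(1,3,4)]
  have "pairing i f h p = dd i f p (\<Sum>b\<in>Basis. (gradient N h i p \<bullet> b) *\<^sub>R b)"
    by (simp add: pairing_def euclidean_representation)
  also have "\<dots> = (\<Sum>b\<in>Basis. (gradient N h i p \<bullet> b) * dd i f p b)"
    by (simp add: linear_sum[OF lin] linear_cmul[OF lin])
  also have "\<dots> = (\<Sum>b\<in>Basis. \<Sum>c\<in>Basis. dd i f p b * dd i h p c * (covec i c p \<bullet> b))"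
    by (simp add: gradient_eq[OF assms(2-4)] inner_sum_left sum_distrib_left sum_distrib_right mult_ac)
  finally show ?thesis .
qed

lemma pairing_continuous_patch:
  assumes f: "C1_fun f" and h: "C1_fun h" and i: "i \<in> idx N"
  shows "continuous_on (patch N i) (pairing i f h)"
proof -
  have "continuous_on (patch N i) (\<lambda>p. \<Sum>b\<in>Basis. (gradient N h i p \<bullet> b) * dd i f p b)"
    by (intro continuous_intros gradient_continuous dd_continuous f h i)
  then show ?thesis
  proof (rule continuous_on_eq)
    fix p assume p: "p \<in> patch N i"
    note lin = dd_linear[OF f i p]
    have "dd i f p (\<Sum>b\<in>Basis. (gradient N h i p \<bullet> b) *\<^sub>R b) = (\<Sum>b\<in>Basis. (gradient N h i p \<bullet> b) * dd i f p b)"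
      by (simp add: linear_sum[OF lin] linear_cmul[OF lin])
    then show "(\<Sum>b\<in>Basis. (gradient N h i p \<bullet> b) * dd i f p b) = pairing i f h p"
      by (simp add: pairing_def euclidean_representation)
  qed
qed

lemma pairing_self_nonneg:
  assumes "C1_fun f" "i \<in> idx N" "p \<in> patch N i"
  shows "pairing i f f p \<ge> 0"
  unfolding pairing_def gradient_metric[OF assms, symmetric]
  using metric_pos[OF assms(2,3), of "gradient N f i p"] bilinear_lzero[OF metric_bilinear[OF assms(2,3)]]
  by (cases "gradient N f i p = 0") auto

subsection \<open>Change of chart\<close>

context
  fixes i j assumes ij: "i \<in> idx N" "j \<in> idx N"
begin

lemma open_overlap: "open (overlap i j)"
proof -
  have "openin (top_of_set (patch N i)) (patch N i \<inter> patch N j)"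
    using openin_subset_trans[OF _ Int_lower1 patch_subset[OF ij(1)], of "patch N j"] 
      openin_Int[OF openin_patch[OF ij(1)] openin_patch[OF ij(2)]]
    by (metis Int_lower1 openin_subset_trans patch_subset ij(1))
  then have "openin (top_of_set (U i)) (overlap i j)"
    using homeomorphism_imp_open_map[OF homeo[OF ij(1)]] by blast
  then show ?thesis using open_U[OF ij(1)] by (simp add: openin_open_eq)
qed

lemma trans_C1: "C1_on (overlap i j) (trans i j)"
  using smooth ij unfolding C1_on_iff_Ck_on smooth_manifold_def smooth_on_def by blast

lemma trans_image: "trans i j ` overlap i j = overlap j i"
  using ij by (force simp: image_iff)

lemma trans_inverse: "y \<in> overlap i j \<Longrightarrow> trans j i (trans i j y) = y"
  using ij by auto

lemma trans_has_derivative: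
  "p \<in> patch N i \<inter> patch N j \<Longrightarrow> (trans i j has_derivative transition_deriv N i j p) (at (chart N i p))"
  unfolding transition_deriv_def by (rule C1_on_has_derivative[OF trans_C1]) auto

lemma metric_trans:
  "p \<in> patch N i \<inter> patch N j \<Longrightarrow>
    metric N i p v w = metric N j p (transition_deriv N i j p v) (transition_deriv N i j p w)"
  using riem ij unfolding riemannian_manifold_def by blast

lemma dd_trans:
  assumes f: "C1_fun f" and p: "p \<in> patch N i \<inter> patch N j"
  shows "dd i f p v = dd j f p (transition_deriv N i j p v)"
proof -
  have "((\<lambda>y. (f \<circ> chart_inv N j) (trans i j y)) has_derivative
      (\<lambda>v. dd j f p (transition_deriv N i j p v))) (at (chart N i p))"
    using has_derivative_compose[OF trans_has_derivative[OF p], of "f \<circ> chart_inv N j"]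
      C1_fun_has_derivative[OF f ij(2), of p] p ij by simp
  then have "((f \<circ> chart_inv N i) has_derivative (\<lambda>v. dd j f p (transition_deriv N i j p v))) (at (chart N i p))"
    by (rule has_derivative_transform_within_open[OF _ open_overlap]) (use p ij in auto)
  then have "dd i f p = (\<lambda>v. dd j f p (transition_deriv N i j p v))"
    using C1_fun_has_derivative[OF f ij(1)] p has_derivative_unique by blast
  then show ?thesis by simp
qed

end

lemma transition_deriv_inverse:
  assumes ij: "i \<in> idx N" "j \<in> idx N" and p: "p \<in> patch N i \<inter> patch N j"
  shows "transition_deriv N i j p (transition_deriv N j i p w) = w"
proof -
  have "((\<lambda>y. trans i j (trans j i y)) has_derivative
      (\<lambda>w. transition_deriv N i j p (transition_deriv N j i p w))) (at (chart N j p))"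
    using has_derivative_compose[OF trans_has_derivative[OF ij(2,1)], of p "trans i j"]
      trans_has_derivative[OF ij p] p ij by simp
  moreover have "((\<lambda>y. trans i j (trans j i y)) has_derivative (\<lambda>w. w)) (at (chart N j p))"
    by (rule has_derivative_transform_within_open[OF _ open_overlap[OF ij(2,1)], of "\<lambda>y. y"])
      (use p ij in auto)
  ultimately have "(\<lambda>w. transition_deriv N i j p (transition_deriv N j i p w)) = (\<lambda>w. w)"
    by (rule has_derivative_unique)
  then show ?thesis by meson
qed

text \<open>The transported gradient represents the differential in chart \<open>j\<close>, because
  every \<open>w\<close> is the image of a vector in chart \<open>i\<close>. Uniqueness of the
  representing vector concludes.\<close>

lemma gradient_trans:
  assumes ij: "i \<in> idx N" "j \<in> idx N" and f: "C1_fun f" and p: "p \<in> patch N i \<inter> patch N j"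
  shows "gradient N f j p = transition_deriv N i j p (gradient N f i p)"
proof -
  have pj: "p \<in> patch N j" and pi: "p \<in> patch N i" using p by auto
  have "metric N j p (transition_deriv N i j p (gradient N f i p)) w = dd j f p w" for w
  proof -
    have w: "w = transition_deriv N i j p (transition_deriv N j i p w)"
      by (rule transition_deriv_inverse[OF ij p, symmetric])
    have "metric N j p (transition_deriv N i j p (gradient N f i p)) w
        = metric N i p (gradient N f i p) (transition_deriv N j i p w)"
      by (subst w) (rule metric_trans[OF ij p, symmetric])
    also have "\<dots> = dd j f p (transition_deriv N i j p (transition_deriv N j i p w))"
      by (simp add: gradient_metric[OF f ij(1) pi] dd_trans[OF ij f p])
    finally show ?thesis by (simp add: transition_deriv_inverse[OF ij p])
  qed
  then show ?thesis
    using representing_vector[OF ij(2) pj dd_linear[OF f ij(2) pj]] gradient_metric[OF f ij(2) pj] by blast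
qed

lemma pairing_trans:
  assumes "i \<in> idx N" "j \<in> idx N" "C1_fun f" "C1_fun h" "p \<in> patch N i \<inter> patch N j"
  shows "pairing i f h p = pairing j f h p"
  by (simp add: pairing_def gradient_trans[OF assms(1,2,4,5)] dd_trans[OF assms(1,2,3,5)])

lemma vol_trans:
  assumes ij: "i \<in> idx N" "j \<in> idx N" and p: "p \<in> patch N i \<inter> patch N j"
  shows "vol_density N i p = \<bar>ldet (transition_deriv N i j p)\<bar> * vol_density N j p"
proof -
  have "gram_det N i p = (ldet (transition_deriv N i j p))\<^sup>2 * gram_det N j p"
    unfolding gram_det_eq[OF ij(1)] gram_det_eq[OF ij(2)]
    by (rule bdet_pullback[OF metric_bilinear[OF ij(2)] metric_trans[OF ij p]]) (use p in auto)
  then show ?thesis by (simp add: vol_density_def real_sqrt_mult)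
qed

section \<open>Integration in one chart: independence of the chart and Green's formula\<close>

lemma chart_integral_compact_support:
  assumes i: "i \<in> idx N" and f: "continuous_on (patch N i) f"
    and K: "compact K" "K \<subseteq> patch N i" and zero: "\<And>p. p \<in> patch N i - K \<Longrightarrow> f p = 0"
  defines "g \<equiv> \<lambda>y. f (chart_inv N i y) * vol_density N i (chart_inv N i y)"
  shows "compact (chart N i ` K)" "chart N i ` K \<subseteq> U i" "continuous_on (U i) g"
    "\<And>y. y \<in> U i - chart N i ` K \<Longrightarrow> g y = 0" "g integrable_on U i"
proof -
  show 1: "compact (chart N i ` K)"
    using K continuous_chart[OF i] by (intro compact_continuous_image) (auto intro: continuous_on_subset)
  show 2: "chart N i ` K \<subseteq> U i" using K by auto
  show 3: "continuous_on (U i) g"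
    unfolding g_def
    by (intro continuous_intros C1_on_continuous[OF vol_C1[OF i]] continuous_on_compose2[OF f continuous_chart_inv[OF i]])
      (use i in auto)
  show 4: "g y = 0" if "y \<in> U i - chart N i ` K" for y
  proof -
    have "chart_inv N i y \<notin> K" using that i by (metis Diff_iff chart_chart_inv imageI)
    then show ?thesis using that i zero[of "chart_inv N i y"] by (auto simp: g_def)
  qed
  show "g integrable_on U i"
    by (rule integral_compact_support(2)[OF open_U[OF i] 1 2 3 4])
qed

text \<open>By \<open>vol_trans\<close> the Jacobian of the transition map is the quotient of the
  two volume densities. The support in the overlap allows both integrals to be restricted to
  it.\<close>

lemma chart_integral_trans:
  assumes ij: "i \<in> idx N" "j \<in> idx N" and f: "continuous_on (patch N i \<inter> patch N j) f"
    and K: "compact K" "K \<subseteq> patch N i \<inter> patch N j" and zero: "\<And>p. p \<in> (patch N i \<union> patch N j) - K \<Longrightarrow> f p = 0"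
  shows "chart_integral i f = chart_integral j f"
proof -
  let ?g = "\<lambda>i y. f (chart_inv N i y) * vol_density N i (chart_inv N i y)"
  have restrict: "chart_integral i f = integral (overlap i j) (?g i)" if "i \<in> idx N" "K \<subseteq> patch N i \<inter> patch N j"
    "\<And>p. p \<in> patch N i - K \<Longrightarrow> f p = 0" for i j
    unfolding chart_integral_def
  proof (rule integral_superset_zero)
    show "overlap i j \<subseteq> U i" by auto
    show "?g i y = 0" if "y \<in> U i - overlap i j" for y
    proof -
      have "y = chart N i (chart_inv N i y)" using that \<open>i \<in> idx N\<close> by auto
      then have "chart_inv N i y \<notin> K" using that \<open>K \<subseteq> patch N i \<inter> patch N j\<close> by blast
      then show ?thesis using that \<open>i \<in> idx N\<close> \<open>\<And>p. p \<in> patch N i - K \<Longrightarrow> f p = 0\<close>[of "chart_inv N i y"] by auto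
    qed
  qed
  have "chart_integral j f = integral (overlap j i) (?g j)"
    by (rule restrict) (use ij K zero in auto)
  also have "\<dots> = integral (trans i j ` overlap i j) (?g j)" by (simp only: trans_image[OF ij])
  also have "\<dots> = integral (overlap i j)
      (\<lambda>y. \<bar>ldet (transition_deriv N i j (chart_inv N i y))\<bar> * ?g j (trans i j y))"
  proof (rule change_of_variables_compact_support[where K = "chart N j ` K" and \<Psi> = "trans j i"])
    show "open (overlap i j)" by (rule open_overlap[OF ij])
    show "open (trans i j ` overlap i j)" unfolding trans_image[OF ij] by (rule open_overlap[OF ij(2,1)])
    show "(trans i j has_derivative transition_deriv N i j (chart_inv N i y)) (at y)" if "y \<in> overlap i j" for y
      using trans_has_derivative[OF ij, of "chart_inv N i y"] that ij by auto
    show "trans j i (trans i j y) = y" if "y \<in> overlap i j" for y by (rule trans_inverse[OF ij that])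
    show "continuous_on (trans i j ` overlap i j) (trans j i)"
      unfolding trans_image[OF ij] by (rule C1_on_continuous[OF trans_C1[OF ij(2,1)]])
    have sub: "overlap j i \<subseteq> U j" by auto
    show "continuous_on (trans i j ` overlap i j) (?g j)"
      unfolding trans_image[OF ij]
      by (intro continuous_intros continuous_on_subset[OF C1_on_continuous[OF vol_C1[OF ij(2)]] sub]
          continuous_on_compose2[OF f continuous_on_subset[OF continuous_chart_inv[OF ij(2)] sub]])
        (use ij in auto)
    show "compact (chart N j ` K)"
      using K continuous_chart[OF ij(2)] by (intro compact_continuous_image) (auto intro: continuous_on_subset)
    show "chart N j ` K \<subseteq> trans i j ` overlap i j"
      unfolding trans_image[OF ij] using K by auto
    show "?g j y = 0" if "y \<in> trans i j ` overlap i j - chart N j ` K" for y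
    proof -
      have y: "y \<in> overlap j i" using that trans_image[OF ij] by blast
      have "y = chart N j (chart_inv N j y)" using y ij(2) by auto
      then have "chart_inv N j y \<notin> K" using that by blast
      then show ?thesis using y ij zero[of "chart_inv N j y"] by auto
    qed
    show "continuous_on (overlap i j) (\<lambda>y. ldet (transition_deriv N i j (chart_inv N i y)))"
    proof -
      have "continuous_on (overlap i j) (\<lambda>y. ldet (frechet_derivative (trans i j) (at y)))"
        unfolding ldet_def bdet_def
        by (intro continuous_intros C1_on_continuous_deriv[OF trans_C1[OF ij]])
      then show ?thesis
        by (rule continuous_on_eq) (use ij in \<open>auto simp: transition_deriv_def\<close>)
    qed
  qed
  also have "\<dots> = integral (overlap i j) (?g i)"
    by (rule integral_cong) (use ij vol_trans[OF ij] in \<open>auto simp: mult_ac\<close>)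
  also have "\<dots> = chart_integral i f"
    by (rule restrict[symmetric]) (use ij K zero in auto)
  finally show ?thesis by simp
qed

lemma lap_continuous:
  assumes h: "C2_fun h" and i: "i \<in> idx N"
  shows "continuous_on (patch N i) (lap i h)"
proof -
  have vol: "continuous_on (patch N i) (\<lambda>p. vol_density N i p)"
  proof -
    have "continuous_on (patch N i) (\<lambda>p. vol_density N i (chart_inv N i (chart N i p)))"
      by (rule continuous_on_compose2[OF C1_on_continuous[OF vol_C1[OF i]] continuous_chart[OF i]]) auto
    then show ?thesis by (rule continuous_on_eq) (use i in auto)
  qed
  have C1: "C1_on (U i) (\<lambda>y. vol_density N i (chart_inv N i y) * (gradient N h i (chart_inv N i y) \<bullet> b))" for b
    by (intro C1_on_mult vol_C1 C1_on_inner gradient_C1 h i)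
  show ?thesis
    unfolding lap_def
    by (intro continuous_intros vol continuous_on_compose2[OF C1_on_continuous_deriv[OF C1] continuous_chart[OF i]])
      (use vol_pos[OF i] in force)+
qed

text \<open>With \<open>V b\<close> the components of \<nabla>h multiplied by the volume density,
  each partial derivative of \<open>f V b\<close> has integral zero since \<open>f\<close> has
  compact support. The density in \<open>chart_integral\<close> cancels the one by which
  \<open>lap\<close> divides, so the product rule gives the formula.\<close>

lemma local_Green:
  assumes i: "i \<in> idx N" and f: "C1_fun f" and h: "C2_fun h"
    and K: "compact K" "K \<subseteq> patch N i" and zero: "\<And>p. p \<in> patch N i - K \<Longrightarrow> f p = 0"
  shows "chart_integral i (\<lambda>p. f p * lap i h p) = - chart_integral i (pairing i f h)"
proof -
  let ?k = "chart_inv N i" and ?f = "f \<circ> chart_inv N i"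
  define V where "V b y = vol_density N i (?k y) * (gradient N h i (?k y) \<bullet> b)" for b y
  have V: "C1_on (U i) (V b)" for b
    unfolding V_def
    by (intro C1_on_mult vol_C1 C1_on_inner gradient_C1 h i)
  have fC1: "C1_on (U i) ?f" using f i by (simp add: C1_fun_def)
  have K': "compact (chart N i ` K)" "chart N i ` K \<subseteq> U i"
    using K continuous_chart[OF i] by (auto intro!: compact_continuous_image intro: continuous_on_subset)
  have f0: "?f y = 0" if "y \<in> U i - chart N i ` K" for y
  proof -
    have "?k y \<notin> K" using that i by (metis Diff_iff chart_chart_inv imageI)
    then show ?thesis using that i zero[of "?k y"] by auto
  qed
  have opn: "open (U i - chart N i ` K)"
    using open_U[OF i] K'(1) by (simp add: compact_imp_closed open_Diff)
  have df0: "frechet_derivative ?f (at y) v = 0" if "y \<in> U i - chart N i ` K" for y v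
  proof -
    have "(?f has_derivative (\<lambda>_. 0)) (at y)"
      by (rule has_derivative_transform_within_open[OF _ opn that, of "\<lambda>_. 0"]) (use f0 in auto)
    from frechet_derivative_at[OF this] show ?thesis by (metis)
  qed
  have prod: "frechet_derivative (\<lambda>y. ?f y * V b y) (at y) b
      = ?f y * frechet_derivative (V b) (at y) b + frechet_derivative ?f (at y) b * V b y" if "y \<in> U i" for b y
    using frechet_derivative_at[OF has_derivative_mult[OF C1_on_has_derivative[OF fC1 that] C1_on_has_derivative[OF V that]], symmetric, of b]
    by (simp add: fun_eq_iff)
  define A where "A b y = ?f y * frechet_derivative (V b) (at y) b" for b y
  define B where "B b y = frechet_derivative ?f (at y) b * V b y" for b y
  have cont: "continuous_on (U i) (A b)" "continuous_on (U i) (B b)" for b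
    unfolding A_def B_def
    by (intro continuous_intros C1_on_continuous[OF fC1] C1_on_continuous[OF V] C1_on_continuous_deriv V fC1)+
  have zAB: "A b y = 0" "B b y = 0" if "y \<in> U i - chart N i ` K" for b y
    using f0[OF that] df0[OF that] by (simp_all add: A_def B_def)
  note intA = integral_compact_support(2)[OF open_U[OF i] K' cont(1) zAB(1)]
  note intB = integral_compact_support(2)[OF open_U[OF i] K' cont(2) zAB(2)]
  have AB: "integral (U i) (A b) + integral (U i) (B b) = 0" for b
  proof -
    have "integral (U i) (\<lambda>y. frechet_derivative (\<lambda>y. ?f y * V b y) (at y) b) = 0"
      by (rule integral_derivative_compact_support[OF open_U[OF i] K' C1_on_mult[OF fC1 V]]) (use f0 in auto)
    also have "integral (U i) (\<lambda>y. frechet_derivative (\<lambda>y. ?f y * V b y) (at y) b) = integral (U i) (\<lambda>y. A b y + B b y)"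
      by (rule integral_cong) (simp only: prod A_def B_def)
    also have "\<dots> = integral (U i) (A b) + integral (U i) (B b)"
      by (rule integral_add) (use intA intB in auto)
    finally show ?thesis by simp
  qed
  have "chart_integral i (\<lambda>p. f p * lap i h p) = integral (U i) (\<lambda>y. \<Sum>b\<in>Basis. A b y)"
    unfolding chart_integral_def
  proof (rule integral_cong)
    fix y assume y: "y \<in> U i"
    then have "vol_density N i (?k y) > 0" using vol_pos[OF i] i by simp
    then show "f (?k y) * lap i h (?k y) * vol_density N i (?k y) = (\<Sum>b\<in>Basis. A b y)"
      using y i by (simp add: lap_def A_def V_def[abs_def] sum_distrib_left)
  qed
  also have "\<dots> = (\<Sum>b\<in>Basis. integral (U i) (A b))"
    by (rule integral_sum) (use intA in auto)
  also have "\<dots> = - (\<Sum>b\<in>Basis. integral (U i) (B b))"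
    unfolding sum_negf[symmetric] by (rule sum.cong) (use AB in \<open>auto simp: eq_neg_iff_add_eq_0\<close>)
  also have "(\<Sum>b\<in>Basis. integral (U i) (B b)) = integral (U i) (\<lambda>y. \<Sum>b\<in>Basis. B b y)"
    by (rule integral_sum[symmetric]) (use intB in auto)
  also have "\<dots> = chart_integral i (pairing i f h)"
    unfolding chart_integral_def
  proof (rule integral_cong)
    fix y assume y: "y \<in> U i"
    then have p: "?k y \<in> patch N i" using i by simp
    note lin = dd_linear[OF f i p]
    have "pairing i f h (?k y) = dd i f (?k y) (\<Sum>b\<in>Basis. (gradient N h i (?k y) \<bullet> b) *\<^sub>R b)"
      by (simp add: pairing_def euclidean_representation)
    also have "\<dots> = (\<Sum>b\<in>Basis. (gradient N h i (?k y) \<bullet> b) * dd i f (?k y) b)"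
      by (simp add: linear_sum[OF lin] linear_cmul[OF lin])
    finally show "(\<Sum>b\<in>Basis. B b y) = pairing i f h (?k y) * vol_density N i (?k y)"
      using y i by (simp add: B_def V_def dd_def sum_distrib_left sum_distrib_right mult_ac)
  qed
  finally show ?thesis .
qed

end

section \<open>Bump functions\<close>

lemma max_0_squared_has_derivative:
  "((\<lambda>s. (max 0 s)\<^sup>2) has_real_derivative 2 * max 0 s) (at (s::real))"
proof -
  consider "s > 0" | "s < 0" | "s = 0" by linarith
  then show ?thesis
  proof cases
    case 1
    have "((\<lambda>s. s\<^sup>2) has_real_derivative 2 * s) (at s)"
      by (auto intro!: derivative_eq_intros)
    then have "((\<lambda>s. (max 0 s)\<^sup>2) has_real_derivative 2 * s) (at s)"
      by (rule has_field_derivative_transform_within_open[of _ _ _ "{0<..}"]) (use 1 in auto)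
    then show ?thesis using 1 by simp
  next
    case 2
    have "((\<lambda>s. 0) has_real_derivative 0) (at s)" by simp
    then have "((\<lambda>s. (max 0 s)\<^sup>2) has_real_derivative 0) (at s)"
      by (rule has_field_derivative_transform_within_open[of _ _ _ "{..<0}"]) (use 2 in auto)
    then show ?thesis using 2 by simp
  next
    case 3
    have "((\<lambda>h::real. (max 0 (s + h))\<^sup>2 / h) \<longlongrightarrow> 0) (at 0)"
    proof (rule Lim_null_comparison)
      show "\<forall>\<^sub>F h in at 0. norm ((max 0 (s + h))\<^sup>2 / h) \<le> \<bar>h\<bar>"
      proof (rule always_eventually, rule allI)
        fix h :: real
        show "norm ((max 0 (s + h))\<^sup>2 / h) \<le> \<bar>h\<bar>"
          using 3 by (cases "h > 0") (auto simp: power2_eq_square max_def)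
      qed
      show "((\<lambda>h::real. \<bar>h\<bar>) \<longlongrightarrow> 0) (at 0)"
        by (rule tendsto_eq_intros) auto
    qed
    then show ?thesis using 3 by (simp add: DERIV_def)
  qed
qed

text \<open>The squared positive part is continuously differentiable, and one derivative is all that
  test functions and the partition of unity have to possess in Green's formula.\<close>

lemma C1_on_bump: "C1_on S (\<lambda>y. (max 0 (R\<^sup>2 - (y - c) \<bullet> (y - c)))\<^sup>2)"
  for c :: "'e::euclidean_space"
proof (rule C1_on_compose_real[where h = "\<lambda>s. (max 0 s)\<^sup>2" and h' = "\<lambda>s. 2 * max 0 s"])
  show "C1_on S (\<lambda>y. R\<^sup>2 - (y - c) \<bullet> (y - c))"
  proof (rule C1_onI)
    show "((\<lambda>y. R\<^sup>2 - (y - c) \<bullet> (y - c)) has_derivative (\<lambda>v. - 2 * ((y - c) \<bullet> v))) (at y)" for y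
      by (auto intro!: derivative_eq_intros simp: inner_commute)
  qed (intro continuous_intros)
qed (use max_0_squared_has_derivative in \<open>auto intro!: continuous_intros\<close>)

context compact_riem
begin

lemma openin_chart_image:
  assumes i: "i \<in> idx N" and W: "openin (top_of_set (points N)) W" "W \<subseteq> patch N i"
  shows "open (chart N i ` W)"
proof -
  have "openin (top_of_set (patch N i)) W"
    using W patch_subset[OF i] openin_subset_trans by blast
  then have "openin (top_of_set (U i)) (chart N i ` W)"
    using homeomorphism_imp_open_map[OF homeo[OF i]] by blast
  then show ?thesis using open_U[OF i] by (simp add: openin_open_eq)
qed

text \<open>A chart domain \<open>U j\<close> is covered by two open sets: the overlap with chart
  \<open>i\<close>, where \<open>f\<close> is composed with a transition map, and the complement of
  \<open>K\<close>, where \<open>f\<close> vanishes.\<close>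

lemma C1_fun_extend_zero:
  assumes i: "i \<in> idx N" and f: "C1_on (U i) (f \<circ> chart_inv N i)"
    and K: "compact K" "K \<subseteq> patch N i" and zero: "\<And>p. p \<in> points N - K \<Longrightarrow> f p = 0"
  shows "C1_fun f"
  unfolding C1_fun_def
proof
  fix j assume j: "j \<in> idx N"
  let ?V = "{y \<in> U j. chart_inv N j y \<in> - K}"
  have opn: "open ?V"
    using continuous_open_preimage[OF continuous_chart_inv[OF j] open_U[OF j], of "- K"] K
    by (simp add: compact_imp_closed open_Compl vimage_def Int_def)
  have "C1_on (overlap j i) (\<lambda>y. (f \<circ> chart_inv N i) (trans j i y))"
    by (rule C1_on_compose[OF f trans_C1[OF j i]]) (use trans_image[OF j i] in auto)
  then have 1: "C1_on (overlap j i) (f \<circ> chart_inv N j)"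
    by (rule C1_on_cong[OF _ open_overlap[OF j i]]) (use i j in auto)
  have 2: "C1_on ?V (f \<circ> chart_inv N j)"
    by (rule C1_on_cong[OF C1_on_const[of _ 0] opn]) (use zero patch_subset[OF j] j in auto)
  have "overlap j i \<union> ?V = U j"
    using K j by auto
  then show "C1_on (U j) (f \<circ> chart_inv N j)"
    using C1_on_Un[OF 1 2 open_overlap[OF j i] opn] by simp
qed

lemma bump_function:
  assumes i: "i \<in> idx N" and W: "openin (top_of_set (points N)) W" "W \<subseteq> patch N i" and p0: "p0 \<in> W"
  obtains f K where "C1_fun f" "compact K" "K \<subseteq> W" "\<And>p. p \<in> points N - K \<Longrightarrow> f p = 0"
    "\<And>p. f p \<ge> 0" "f p0 > 0"
proof -
  let ?y0 = "chart N i p0"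
  obtain R where R: "R > 0" "cball ?y0 R \<subseteq> chart N i ` W"
    using openin_chart_image[OF i W] p0 by (meson imageI open_contains_cball)
  define \<rho> where "\<rho> y = (max 0 (R\<^sup>2 - (y - ?y0) \<bullet> (y - ?y0)))\<^sup>2" for y
  define f where "f p = (if p \<in> patch N i then \<rho> (chart N i p) else 0)" for p
  define K where "K = chart_inv N i ` cball ?y0 R"
  have sub: "cball ?y0 R \<subseteq> U i" using R W by blast
  have K: "compact K"
    unfolding K_def by (intro compact_continuous_image continuous_on_subset[OF continuous_chart_inv[OF i] sub]) auto
  have KW: "K \<subseteq> W"
  proof
    fix p assume "p \<in> K"
    then obtain y where y: "y \<in> cball ?y0 R" "p = chart_inv N i y" by (auto simp: K_def)
    then obtain q where "q \<in> W" "y = chart N i q" using R by blast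
    then show "p \<in> W" using W y i by auto
  qed
  have \<rho>0: "\<rho> y = 0" if "y \<notin> cball ?y0 R" for y
  proof -
    have "R < norm (y - ?y0)" using that by (simp add: dist_norm norm_minus_commute)
    then have "R\<^sup>2 \<le> (y - ?y0) \<bullet> (y - ?y0)"
      using R by (simp add: power2_norm_eq_inner[symmetric] power_mono)
    then show ?thesis by (simp add: \<rho>_def)
  qed
  have zero: "f p = 0" if "p \<in> points N - K" for p
  proof (cases "p \<in> patch N i")
    case True
    have "chart N i p \<notin> cball ?y0 R"
    proof
      assume "chart N i p \<in> cball ?y0 R"
      then have "chart_inv N i (chart N i p) \<in> K" unfolding K_def by blast
      then show False using that True i by simp
    qed
    then show ?thesis by (simp add: f_def \<rho>0)
  qed (simp add: f_def)
  have "C1_fun f"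
  proof (rule C1_fun_extend_zero[OF i _ K _ zero])
    show "C1_on (U i) (f \<circ> chart_inv N i)"
      by (rule C1_on_cong[OF C1_on_bump[of _ R ?y0] open_U[OF i]]) (use i in \<open>auto simp: f_def \<rho>_def\<close>)
    show "K \<subseteq> patch N i" using KW W by blast
  qed
  moreover have "f p \<ge> 0" for p by (simp add: f_def \<rho>_def)
  moreover have "f p0 > 0" using R p0 W by (auto simp: f_def \<rho>_def)
  ultimately show thesis using that K KW zero by blast
qed

section \<open>Positivity of chart integrals and chart independence of the Laplacian\<close>

lemma chart_integral_nonneg:
  assumes "i \<in> idx N" "continuous_on (patch N i) f" "compact K" "K \<subseteq> patch N i"
    "\<And>p. p \<in> patch N i - K \<Longrightarrow> f p = 0" "\<And>p. p \<in> patch N i \<Longrightarrow> f p \<ge> 0"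
  shows "chart_integral i f \<ge> 0"
  unfolding chart_integral_def
  by (rule integral_nonneg[OF chart_integral_compact_support(5)[OF assms(1-5)]])
    (use assms(1,6) vol_pos[OF assms(1)] in \<open>auto simp: less_imp_le\<close>)

lemma chart_integral_zero_imp:
  assumes i: "i \<in> idx N" and f: "continuous_on (patch N i) f" and K: "compact K" "K \<subseteq> patch N i"
    and zero: "\<And>p. p \<in> patch N i - K \<Longrightarrow> f p = 0" and nonneg: "\<And>p. p \<in> patch N i \<Longrightarrow> f p \<ge> 0"
    and int0: "chart_integral i f = 0" and p: "p \<in> patch N i"
  shows "f p = 0"
proof -
  let ?g = "\<lambda>y. f (chart_inv N i y) * vol_density N i (chart_inv N i y)"
  note cs = chart_integral_compact_support[OF i f K zero]
  have g0: "?g y \<ge> 0" if "y \<in> U i" for y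
    using nonneg[of "chart_inv N i y"] vol_pos[OF i, of "chart_inv N i y"] i that by (simp add: less_imp_le)
  obtain a b where ab: "cbox a b \<subseteq> U i" "chart N i p \<in> box a b"
    using open_contains_cbox[OF open_U[OF i]] p by (metis imageI)
  have cont: "continuous_on (cbox a b) ?g" by (rule continuous_on_subset[OF cs(3) ab(1)])
  have "integral (cbox a b) ?g \<le> integral (U i) ?g"
    by (rule integral_subset_le[OF ab(1) integrable_continuous[OF cont] cs(5)]) (use g0 in auto)
  moreover have "integral (cbox a b) ?g \<ge> 0"
    by (rule integral_nonneg[OF integrable_continuous[OF cont]]) (use g0 ab in auto)
  ultimately have "integral (cbox a b) ?g = 0"
    using int0 by (simp add: chart_integral_def)
  then have "\<forall>y\<in>cbox a b. ?g y = 0"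
    by (subst (asm) integral_cbox_eq_0_iff[OF cont]) (use ab g0 in auto)
  then have "?g (chart N i p) = 0" using ab box_subset_cbox by blast
  then show ?thesis using vol_pos[OF i p] p i by simp
qed

lemma chart_integral_add:
  assumes i: "i \<in> idx N" and "continuous_on (patch N i) f" "continuous_on (patch N i) g" "compact K" "K \<subseteq> patch N i"
    "\<And>p. p \<in> patch N i - K \<Longrightarrow> f p = 0" "\<And>p. p \<in> patch N i - K \<Longrightarrow> g p = 0"
  shows "chart_integral i (\<lambda>p. f p + g p) = chart_integral i f + chart_integral i g"
  unfolding chart_integral_def distrib_right
  by (rule integral_add)
    (use chart_integral_compact_support(5)[OF i assms(2,4,5,6)] chart_integral_compact_support(5)[OF i assms(3,4,5,7)] in auto)

lemma chart_integral_cmult: "chart_integral i (\<lambda>p. c * f p) = c * chart_integral i f"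
  unfolding chart_integral_def by (simp add: mult.assoc)

lemma chart_integral_cong:
  "i \<in> idx N \<Longrightarrow> (\<And>p. p \<in> patch N i \<Longrightarrow> f p = g p) \<Longrightarrow> chart_integral i f = chart_integral i g"
  unfolding chart_integral_def by (rule integral_cong) auto

lemma dd_zero:
  assumes i: "i \<in> idx N" and K: "compact K" and zero: "\<And>p. p \<in> points N - K \<Longrightarrow> f p = 0"
    and p: "p \<in> patch N i - K"
  shows "dd i f p v = 0"
proof -
  let ?V = "{y \<in> U i. chart_inv N i y \<in> - K}"
  have opn: "open ?V"
    using continuous_open_preimage[OF continuous_chart_inv[OF i] open_U[OF i], of "- K"] K
    by (simp add: compact_imp_closed open_Compl vimage_def Int_def)
  have "((f \<circ> chart_inv N i) has_derivative (\<lambda>_. 0)) (at (chart N i p))"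
    by (rule has_derivative_transform_within_open[OF _ opn, of "\<lambda>_. 0"])
      (use zero p i patch_subset[OF i] in auto)
  from frechet_derivative_at[OF this] show ?thesis by (metis dd_def)
qed

text \<open>
  Both chart Laplacians satisfy the weak formulation, whose right-hand side does not depend on the
  chart; this replaces differentiating the determinant of the transition map.
\<close>

lemma lap_trans_le:
  assumes ij: "i \<in> idx N" "j \<in> idx N" and h: "C2_fun h" and p0: "p0 \<in> patch N i \<inter> patch N j"
  shows "lap i h p0 \<le> lap j h p0"
proof (rule ccontr)
  assume neg: "\<not> lap i h p0 \<le> lap j h p0"
  define D where "D p = lap i h p - lap j h p" for p
  let ?O = "patch N i \<inter> patch N j"
  have contD: "continuous_on ?O D"
    unfolding D_def
    by (intro continuous_intros continuous_on_subset[OF lap_continuous[OF h ij(1)]]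
        continuous_on_subset[OF lap_continuous[OF h ij(2)]]) auto
  \<comment> \<open>A nonnegative test function supported where the difference \<open>D\<close> is
    positive, and itself positive at \<open>p0\<close>, will have a vanishing integral against
    \<open>D\<close>, which is absurd.\<close>
  define W where "W = ?O \<inter> D -` {0<..}"
  have opO: "openin (top_of_set (points N)) ?O"
    by (intro openin_Int openin_patch ij)
  have W: "openin (top_of_set (points N)) W"
    unfolding W_def by (rule openin_trans[OF continuous_openin_preimage_gen[OF contD open_greaterThan] opO])
  have p0W: "p0 \<in> W" using p0 neg by (simp add: W_def D_def)
  obtain f K where f: "C1_fun f" "compact K" "K \<subseteq> W" "\<And>p. p \<in> points N - K \<Longrightarrow> f p = 0"
    "\<And>p. f p \<ge> 0" "f p0 > 0"
    by (rule bump_function[OF ij(1) W _ p0W]) (auto simp: W_def)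
  have KO: "K \<subseteq> ?O" using f(3) by (auto simp: W_def)
  have Ki: "K \<subseteq> patch N i" and Kj: "K \<subseteq> patch N j" using KO by auto
  have pt: "patch N i \<subseteq> points N" "patch N j \<subseteq> points N" using patch_subset ij by auto
  have C1h: "C1_fun h" by (rule C2_fun_C1_fun[OF h])
  have pz: "pairing k f h p = 0" if "k \<in> idx N" "p \<in> patch N k - K" for k p
    unfolding pairing_def by (rule dd_zero[OF that(1) f(2,4) that(2)])
  have pc: "continuous_on ?O (pairing i f h)"
    by (rule continuous_on_subset[OF pairing_continuous_patch[OF f(1) C1h ij(1)]]) auto
  \<comment> \<open>Each \<open>pairing\<close> is meaningful only in its own patch. Setting the
    value 0 off the overlap produces a single function that can be moved from one chart to the
    other.\<close>
  define P where "P p = (if p \<in> ?O then pairing i f h p else 0)" for p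
  have "chart_integral i (\<lambda>p. f p * lap i h p) = - chart_integral i (pairing i f h)"
    by (rule local_Green[OF ij(1) f(1) h f(2) Ki]) (use f(4) pt in auto)
  also have "chart_integral i (pairing i f h) = chart_integral i P"
    by (rule chart_integral_cong[OF ij(1)]) (use pz[OF ij(1)] KO in \<open>auto simp: P_def\<close>)
  also have "chart_integral i P = chart_integral j P"
  proof (rule chart_integral_trans[OF ij _ f(2) KO])
    show "continuous_on ?O P" using pc by (rule continuous_on_eq) (simp add: P_def)
  qed (use pz[OF ij(1)] in \<open>auto simp: P_def\<close>)
  also have "chart_integral j P = chart_integral j (pairing j f h)"
  proof (rule chart_integral_cong[OF ij(2)])
    fix p assume p: "p \<in> patch N j"
    show "P p = pairing j f h p"
    proof (cases "p \<in> patch N i")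
      case True
      then show ?thesis using p pairing_trans[OF ij f(1) C1h, of p] by (simp add: P_def)
    next
      case False
      then have "p \<notin> K" using Ki by auto
      then show ?thesis using pz[OF ij(2), of p] p False by (simp add: P_def)
    qed
  qed
  also have "- chart_integral j (pairing j f h) = chart_integral j (\<lambda>p. f p * lap j h p)"
    by (rule local_Green[OF ij(2) f(1) h f(2) Kj, symmetric]) (use f(4) pt in auto)
  also have "\<dots> = chart_integral i (\<lambda>p. f p * lap j h p)"
  proof (rule chart_integral_trans[OF ij(2,1) _ f(2)])
    show "continuous_on (patch N j \<inter> patch N i) (\<lambda>p. f p * lap j h p)"
      by (intro continuous_intros continuous_on_subset[OF C1_fun_continuous_patch[OF f(1) ij(2)]]
          continuous_on_subset[OF lap_continuous[OF h ij(2)]]) auto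
  qed (use KO f(4) pt in auto)
  finally have eq: "chart_integral i (\<lambda>p. f p * lap i h p) = chart_integral i (\<lambda>p. f p * lap j h p)" .
  \<comment> \<open>Outside \<open>patch N j\<close> nothing is known about \<open>lap j h\<close>.
    The products are cut off to the overlap, where they keep their support, so that the integral
    over \<open>patch N i\<close> can be split.\<close>
  define E where "E p = (if p \<in> ?O then f p * D p else 0)" for p
  define F where "F p = (if p \<in> ?O then f p * lap j h p else 0)" for p
  have cont_ext: "continuous_on (patch N i) (\<lambda>p. if p \<in> ?O then f p * g p else 0)"
    if g: "continuous_on ?O g" for g
  proof -
    have op: "openin (top_of_set (patch N i)) ?O" "openin (top_of_set (patch N i)) (patch N i - K)"
    proof -
      show "openin (top_of_set (patch N i)) ?O"
        using opO by (rule openin_subset_trans) (use pt in auto)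
      show "openin (top_of_set (patch N i)) (patch N i - K)"
        using f(2) by (metis Diff_eq compact_imp_closed open_Compl openin_open_Int)
    qed
    have "continuous_on (?O \<union> (patch N i - K)) (\<lambda>p. if p \<in> ?O then f p * g p else 0)"
    proof (rule continuous_on_Un_local_open)
      have un: "?O \<union> (patch N i - K) = patch N i" using KO by auto
      show "openin (top_of_set (?O \<union> (patch N i - K))) ?O" "openin (top_of_set (?O \<union> (patch N i - K))) (patch N i - K)"
        unfolding un by (rule op)+
      have "continuous_on ?O (\<lambda>p. f p * g p)"
        by (intro continuous_intros g continuous_on_subset[OF C1_fun_continuous_patch[OF f(1) ij(1)]]) auto
      then show "continuous_on ?O (\<lambda>p. if p \<in> ?O then f p * g p else 0)"
        by (rule continuous_on_eq) simp
      have "continuous_on (patch N i - K) (\<lambda>p. 0 :: real)" by simp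
      then show "continuous_on (patch N i - K) (\<lambda>p. if p \<in> ?O then f p * g p else 0)"
        by (rule continuous_on_eq) (use f(4) pt in auto)
    qed
    moreover have "?O \<union> (patch N i - K) = patch N i" using KO by auto
    ultimately show ?thesis by simp
  qed
  have contE: "continuous_on (patch N i) E" unfolding E_def by (rule cont_ext[OF contD])
  have contF: "continuous_on (patch N i) F"
    unfolding F_def by (rule cont_ext) (rule continuous_on_subset[OF lap_continuous[OF h ij(2)]], auto)
  have zE: "E p = 0" if "p \<in> patch N i - K" for p using f(4)[of p] that pt by (auto simp: E_def)
  have zF: "F p = 0" if "p \<in> patch N i - K" for p using f(4)[of p] that pt by (auto simp: F_def)
  have f0: "f p = 0" if "p \<in> patch N i" "p \<notin> patch N j" for p
    using f(4)[of p] that pt KO by auto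
  have "chart_integral i (\<lambda>p. E p + F p) = chart_integral i E + chart_integral i F"
    by (rule chart_integral_add[OF ij(1) contE contF f(2) Ki zE zF])
  moreover have "chart_integral i (\<lambda>p. E p + F p) = chart_integral i (\<lambda>p. f p * lap i h p)"
    by (rule chart_integral_cong[OF ij(1)]) (auto simp: E_def F_def D_def f0 algebra_simps)
  moreover have "chart_integral i F = chart_integral i (\<lambda>p. f p * lap j h p)"
    by (rule chart_integral_cong[OF ij(1)]) (auto simp: F_def f0)
  ultimately have "chart_integral i E = 0" using eq by simp
  moreover have "E p \<ge> 0" if "p \<in> patch N i" for p
  proof (cases "p \<in> K")
    case True
    then have "p \<in> W" using f(3) by auto
    then show ?thesis using f(5)[of p] by (simp add: E_def W_def)
  qed (use zE that in auto)
  ultimately have "E p0 = 0"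
    by (intro chart_integral_zero_imp[OF ij(1) contE f(2) Ki zE]) (use p0 in auto)
  moreover have "E p0 > 0" using p0W f(6) by (simp add: E_def W_def)
  ultimately show False by simp
qed

lemma lap_trans:
  assumes "i \<in> idx N" "j \<in> idx N" "C2_fun h" "p \<in> patch N i \<inter> patch N j"
  shows "lap i h p = lap j h p"
  using lap_trans_le[OF assms] lap_trans_le[OF assms(2,1,3), of p] assms(4) by auto

text \<open>Every point has a bump function positive near it and supported in one patch. Compactness
  leaves finitely many of them with positive sum, and dividing by this sum normalizes them.\<close>

lemma partition_of_unity:
  obtains A :: "'a set" and \<theta> :: "'a \<Rightarrow> 'a \<Rightarrow> real" and K :: "'a \<Rightarrow> 'a set" and \<iota> :: "'a \<Rightarrow> 'i"
  where "finite A" "\<And>a. a \<in> A \<Longrightarrow> \<iota> a \<in> idx N" "\<And>a. a \<in> A \<Longrightarrow> compact (K a)"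
    "\<And>a. a \<in> A \<Longrightarrow> K a \<subseteq> patch N (\<iota> a)" "\<And>a. a \<in> A \<Longrightarrow> C1_fun (\<theta> a)"
    "\<And>a p. a \<in> A \<Longrightarrow> p \<in> points N - K a \<Longrightarrow> \<theta> a p = 0"
    "\<And>a p. a \<in> A \<Longrightarrow> p \<in> points N \<Longrightarrow> \<theta> a p \<ge> 0"
    "\<And>p. p \<in> points N \<Longrightarrow> (\<Sum>a\<in>A. \<theta> a p) = 1"
proof -
  \<comment> \<open>The conditions are packed into one predicate so that neighbourhood, chart,
    function and support can be chosen simultaneously as functions of the point.\<close>
  define Q where "Q a T i f K \<longleftrightarrow> open T \<and> a \<in> T \<and> i \<in> idx N \<and> compact K \<and> K \<subseteq> patch N i \<and> C1_fun f \<and>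
      (\<forall>p\<in>points N - K. f p = 0) \<and> (\<forall>p. f p \<ge> 0) \<and> (\<forall>p\<in>points N \<inter> T. f p > 0)"
    for a T i f K
  have ex: "\<exists>T i f K. Q a T i f K" if "a \<in> points N" for a
  proof -
    obtain i where i: "i \<in> idx N" "a \<in> patch N i" using \<open>a \<in> points N\<close> by (auto simp: points_eq)
    obtain f K where f: "C1_fun f" "compact K" "K \<subseteq> patch N i" "\<And>p. p \<in> points N - K \<Longrightarrow> f p = 0"
      "\<And>p. f p \<ge> 0" "f a > 0"
      by (rule bump_function[OF i(1) openin_patch[OF i(1)] _ i(2)]) auto
    have "openin (top_of_set (points N)) (points N \<inter> f -` {0<..})"
      by (rule continuous_openin_preimage_gen[OF C1_fun_continuous[OF f(1)]]) simp
    then obtain T where T: "open T" "points N \<inter> f -` {0<..} = points N \<inter> T"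
      by (auto simp: openin_open)
    have "a \<in> T" using T(2) f(6) \<open>a \<in> points N\<close> by blast
    moreover have "\<forall>p\<in>points N \<inter> T. f p > 0" unfolding T(2)[symmetric] by simp
    ultimately have "Q a T i f K" unfolding Q_def using T(1) i f by blast
    then show ?thesis by blast
  qed
  then obtain T \<iota> \<rho> K where Q: "\<And>a. a \<in> points N \<Longrightarrow> Q a (T a) (\<iota> a) (\<rho> a) (K a)"
    by metis
  have *: "\<And>a. a \<in> points N \<Longrightarrow> open (T a)" "\<And>a. a \<in> points N \<Longrightarrow> a \<in> T a"
    "\<And>a. a \<in> points N \<Longrightarrow> \<iota> a \<in> idx N" "\<And>a. a \<in> points N \<Longrightarrow> compact (K a)"
    "\<And>a. a \<in> points N \<Longrightarrow> K a \<subseteq> patch N (\<iota> a)" "\<And>a. a \<in> points N \<Longrightarrow> C1_fun (\<rho> a)"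
    "\<And>a p. a \<in> points N \<Longrightarrow> p \<in> points N - K a \<Longrightarrow> \<rho> a p = 0"
    "\<And>a p. a \<in> points N \<Longrightarrow> \<rho> a p \<ge> 0"
    "\<And>a p. a \<in> points N \<Longrightarrow> p \<in> points N \<inter> T a \<Longrightarrow> \<rho> a p > 0"
    using Q unfolding Q_def by blast+
  obtain A where A: "A \<subseteq> points N" "finite A" "points N \<subseteq> (\<Union>a\<in>A. T a)"
    using compactE_image[OF compact_points, of "points N" T] *(1,2) by blast
  define s where "s p = (\<Sum>a\<in>A. \<rho> a p)" for p
  have spos: "s p > 0" if p: "p \<in> points N" for p
  proof -
    obtain a where a: "a \<in> A" "p \<in> T a" using A p by blast
    show ?thesis unfolding s_def
      by (rule sum_pos2[OF A(2) a(1)]) (use *(8,9) A a p in auto)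
  qed
  define \<theta> where "\<theta> a p = \<rho> a p / s p" for a p
  have C1: "C1_fun (\<theta> a)" if "a \<in> A" for a
    unfolding C1_fun_def
  proof
    fix i assume i: "i \<in> idx N"
    have "C1_on (U i) (\<lambda>y. \<rho> a (chart_inv N i y) / (\<Sum>a\<in>A. \<rho> a (chart_inv N i y)))"
    proof (intro C1_on_divide C1_on_sum)
      show "C1_on (U i) (\<lambda>y. \<rho> b (chart_inv N i y))" if "b \<in> A" for b
        using *(6)[of b] A that i by (auto simp: C1_fun_def o_def)
      then show "C1_on (U i) (\<lambda>y. \<rho> a (chart_inv N i y))" using \<open>a \<in> A\<close> .
      show "(\<Sum>a\<in>A. \<rho> a (chart_inv N i y)) \<noteq> 0" if "y \<in> U i" for y
        using spos[of "chart_inv N i y"] patch_subset[OF i] chart_inv_in[OF i that] by (auto simp: s_def)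
    qed
    then show "C1_on (U i) (\<theta> a \<circ> chart_inv N i)"
      by (simp add: \<theta>_def s_def o_def)
  qed
  show thesis
  proof (rule that[of A \<iota> K \<theta>])
    show "(\<Sum>a\<in>A. \<theta> a p) = 1" if "p \<in> points N" for p
      using spos[OF that] by (simp add: \<theta>_def sum_divide_distrib[symmetric] s_def[symmetric])
    show "\<theta> a p \<ge> 0" if "a \<in> A" "p \<in> points N" for a p
    proof -
      have "\<rho> a p \<ge> 0" using *(8)[of a p] that A by auto
      then show ?thesis using spos[OF that(2)] by (simp add: \<theta>_def)
    qed
    show "K a \<subseteq> patch N (\<iota> a)" if "a \<in> A" for a
      using *(5)[of a] A that by blast
  qed (use * A C1 in \<open>auto simp: \<theta>_def\<close>)
qed

end

section \<open>Integration over the compact manifold, for a fixed partition of unity\<close>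

locale compact_riem_pou = compact_riem N
  for N :: "('i, 'a::{t2_space, second_countable_topology}, 'e::euclidean_space) riem" +
  fixes A :: "'a set" and \<theta> :: "'a \<Rightarrow> 'a \<Rightarrow> real" and K :: "'a \<Rightarrow> 'a set" and \<iota> :: "'a \<Rightarrow> 'i"
  assumes pou: "finite A" "\<And>a. a \<in> A \<Longrightarrow> \<iota> a \<in> idx N" "\<And>a. a \<in> A \<Longrightarrow> compact (K a)"
    "\<And>a. a \<in> A \<Longrightarrow> K a \<subseteq> patch N (\<iota> a)" "\<And>a. a \<in> A \<Longrightarrow> C1_fun (\<theta> a)"
    "\<And>a p. a \<in> A \<Longrightarrow> p \<in> points N - K a \<Longrightarrow> \<theta> a p = 0"
    "\<And>a p. a \<in> A \<Longrightarrow> p \<in> points N \<Longrightarrow> \<theta> a p \<ge> 0"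
    "\<And>p. p \<in> points N \<Longrightarrow> (\<Sum>a\<in>A. \<theta> a p) = 1"
begin

text \<open>The integral over N for the Riemannian measure. For continuous \<open>f\<close> each
  summand has its support in the compact set \<open>K a\<close> inside one patch, so the lemmas on
  chart integrals apply to it.\<close>

definition I :: "('a \<Rightarrow> real) \<Rightarrow> real" where
  "I f = (\<Sum>a\<in>A. chart_integral (\<iota> a) (\<lambda>p. \<theta> a p * f p))"

definition lapN :: "('a \<Rightarrow> real) \<Rightarrow> 'a \<Rightarrow> real" where
  "lapN h p = lap (chart_at N p) h p"

definition prN :: "('a \<Rightarrow> real) \<Rightarrow> ('a \<Rightarrow> real) \<Rightarrow> 'a \<Rightarrow> real" where
  "prN f h p = pairing (chart_at N p) f h p"

lemma chart_at: "p \<in> points N \<Longrightarrow> chart_at N p \<in> idx N \<and> p \<in> patch N (chart_at N p)"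
  unfolding chart_at_def by (rule someI_ex) (auto simp: points_eq)

lemma lapN_eq: "C2_fun h \<Longrightarrow> i \<in> idx N \<Longrightarrow> p \<in> patch N i \<Longrightarrow> lapN h p = lap i h p"
  unfolding lapN_def using chart_at[of p] patch_subset[of i] by (intro lap_trans) auto

lemma prN_eq: "C1_fun f \<Longrightarrow> C1_fun h \<Longrightarrow> i \<in> idx N \<Longrightarrow> p \<in> patch N i \<Longrightarrow> prN f h p = pairing i f h p"
  unfolding prN_def using chart_at[of p] patch_subset[of i] by (intro pairing_trans) auto

lemma lapN_continuous:
  assumes "C2_fun h" shows "continuous_on (points N) (lapN h)"
proof (rule continuous_on_points)
  fix i assume i: "i \<in> idx N"
  show "continuous_on (patch N i) (lapN h)"
    using lap_continuous[OF assms i] by (rule continuous_on_eq) (simp add: lapN_eq[OF assms i])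
qed

lemma prN_continuous:
  assumes "C1_fun f" "C1_fun h" shows "continuous_on (points N) (prN f h)"
proof (rule continuous_on_points)
  fix i assume i: "i \<in> idx N"
  show "continuous_on (patch N i) (prN f h)"
    using pairing_continuous_patch[OF assms i] by (rule continuous_on_eq) (simp add: prN_eq[OF assms i])
qed

lemma prN_self_nonneg: "C1_fun f \<Longrightarrow> p \<in> points N \<Longrightarrow> prN f f p \<ge> 0"
  unfolding prN_def using chart_at pairing_self_nonneg by blast

lemma pou_props:
  assumes a: "a \<in> A" and f: "continuous_on (points N) f"
  shows "continuous_on (patch N (\<iota> a)) (\<lambda>p. \<theta> a p * f p)"
    "\<And>p. p \<in> patch N (\<iota> a) - K a \<Longrightarrow> \<theta> a p * f p = 0"
proof -
  have sub: "patch N (\<iota> a) \<subseteq> points N" using patch_subset pou(2)[OF a] by auto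
  show "continuous_on (patch N (\<iota> a)) (\<lambda>p. \<theta> a p * f p)"
    by (intro continuous_intros continuous_on_subset[OF f sub] C1_fun_continuous_patch pou a)
  show "\<theta> a p * f p = 0" if "p \<in> patch N (\<iota> a) - K a" for p
    using pou(6)[OF a, of p] that sub by auto
qed

lemma I_cong:
  assumes "\<And>p. p \<in> points N \<Longrightarrow> f p = g p" shows "I f = I g"
  unfolding I_def
  by (rule sum.cong[OF refl], rule chart_integral_cong) (use assms pou(2) patch_subset in auto)

lemma I_add:
  assumes "continuous_on (points N) f" "continuous_on (points N) g"
  shows "I (\<lambda>p. f p + g p) = I f + I g"
  unfolding I_def sum.distrib[symmetric] distrib_left
  by (rule sum.cong[OF refl], rule chart_integral_add[OF pou(2) pou_props(1)[OF _ assms(1)]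
        pou_props(1)[OF _ assms(2)] pou(3,4) pou_props(2)[OF _ assms(1)] pou_props(2)[OF _ assms(2)]])

lemma I_cmult: "I (\<lambda>p. c * f p) = c * I f"
proof -
  have "I (\<lambda>p. c * f p) = (\<Sum>a\<in>A. chart_integral (\<iota> a) (\<lambda>p. c * (\<theta> a p * f p)))"
    by (simp add: I_def mult_ac)
  then show ?thesis by (simp only: chart_integral_cmult I_def sum_distrib_left)
qed

lemma I_zero: "I (\<lambda>p. 0) = 0"
  using I_cmult[of 0 "\<lambda>_. 0"] by simp

lemma I_diff:
  assumes "continuous_on (points N) f" "continuous_on (points N) g"
  shows "I (\<lambda>p. f p - g p) = I f - I g"
  using I_add[OF assms(1) continuous_on_mult_left[OF assms(2), of "-1"]] I_cmult[of "-1" g] by simp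

lemma I_sum:
  assumes "\<And>b. b \<in> B \<Longrightarrow> continuous_on (points N) (f b)"
  shows "I (\<lambda>p. \<Sum>b\<in>B. f b p) = (\<Sum>b\<in>B. I (f b))"
  using assms
proof (induction B rule: infinite_finite_induct)
  case (insert b B)
  then show ?case by (simp add: I_add continuous_on_sum)
qed (simp_all add: I_zero)

lemma I_nonneg:
  assumes f: "continuous_on (points N) f" and "\<And>p. p \<in> points N \<Longrightarrow> f p \<ge> 0"
  shows "I f \<ge> 0"
  unfolding I_def
proof (rule sum_nonneg)
  fix a assume a: "a \<in> A"
  have "patch N (\<iota> a) \<subseteq> points N" using patch_subset pou(2)[OF a] by auto
  then show "chart_integral (\<iota> a) (\<lambda>p. \<theta> a p * f p) \<ge> 0"
    using assms(2) pou(7)[OF a] by (intro chart_integral_nonneg[OF pou(2)[OF a] pou_props(1)[OF a f] pou(3,4)[OF a] pou_props(2)[OF a f]]) auto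
qed

lemma I_mono:
  assumes "continuous_on (points N) f" "continuous_on (points N) g" "\<And>p. p \<in> points N \<Longrightarrow> f p \<le> g p"
  shows "I f \<le> I g"
proof -
  have "I (\<lambda>p. g p - f p) \<ge> 0"
    by (rule I_nonneg) (use assms in \<open>auto intro: continuous_intros\<close>)
  then show ?thesis using I_diff[OF assms(2,1)] by simp
qed

lemma I_zero_imp:
  assumes f: "continuous_on (points N) f" and nonneg: "\<And>p. p \<in> points N \<Longrightarrow> f p \<ge> 0" and "I f = 0"
    and p: "p \<in> points N"
  shows "f p = 0"
proof -
  obtain a where a: "a \<in> A" "\<theta> a p \<noteq> 0"
    using pou(8)[OF p] by (metis sum.neutral zero_neq_one)
  have sub: "patch N (\<iota> b) \<subseteq> points N" if "b \<in> A" for b using patch_subset pou(2)[OF that] by auto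
  have nn: "chart_integral (\<iota> b) (\<lambda>p. \<theta> b p * f p) \<ge> 0" if b: "b \<in> A" for b
    using nonneg pou(7)[OF b] sub[OF b]
    by (intro chart_integral_nonneg[OF pou(2)[OF b] pou_props(1)[OF b f] pou(3,4)[OF b] pou_props(2)[OF b f]]) auto
  then have "chart_integral (\<iota> a) (\<lambda>p. \<theta> a p * f p) = 0"
    using \<open>I f = 0\<close> a(1) pou(1) by (simp add: I_def sum_nonneg_eq_0_iff)
  moreover have "p \<in> patch N (\<iota> a)"
    using pou(6)[OF a(1), of p] a p pou(4)[OF a(1)] by blast
  ultimately have "\<theta> a p * f p = 0"
    using nonneg pou(7)[OF a(1)] sub[OF a(1)]
    by (intro chart_integral_zero_imp[OF pou(2)[OF a(1)] pou_props(1)[OF a(1) f] pou(3,4)[OF a(1)] pou_props(2)[OF a(1) f]]) auto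
  then show ?thesis using a by simp
qed

text \<open>Each piece \<open>\<theta> a p * f p\<close> is supported in the overlap of its own
  patch with \<open>patch N i\<close>, hence can be moved to chart \<open>i\<close>, where the
  pieces add up to \<open>f\<close>.\<close>

lemma I_local:
  assumes i: "i \<in> idx N" and f: "continuous_on (points N) f" and K': "compact K'" "K' \<subseteq> patch N i"
    and zero: "\<And>p. p \<in> points N - K' \<Longrightarrow> f p = 0"
  shows "I f = chart_integral i f"
proof -
  have sub: "patch N j \<subseteq> points N" if "j \<in> idx N" for j using patch_subset[OF that] .
  have c: "continuous_on (patch N i) (\<lambda>p. \<theta> a p * f p)" if a: "a \<in> A" for a
    by (intro continuous_intros continuous_on_subset[OF f sub[OF i]] C1_fun_continuous_patch pou a i)
  have "I f = (\<Sum>a\<in>A. chart_integral i (\<lambda>p. \<theta> a p * f p))"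
    unfolding I_def
  proof (rule sum.cong[OF refl])
    fix a assume a: "a \<in> A"
    show "chart_integral (\<iota> a) (\<lambda>p. \<theta> a p * f p) = chart_integral i (\<lambda>p. \<theta> a p * f p)"
    proof (rule chart_integral_trans[OF pou(2)[OF a] i, of _ "K a \<inter> K'"])
      show "continuous_on (patch N (\<iota> a) \<inter> patch N i) (\<lambda>p. \<theta> a p * f p)"
        by (rule continuous_on_subset[OF c[OF a]]) auto
      show "compact (K a \<inter> K')" using pou(3)[OF a] K' by (intro compact_Int)
      show "K a \<inter> K' \<subseteq> patch N (\<iota> a) \<inter> patch N i" using pou(4)[OF a] K' by auto
      show "\<theta> a p * f p = 0" if "p \<in> patch N (\<iota> a) \<union> patch N i - K a \<inter> K'" for p
      proof -
        have "p \<in> points N" using that sub[OF i] sub[OF pou(2)[OF a]] by auto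
        then show ?thesis using that pou(6)[OF a, of p] zero[of p] by auto
      qed
    qed
  qed
  also have "\<dots> = chart_integral i (\<lambda>p. \<Sum>a\<in>A. \<theta> a p * f p)"
  proof -
    have z: "\<theta> a p * f p = 0" if "p \<in> patch N i - K'" for a p
      using zero[of p] that sub[OF i] by auto
    show ?thesis
      unfolding chart_integral_def sum_distrib_right
      by (rule integral_sum[symmetric, OF pou(1)])
        (rule chart_integral_compact_support(5)[OF i c K' z])
  qed
  also have "\<dots> = chart_integral i f"
    by (rule chart_integral_cong[OF i]) (use pou(8) sub[OF i] in \<open>auto simp: sum_distrib_right[symmetric]\<close>)
  finally show ?thesis .
qed

lemma dd_cong:
  assumes i: "i \<in> idx N" and p: "p \<in> patch N i" and "C1_fun g" and "\<And>q. q \<in> points N \<Longrightarrow> f q = g q"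
  shows "dd i f p = dd i g p"
proof -
  have "((f \<circ> chart_inv N i) has_derivative dd i g p) (at (chart N i p))"
    by (rule has_derivative_transform_within_open[OF C1_fun_has_derivative[OF assms(3) i p] open_U[OF i]])
      (use assms(4) patch_subset[OF i] p i in auto)
  from frechet_derivative_at[OF this] show ?thesis by (simp add: dd_def)
qed

lemma C1_fun_mult: "C1_fun f \<Longrightarrow> C1_fun g \<Longrightarrow> C1_fun (\<lambda>p. f p * g p)"
  unfolding C1_fun_def o_def by (auto intro: C1_on_mult)

lemma dd_sum:
  assumes "\<And>b. b \<in> B \<Longrightarrow> C1_fun (f b)" and i: "i \<in> idx N" and p: "p \<in> patch N i"
  shows "dd i (\<lambda>q. \<Sum>b\<in>B. f b q) p v = (\<Sum>b\<in>B. dd i (f b) p v)"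
proof -
  have "((\<lambda>y. \<Sum>b\<in>B. (f b \<circ> chart_inv N i) y) has_derivative (\<lambda>v. \<Sum>b\<in>B. dd i (f b) p v)) (at (chart N i p))"
    by (rule has_derivative_sum, rule C1_fun_has_derivative[OF assms(1) i p])
  from frechet_derivative_at[OF this] show ?thesis by (simp add: dd_def o_def) metis
qed

text \<open>\<open>local_Green\<close> is applied to the products of \<open>f\<close> with the
  members of the partition. No derivative of \<open>\<theta>\<close> survives: these products sum to
  \<open>f\<close> on all of N, so their differentials sum to the differential of
  \<open>f\<close>.\<close>

lemma Green:
  assumes f: "C1_fun f" and h: "C2_fun h"
  shows "I (\<lambda>p. f p * lapN h p) = - I (prN f h)"
proof -
  have C1h: "C1_fun h" by (rule C2_fun_C1_fun[OF h])
  define F where "F a p = \<theta> a p * f p" for a p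
  have F: "C1_fun (F a)" if "a \<in> A" for a
    unfolding F_def by (intro C1_fun_mult pou that f)
  have F0: "F a p = 0" if "a \<in> A" "p \<in> points N - K a" for a p
    using pou(6)[OF that] by (simp add: F_def)
  have sub: "patch N (\<iota> a) \<subseteq> points N" if "a \<in> A" for a using patch_subset pou(2)[OF that] by auto
  have "chart_integral (\<iota> a) (\<lambda>p. \<theta> a p * (f p * lapN h p)) = - I (prN (F a) h)" if a: "a \<in> A" for a
  proof -
    have "chart_integral (\<iota> a) (\<lambda>p. \<theta> a p * (f p * lapN h p)) = chart_integral (\<iota> a) (\<lambda>p. F a p * lap (\<iota> a) h p)"
      by (rule chart_integral_cong[OF pou(2)[OF a]]) (simp add: F_def lapN_eq[OF h pou(2)[OF a]])
    also have "\<dots> = - chart_integral (\<iota> a) (pairing (\<iota> a) (F a) h)"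
      by (rule local_Green[OF pou(2)[OF a] F[OF a] h pou(3,4)[OF a]]) (use F0[OF a] sub[OF a] in auto)
    also have "chart_integral (\<iota> a) (pairing (\<iota> a) (F a) h) = chart_integral (\<iota> a) (prN (F a) h)"
      by (rule chart_integral_cong[OF pou(2)[OF a]]) (simp add: prN_eq[OF F[OF a] C1h pou(2)[OF a]])
    also have "\<dots> = I (prN (F a) h)"
    proof (rule I_local[OF pou(2)[OF a] prN_continuous[OF F[OF a] C1h] pou(3,4)[OF a], symmetric])
      fix p assume p: "p \<in> points N - K a"
      then show "prN (F a) h p = 0"
        unfolding prN_def pairing_def
        using chart_at[of p] by (intro dd_zero[of _ "K a"] pou(3)[OF a] F0[OF a]) auto
    qed
    finally show ?thesis .
  qed
  then have "I (\<lambda>p. f p * lapN h p) = - (\<Sum>a\<in>A. I (prN (F a) h))"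
    unfolding I_def[of "\<lambda>p. f p * lapN h p"] by (simp add: sum_negf)
  also have "(\<Sum>a\<in>A. I (prN (F a) h)) = I (\<lambda>p. \<Sum>a\<in>A. prN (F a) h p)"
    by (rule I_sum[symmetric]) (rule prN_continuous[OF F C1h])
  also have "\<dots> = I (prN f h)"
  proof (rule I_cong)
    fix p assume p: "p \<in> points N"
    let ?i = "chart_at N p"
    have i: "?i \<in> idx N" "p \<in> patch N ?i" using chart_at[OF p] by auto
    have "(\<Sum>a\<in>A. prN (F a) h p) = dd ?i (\<lambda>q. \<Sum>a\<in>A. F a q) p (gradient N h ?i p)"
      unfolding prN_def pairing_def by (rule dd_sum[symmetric, OF F i])
    also have "dd ?i (\<lambda>q. \<Sum>a\<in>A. F a q) p = dd ?i f p"
      by (rule dd_cong[OF i f]) (simp add: F_def sum_distrib_right[symmetric] pou(8))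
    finally show "(\<Sum>a\<in>A. prN (F a) h p) = prN f h p"
      by (simp add: prN_def pairing_def)
  qed
  finally show ?thesis .
qed

text \<open>Joint continuity of \<open>F'\<close> and compactness of N make \<open>F' s\<close>
  converge to \<open>F' t\<close> uniformly. By the mean value theorem the difference quotients
  converge uniformly too, and \<open>I\<close>, being positive and linear, respects uniform
  bounds.\<close>

lemma I_has_real_derivative:
  assumes J: "open J" "t \<in> J"
    and der: "\<And>s p. s \<in> J \<Longrightarrow> p \<in> points N \<Longrightarrow> ((\<lambda>s. F s p) has_real_derivative F' s p) (at s)"
    and F: "\<And>s. s \<in> J \<Longrightarrow> continuous_on (points N) (F s)"
    and F': "continuous_on (J \<times> points N) (\<lambda>(s, p). F' s p)"
  shows "((\<lambda>s. I (F s)) has_real_derivative I (F' t)) (at t)"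
proof -
  have F't: "continuous_on (points N) (F' s)" if "s \<in> J" for s
  proof -
    have "continuous_on (points N) (\<lambda>p. (s, p))" by (intro continuous_intros)
    from continuous_on_compose2[OF F' this] that show ?thesis by auto
  qed
  have c1: "continuous_on (points N) (\<lambda>_. 1 :: real)" by simp
  have "((\<lambda>h. (I (F (t + h)) - I (F t)) / h) \<longlongrightarrow> I (F' t)) (at 0)"
    unfolding tendsto_iff
  proof (intro allI impI)
    fix e :: real assume e: "e > 0"
    \<comment> \<open>The summand 1 keeps the denominator positive even if
      \<open>I (\<lambda>_. 1)\<close> is 0, and the factor 2 makes the final inequality
      strict.\<close>
    define e' where "e' = e / (2 * (I (\<lambda>_. 1) + 1))"
    have I1: "I (\<lambda>_. 1) \<ge> 0" by (rule I_nonneg[OF c1]) auto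
    have e': "e' > 0" "e' * I (\<lambda>_. 1) < e"
    proof -
      show "e' > 0" using e I1 by (simp add: e'_def)
      have "e' * I (\<lambda>_. 1) \<le> e' * (I (\<lambda>_. 1) + 1)" using \<open>e' > 0\<close> by simp
      also have "\<dots> = e / 2" using I1 by (simp add: e'_def field_simps)
      finally show "e' * I (\<lambda>_. 1) < e" using e by simp
    qed
    obtain X0 where X0: "t \<in> X0" "open X0" "\<forall>s\<in>X0 \<inter> J. \<forall>p\<in>points N. dist (F' s p) (F' t p) \<le> e'"
      using continuous_on_prod_compactE[OF F' compact_points J(2) e'(1)] by (auto simp: split_def)
    obtain d where d: "d > 0" "ball t d \<subseteq> X0 \<inter> J"
      using X0 J by (meson IntI open_Int open_contains_ball)
    have "dist ((I (F (t + h)) - I (F t)) / h) (I (F' t)) < e" if h: "h \<noteq> 0" "dist h 0 < d" for h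
    proof -
      have th: "t + h \<in> J" using d h by (auto simp: dist_norm subset_iff)
      have bd: "\<bar>(1 / h) * (F (t + h) p - F t p) - F' t p\<bar> \<le> e'" if p: "p \<in> points N" for p
      proof -
        have seg: "s \<in> X0 \<inter> J" if "min t (t + h) \<le> s" "s \<le> max t (t + h)" for s
        proof -
          have "dist s t < d" using that h by (auto simp: dist_real_def min_def max_def split: if_splits)
          then show ?thesis using d by (auto simp: dist_commute)
        qed
        have "min t (t + h) < max t (t + h)" using h by auto
        from MVT2[OF this der[OF _ p]] seg obtain z where z: "min t (t + h) < z" "z < max t (t + h)"
          "F (max t (t + h)) p - F (min t (t + h)) p = (max t (t + h) - min t (t + h)) * F' z p"
          by (metis IntD2)
        have "F (t + h) p - F t p = h * F' z p"
          using z(3) by (cases "h > 0") (auto simp: min_def max_def algebra_simps split: if_splits)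
        then have "(1 / h) * (F (t + h) p - F t p) - F' t p = F' z p - F' t p" using h by simp
        moreover have "dist (F' z p) (F' t p) \<le> e'" using X0(3) seg[of z] z p by auto
        ultimately show ?thesis by (simp add: dist_real_def)
      qed
      let ?q = "\<lambda>p. (1 / h) * (F (t + h) p - F t p) - F' t p"
      have cq: "continuous_on (points N) (\<lambda>p. (1 / h) * (F (t + h) p - F t p))" "continuous_on (points N) ?q"
        by (intro continuous_intros F F't th J)+
      have Iq: "I ?q = (I (F (t + h)) - I (F t)) / h - I (F' t)"
        by (simp only: I_diff[OF cq(1) F't[OF J(2)]] I_cmult I_diff[OF F[OF th] F[OF J(2)]]) (simp add: field_simps)
      have "I ?q \<le> I (\<lambda>p. e' * 1)"
        by (rule I_mono[OF cq(2)]) (use bd in \<open>auto simp: abs_le_iff\<close>)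
      moreover have "I (\<lambda>p. - e' * 1) \<le> I ?q"
      proof (rule I_mono[OF _ cq(2)])
        show "- e' * 1 \<le> ?q p" if "p \<in> points N" for p
          using bd[OF that] unfolding abs_le_iff by linarith
      qed simp
      ultimately have "\<bar>I ?q\<bar> \<le> e' * I (\<lambda>_. 1)"
        unfolding I_cmult by (simp add: abs_le_iff)
      then show ?thesis using e'(2) unfolding Iq dist_real_def by linarith
    qed
    then show "\<forall>\<^sub>F h in at 0. dist ((I (F (t + h)) - I (F t)) / h) (I (F' t)) < e"
      using d(1) by (auto simp: eventually_at)
  qed
  then show ?thesis by (simp add: DERIV_def)
qed

end

section \<open>The Carleman argument in one variable\<close>

text \<open>
  The functions stand for \<open>m = \<integral>w\<^sup>2\<close>, \<open>p = \<integral>w w'\<close>, \<open>k = \<integral>w'\<^sup>2\<close>, \<open>g = \<integral>\<bar>\<nabla>w\<bar>\<^sup>2\<close>, \<open>h = \<integral>F w'\<close>,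
  \<open>s = \<integral>F w\<close> and \<open>f2 = \<integral>F\<^sup>2\<close>, integrated over \<open>N\<close> at time \<open>t\<close>, with \<open>F = w'' + \<Delta>w - c w\<close>; \<open>quad\<close> says
  that \<open>\<integral>(\<alpha> F + \<beta> w' + \<delta> w)\<^sup>2 \<ge> 0\<close>.
\<close>

locale carleman_ode =
  fixes m p k g h s f2 \<phi> \<phi>1 \<phi>2 \<phi>3 Q1 Q2 :: "real \<Rightarrow> real" and c t1 A B :: real
  assumes dm: "\<And>t. t > t1 \<Longrightarrow> (m has_real_derivative 2 * p t) (at t)"
    and dkg: "\<And>t. t > t1 \<Longrightarrow> ((\<lambda>t. k t - g t) has_real_derivative 2 * h t + 2 * c * p t) (at t)"
    and dp: "\<And>t. t > t1 \<Longrightarrow> (p has_real_derivative k t + g t + s t + c * m t) (at t)"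
    and quad: "\<And>t \<alpha> \<beta> \<delta>. t > t1 \<Longrightarrow>
      0 \<le> \<alpha>\<^sup>2 * f2 t + \<beta>\<^sup>2 * k t + \<delta>\<^sup>2 * m t + 2 * \<alpha> * \<beta> * h t + 2 * \<alpha> * \<delta> * s t + 2 * \<beta> * \<delta> * p t"
    and g_nonneg: "\<And>t. t > t1 \<Longrightarrow> 0 \<le> g t"
    and f2_le: "\<And>t. t > t1 \<Longrightarrow> f2 t \<le> 2 * (Q1 t)\<^sup>2 * m t + 2 * (Q2 t)\<^sup>2 * (2 * k t + 2 * c * m t + g t)"
    and c: "c \<ge> 0"
    and d\<phi>: "\<And>t. t > t1 \<Longrightarrow> (\<phi> has_real_derivative \<phi>1 t) (at t)"
    and d\<phi>1: "\<And>t. t > t1 \<Longrightarrow> (\<phi>1 has_real_derivative \<phi>2 t) (at t)"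
    and d\<phi>2: "\<And>t. t > t1 \<Longrightarrow> (\<phi>2 has_real_derivative \<phi>3 t) (at t)"
    and A: "A > 0" and B: "B \<ge> 1"
    and \<phi>_nonneg: "\<And>t. t > t1 \<Longrightarrow> \<phi> t \<ge> 0"
    and \<phi>1_pos: "\<And>t. t > t1 \<Longrightarrow> \<phi>1 t > 0" and \<phi>2_pos: "\<And>t. t > t1 \<Longrightarrow> \<phi>2 t > 0"
    and \<phi>2_le: "\<And>t. t > t1 \<Longrightarrow> \<phi>2 t \<le> A * (\<phi>1 t)\<^sup>2"
    and \<phi>3_le: "\<And>t. t > t1 \<Longrightarrow> \<bar>\<phi>3 t\<bar> \<le> A * \<phi>2 t * \<phi>1 t"
    and \<phi>1_ge: "\<And>t. t > t1 \<Longrightarrow> 1 \<le> A * \<phi>1 t"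
    and Q1_le: "\<And>t. t > t1 \<Longrightarrow> (Q1 t)\<^sup>2 \<le> A * \<phi>2 t * (\<phi>1 t)\<^sup>2"
    and Q2_le: "\<And>t. t > t1 \<Longrightarrow> (Q2 t)\<^sup>2 \<le> A * \<phi>2 t"
    and \<phi>_shift: "\<And>t. t > t1 \<Longrightarrow> \<phi> (t + 2) \<le> B * \<phi> t"
    and \<phi>1_exp: "\<And>t. t > t1 \<Longrightarrow> \<phi>1 t \<le> B * exp (\<phi> t)"
    and \<phi>2_exp: "\<And>t. t > t1 \<Longrightarrow> \<phi>2 t \<le> B * exp (\<phi> t)"
    and \<phi>_top: "filterlim \<phi> at_top at_top"
    and decay: "\<And>\<sigma>. \<sigma> > 0 \<Longrightarrow> \<exists>C. \<forall>\<^sub>F t in at_top. m t \<le> C * exp (- \<sigma> * \<phi> t)"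
begin

lemma m_nonneg: "t > t1 \<Longrightarrow> 0 \<le> m t"
  using quad[of t 0 0 1] by simp

lemma k_nonneg: "t > t1 \<Longrightarrow> 0 \<le> k t"
  using quad[of t 0 1 0] by simp

lemma p_le: "t > t1 \<Longrightarrow> 2 * \<bar>p t\<bar> \<le> k t + m t"
  using quad[of t 0 1 1] quad[of t 0 1 "-1"] by (simp add: abs_if)

lemma \<phi>_mono:
  assumes "t1 < x" "x \<le> y" shows "\<phi> x \<le> \<phi> y"
proof (rule DERIV_nonneg_imp_nondecreasing[OF assms(2)])
  fix z assume "x \<le> z" "z \<le> y"
  then have "t1 < z" using assms by simp
  then show "\<exists>w. (\<phi> has_real_derivative w) (at z) \<and> 0 \<le> w"
    using d\<phi> \<phi>1_pos less_imp_le by blast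
qed

text \<open>For \<open>v = exp (\<tau> \<phi>) w\<close> this is the boundary term of the Carleman identity, divided by \<open>exp (2 \<tau> \<phi>)\<close>.\<close>

definition Y :: "real \<Rightarrow> real \<Rightarrow> real" where
  "Y \<tau> t = - 2 * (\<tau> * \<phi>1 t) * (k t - g t) - 4 * (\<tau> * \<phi>1 t)\<^sup>2 * p t - 4 * (\<tau> * \<phi>1 t) ^ 3 * m t
    + 2 * c * (\<tau> * \<phi>1 t) * m t - 4 * (\<tau> * \<phi>2 t) * p t - 4 * (\<tau> * \<phi>2 t) * (\<tau> * \<phi>1 t) * m t"

definition Y' :: "real \<Rightarrow> real \<Rightarrow> real" where
  "Y' \<tau> t = (let a = \<tau> * \<phi>1 t; b = \<tau> * \<phi>2 t; d = \<tau> * \<phi>3 t; p' = k t + g t + s t + c * m t in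
    - 2 * b * (k t - g t) - 2 * a * (2 * h t + 2 * c * p t) - 8 * a * b * p t - 4 * a\<^sup>2 * p'
    - 12 * a\<^sup>2 * b * m t - 8 * a ^ 3 * p t + 2 * c * b * m t + 4 * c * a * p t - 4 * d * p t - 4 * b * p'
    - 4 * d * a * m t - 4 * b\<^sup>2 * m t - 8 * b * a * p t)"

lemma Y_has_derivative:
  assumes t: "t > t1" shows "(Y \<tau> has_real_derivative Y' \<tau> t) (at t)"
proof -
  have "((\<lambda>t. - 2 * (\<tau> * \<phi>1 t) * (k t - g t) - 4 * (\<tau> * \<phi>1 t)\<^sup>2 * p t - 4 * (\<tau> * \<phi>1 t) ^ 3 * m t
    + 2 * c * (\<tau> * \<phi>1 t) * m t - 4 * (\<tau> * \<phi>2 t) * p t - 4 * (\<tau> * \<phi>2 t) * (\<tau> * \<phi>1 t) * m t)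
    has_real_derivative Y' \<tau> t) (at t)"
    unfolding Y'_def Let_def
    by (rule derivative_eq_intros dm[OF t] dkg[OF t] dp[OF t] d\<phi>1[OF t] d\<phi>2[OF t] refl)+
      (simp add: algebra_simps power2_eq_square power3_eq_cube)
  then show ?thesis by (simp add: Y_def[abs_def])
qed

text \<open>Up to the factor exp (2 \<tau> \<phi>) the left side is the derivative of the boundary
  term. Conjugating the operator by exp (\<tau> \<phi>) gives a symmetric part S v = v'' + \<Delta>v
  + (a^2 - c) v and an antisymmetric part - (2 a v' + b v). The two subtracted brackets are, up to
  the same factor, the integrals of (S v + b v)^2 and of (2 a v' + b v)^2. Without the shift by b v
  the coefficient of \<integral> |\<nabla>v|^2 would be zero; the shift produces 2 b at the price of
  half of the term 4 a^2 b \<integral> v^2.\<close>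

lemma carleman_identity:
  fixes \<tau> t :: real
  defines "a \<equiv> \<tau> * \<phi>1 t" and "b \<equiv> \<tau> * \<phi>2 t" and "d \<equiv> \<tau> * \<phi>3 t"
  shows "2 * a * Y \<tau> t + Y' \<tau> t = f2 t - 6 * b * (k t + 2 * a * p t + a\<^sup>2 * m t) - 2 * b * g t
    - (2 * a\<^sup>2 * b + 2 * c * b - b\<^sup>2) * m t - 4 * d * (p t + a * m t)
    - (f2 t + (2 * a)\<^sup>2 * k t + (2 * a\<^sup>2 + 2 * b)\<^sup>2 * m t + 2 * (2 * a) * h t + 2 * (2 * a\<^sup>2 + 2 * b) * s t
       + 2 * (2 * a) * (2 * a\<^sup>2 + 2 * b) * p t)
    - ((2 * a)\<^sup>2 * k t + (2 * a\<^sup>2 + b)\<^sup>2 * m t + 2 * (2 * a) * (2 * a\<^sup>2 + b) * p t)"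
  unfolding Y_def Y'_def Let_def a_def[symmetric] b_def[symmetric] d_def[symmetric]
  by (simp add: algebra_simps power2_eq_square power3_eq_cube)

text \<open>The sum exceeds each of the thresholds \<open>1\<close>, \<open>A + A\<^sup>2\<close>,
  \<open>10 * A + 4 * A ^ 3 * c\<close> and \<open>8 * A\<close> used for absorption in
  \<open>carleman_le\<close>.\<close>

definition \<tau>0 :: real where "\<tau>0 = 1 + 11 * A + A\<^sup>2 + 4 * A ^ 3 * c"

text \<open>Both squares of \<open>carleman_identity\<close> are discarded. The term with \<phi>'''
  consumes 4 of the 6 multiples of \<open>b * k'\<close>, and the remaining 2 b (k' + g), together
  with at least \<tau>^3 \<phi>'' \<phi>'^2 m, outweighs \<open>f2\<close>. The perturbation enters
  with fixed powers of the coefficients while these terms grow with \<tau>.\<close>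

lemma carleman_le:
  assumes t: "t > t1" and \<tau>: "\<tau> \<ge> \<tau>0"
  shows "2 * (\<tau> * \<phi>1 t) * Y \<tau> t + Y' \<tau> t \<le> 0"
proof -
  define a b d where abd: "a = \<tau> * \<phi>1 t" "b = \<tau> * \<phi>2 t" "d = \<tau> * \<phi>3 t"
  \<comment> \<open>This is \<integral> v'^2 divided by exp (2 \<tau> \<phi>), since v' = exp
    (\<tau> \<phi>) (w' + a w).\<close>
  define k' where "k' = k t + 2 * a * p t + a\<^sup>2 * m t"
  note pos = \<phi>1_pos[OF t] \<phi>2_pos[OF t] m_nonneg[OF t] g_nonneg[OF t]
  have A3: "A ^ 3 * c \<ge> 0" using A c by simp
  have \<tau>ge: "\<tau> \<ge> 1" "\<tau> \<ge> A + A\<^sup>2" "\<tau> \<ge> 10 * A + 4 * A ^ 3 * c" "\<tau> \<ge> 8 * A"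
    using \<tau> A A3 zero_le_power2[of A] unfolding \<tau>0_def by linarith+
  have bpos: "b > 0" and apos: "a > 0" using pos \<tau>ge(1) by (simp_all add: abd)
  have k': "k' \<ge> 0"
    using quad[OF t, of 0 1 a] by (simp add: k'_def algebra_simps)
  \<comment> \<open>Equivalent to \<integral> (w' + 2 a w)^2 \<ge> 0; it returns from v' to w', in
    which the bound on \<open>f2\<close> is phrased.\<close>
  have k_le: "k t \<le> 2 * k' + 2 * a\<^sup>2 * m t"
    using quad[OF t, of 0 1 "2 * a"] by (simp add: k'_def algebra_simps power2_eq_square)
  have q1: "0 \<le> f2 t + (2 * a)\<^sup>2 * k t + (2 * a\<^sup>2 + 2 * b)\<^sup>2 * m t + 2 * (2 * a) * h t + 2 * (2 * a\<^sup>2 + 2 * b) * s t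
       + 2 * (2 * a) * (2 * a\<^sup>2 + 2 * b) * p t"
    using quad[OF t, of 1 "2 * a" "2 * a\<^sup>2 + 2 * b"] by simp
  have q2: "0 \<le> (2 * a)\<^sup>2 * k t + (2 * a\<^sup>2 + b)\<^sup>2 * m t + 2 * (2 * a) * (2 * a\<^sup>2 + b) * p t"
    using quad[OF t, of 0 "2 * a" "2 * a\<^sup>2 + b"] by simp
  \<comment> \<open>The shift d / (2 b) completes the square in 4 b v'^2 + 4 d v v'.\<close>
  have q3: "- 4 * d * (p t + a * m t) \<le> 4 * b * k' + d\<^sup>2 / b * m t"
  proof -
    have "0 \<le> 4 * b * (k t + (a + d / (2 * b))\<^sup>2 * m t + 2 * (a + d / (2 * b)) * p t)"
      using quad[OF t, of 0 1 "a + d / (2 * b)"] bpos by simp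
    also have "\<dots> = 4 * b * k' + d\<^sup>2 / b * m t + 4 * d * (p t + a * m t)"
      using bpos by (simp add: k'_def field_simps power2_eq_square)
    finally show ?thesis by simp
  qed
  have main: "2 * a * Y \<tau> t + Y' \<tau> t \<le> f2 t - 2 * b * (k' + g t) - (2 * a\<^sup>2 * b + 2 * c * b - b\<^sup>2 - d\<^sup>2 / b) * m t"
  proof -
    have "2 * a * Y \<tau> t + Y' \<tau> t \<le> f2 t - 6 * b * k' - 2 * b * g t
      - (2 * a\<^sup>2 * b + 2 * c * b - b\<^sup>2) * m t - 4 * d * (p t + a * m t)"
      using carleman_identity[of \<tau> t] q1 q2 unfolding abd[symmetric] k'_def by linarith
    also have "\<dots> \<le> f2 t - 6 * b * k' - 2 * b * g t - (2 * a\<^sup>2 * b + 2 * c * b - b\<^sup>2) * m t + (4 * b * k' + d\<^sup>2 / b * m t)"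
      using q3 by linarith
    finally show ?thesis by (simp add: algebra_simps)
  qed
  \<comment> \<open>\<open>\<tau> ^ 3 * x\<close> equals \<open>a\<^sup>2 * b\<close>, the scale
    against which all coefficients of \<open>m\<close> are measured.\<close>
  define x where "x = \<phi>2 t * (\<phi>1 t)\<^sup>2"
  have xpos: "x > 0" using pos by (simp add: x_def)
  have b2: "b\<^sup>2 \<le> \<tau>\<^sup>2 * (A * x)"
  proof -
    have "\<phi>2 t * \<phi>2 t \<le> \<phi>2 t * (A * (\<phi>1 t)\<^sup>2)"
      using \<phi>2_le[OF t] pos by (intro mult_left_mono) auto
    then have "(\<phi>2 t)\<^sup>2 \<le> A * x" by (simp add: x_def power2_eq_square mult_ac)
    then show ?thesis unfolding abd power_mult_distrib by (rule mult_left_mono) simp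
  qed
  have d2: "d\<^sup>2 / b \<le> \<tau> * (A\<^sup>2 * x)"
  proof -
    have "(\<phi>3 t)\<^sup>2 \<le> (A * \<phi>2 t * \<phi>1 t)\<^sup>2"
      using power_mono[OF \<phi>3_le[OF t] abs_ge_zero, of 2] by simp
    then have "d\<^sup>2 \<le> \<tau> * (A\<^sup>2 * x) * b"
      using \<tau>ge(1) by (simp add: abd x_def power_mult_distrib power2_eq_square mult_ac)
    then show ?thesis using bpos by (simp add: pos_divide_le_eq)
  qed
  have coef: "\<tau> ^ 3 * x \<le> 2 * a\<^sup>2 * b + 2 * c * b - b\<^sup>2 - d\<^sup>2 / b"
  proof -
    have "b\<^sup>2 + d\<^sup>2 / b \<le> \<tau>\<^sup>2 * (A * x) + \<tau>\<^sup>2 * (A\<^sup>2 * x)"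
    proof -
      have "\<tau> * (A\<^sup>2 * x) \<le> \<tau>\<^sup>2 * (A\<^sup>2 * x)"
        using \<tau>ge(1) xpos by (intro mult_right_mono) (auto simp: power2_eq_square)
      then show ?thesis using b2 d2 by linarith
    qed
    also have "\<dots> = \<tau>\<^sup>2 * x * (A + A\<^sup>2)" by (simp add: algebra_simps)
    also have "\<dots> \<le> \<tau>\<^sup>2 * x * \<tau>" using \<tau>ge xpos by (intro mult_left_mono) auto
    also have "\<dots> = \<tau> ^ 3 * x" by (simp add: power2_eq_square power3_eq_cube)
    finally have "b\<^sup>2 + d\<^sup>2 / b \<le> \<tau> ^ 3 * x" .
    moreover have "2 * a\<^sup>2 * b = 2 * (\<tau> ^ 3 * x)"
      by (simp add: abd x_def power2_eq_square power3_eq_cube)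
    moreover have "2 * c * b \<ge> 0" using c bpos by simp
    ultimately show ?thesis by linarith
  qed
  have f2: "f2 t \<le> 2 * b * (k' + g t) + \<tau> ^ 3 * x * m t"
  proof -
    have nn: "0 \<le> 2 * k t + 2 * c * m t + g t"
      using k_nonneg[OF t] pos c by simp
    have "f2 t \<le> 2 * (A * \<phi>2 t * (\<phi>1 t)\<^sup>2) * m t + 2 * (A * \<phi>2 t) * (2 * k t + 2 * c * m t + g t)"
      using f2_le[OF t] mult_right_mono[OF Q1_le[OF t] pos(3)] mult_right_mono[OF Q2_le[OF t] nn] by linarith
    also have "\<dots> = 2 * A * x * m t + 2 * (A * \<phi>2 t) * (2 * k t + 2 * c * m t + g t)"
      by (simp add: x_def)
    also have "\<dots> \<le> 2 * A * x * m t + 2 * (A * \<phi>2 t) * (2 * (2 * k' + 2 * a\<^sup>2 * m t) + 2 * c * m t + g t)"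
    proof -
      have "2 * k t + 2 * c * m t + g t \<le> 2 * (2 * k' + 2 * a\<^sup>2 * m t) + 2 * c * m t + g t"
        by (intro add_right_mono mult_left_mono k_le) simp
      then have "2 * (A * \<phi>2 t) * (2 * k t + 2 * c * m t + g t)
          \<le> 2 * (A * \<phi>2 t) * (2 * (2 * k' + 2 * a\<^sup>2 * m t) + 2 * c * m t + g t)"
        using A pos by (intro mult_left_mono) auto
      then show ?thesis by linarith
    qed
    also have "\<dots> = \<phi>2 t * (8 * A * k') + \<phi>2 t * (2 * A * g t) + m t * (2 * A * x + 8 * A * a\<^sup>2 * \<phi>2 t + 4 * A * c * \<phi>2 t)"
      by (simp add: algebra_simps)
    also have "\<dots> \<le> \<phi>2 t * (2 * \<tau> * k') + \<phi>2 t * (2 * \<tau> * g t) + m t * (\<tau> ^ 3 * x)"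
    proof (intro add_mono mult_left_mono)
      show "8 * A * k' \<le> 2 * \<tau> * k'" using \<tau>ge A k' by (intro mult_right_mono) auto
      show "2 * A * g t \<le> 2 * \<tau> * g t" using \<tau>ge A pos by (intro mult_right_mono) auto
      have "\<tau> ^ 2 \<ge> 1" using \<tau>ge(1) by simp
      \<comment> \<open>The lower bound on \<phi>' is what lets the contribution of the constant
        potential, a multiple of c \<phi>'', be measured in units of \<open>x\<close>.\<close>
      have "1 \<le> (A * \<phi>1 t)\<^sup>2" using \<phi>1_ge[OF t] by simp
      then have "\<phi>2 t * 1 \<le> \<phi>2 t * (A * \<phi>1 t)\<^sup>2" using pos by (intro mult_left_mono) auto
      then have "\<phi>2 t \<le> A\<^sup>2 * x" by (simp add: x_def power_mult_distrib mult_ac)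
      then have "4 * A * c * \<phi>2 t \<le> 4 * A * c * (A\<^sup>2 * x)"
        using A c by (intro mult_left_mono) auto
      also have "\<dots> = 4 * A ^ 3 * c * x" by (simp add: power2_eq_square power3_eq_cube)
      also have "\<dots> \<le> \<tau>\<^sup>2 * (4 * A ^ 3 * c * x)"
        using mult_right_mono[OF \<open>\<tau> ^ 2 \<ge> 1\<close>, of "4 * A ^ 3 * c * x"] A c xpos by simp
      finally have 1: "4 * A * c * \<phi>2 t \<le> \<tau>\<^sup>2 * (4 * A ^ 3 * c * x)" .
      have 2: "2 * A * x \<le> \<tau>\<^sup>2 * (2 * A * x)"
        using mult_right_mono[OF \<open>\<tau> ^ 2 \<ge> 1\<close>, of "2 * A * x"] A xpos by simp
      have 3: "8 * A * a\<^sup>2 * \<phi>2 t = \<tau>\<^sup>2 * (8 * A * x)"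
        by (simp add: abd x_def power_mult_distrib mult_ac)
      have "2 * A * x + 8 * A * a\<^sup>2 * \<phi>2 t + 4 * A * c * \<phi>2 t \<le> \<tau>\<^sup>2 * (2 * A * x) + \<tau>\<^sup>2 * (8 * A * x) + \<tau>\<^sup>2 * (4 * A ^ 3 * c * x)"
        using 1 2 3 by linarith
      also have "\<dots> = \<tau>\<^sup>2 * x * (10 * A + 4 * A ^ 3 * c)" by (simp add: algebra_simps)
      also have "\<dots> \<le> \<tau>\<^sup>2 * x * \<tau>" using \<tau>ge xpos by (intro mult_left_mono) auto
      also have "\<dots> = \<tau> ^ 3 * x" by (simp add: power2_eq_square power3_eq_cube)
      finally show "2 * A * x + 8 * A * a\<^sup>2 * \<phi>2 t + 4 * A * c * \<phi>2 t \<le> \<tau> ^ 3 * x" .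
    qed (use pos in auto)
    also have "\<dots> = 2 * b * (k' + g t) + \<tau> ^ 3 * x * m t"
      by (simp add: abd algebra_simps)
    finally show ?thesis .
  qed
  have "\<tau> ^ 3 * x * m t \<le> (2 * a\<^sup>2 * b + 2 * c * b - b\<^sup>2 - d\<^sup>2 / b) * m t"
    using coef pos(3) by (rule mult_right_mono)
  then show ?thesis
    using main f2 unfolding abd(1)[symmetric] by linarith
qed

definition Z :: "real \<Rightarrow> real \<Rightarrow> real" where
  "Z \<tau> t = exp (2 * (\<tau> * \<phi> t)) * Y \<tau> t"

lemma Z_antimono:
  assumes "\<tau> \<ge> \<tau>0" "t1 < x" "x \<le> y"
  shows "Z \<tau> y \<le> Z \<tau> x"
proof (rule DERIV_nonpos_imp_nonincreasing[OF assms(3)])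
  fix t assume "x \<le> t" "t \<le> y"
  then have t: "t1 < t" using assms by simp
  have "(Z \<tau> has_real_derivative exp (2 * (\<tau> * \<phi> t)) * (2 * (\<tau> * \<phi>1 t) * Y \<tau> t + Y' \<tau> t)) (at t)"
    unfolding Z_def[abs_def]
    by (rule derivative_eq_intros d\<phi>[OF t] Y_has_derivative[OF t] refl)+ (simp add: algebra_simps)
  moreover have "exp (2 * (\<tau> * \<phi> t)) * (2 * (\<tau> * \<phi>1 t) * Y \<tau> t + Y' \<tau> t) \<le> 0"
    using carleman_le[OF t assms(1)] by (simp add: mult_nonneg_nonpos)
  ultimately show "\<exists>z. (Z \<tau> has_real_derivative z) (at t) \<and> z \<le> 0" by blast
qed

text \<open>A Caccioppoli estimate: \<open>k + g\<close> is bounded by \<open>m''\<close>, and \<open>m''\<close> is small at some point of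
  each interval of length 2 because it equals a second difference of \<open>m\<close>.\<close>

lemma energy_small_somewhere:
  assumes t: "t > t1"
  obtains \<xi> where "t < \<xi>" "\<xi> < t + 2"
    "k \<xi> + g \<xi> \<le> m t + m (t + 2) + 2 * ((Q1 \<xi>)\<^sup>2 + 2 * (Q2 \<xi>)\<^sup>2 + 1) * m \<xi>"
proof -
  have dn: "((\<lambda>x. m (x + 1) - m x) has_real_derivative 2 * p (x + 1) - 2 * p x) (at x)" if "x > t1" for x
  proof -
    have "((\<lambda>x. m (x + 1)) has_real_derivative 2 * p (x + 1)) (at x)"
      using dm[of "x + 1"] that by (simp add: DERIV_shift[of m _ x 1, symmetric])
    then show ?thesis by (intro DERIV_diff dm that)
  qed
  obtain x where x: "t < x" "x < t + 1"
    "(m (t + 1 + 1) - m (t + 1)) - (m (t + 1) - m t) = (t + 1 - t) * (2 * p (x + 1) - 2 * p x)"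
    using MVT2[of t "t + 1" "\<lambda>x. m (x + 1) - m x" "\<lambda>x. 2 * p (x + 1) - 2 * p x"] dn t by auto
  obtain \<xi> where \<xi>: "x < \<xi>" "\<xi> < x + 1" "p (x + 1) - p x = (x + 1 - x) * (k \<xi> + g \<xi> + s \<xi> + c * m \<xi>)"
    using MVT2[of x "x + 1" p "\<lambda>x. k x + g x + s x + c * m x"] dp x t by auto
  have t\<xi>: "t1 < \<xi>" using \<xi> x t by simp
  note pos = m_nonneg[OF t\<xi>] k_nonneg[OF t\<xi>] g_nonneg[OF t\<xi>]
  have eq: "2 * (k \<xi> + g \<xi> + s \<xi> + c * m \<xi>) = m (t + 2) - 2 * m (t + 1) + m t"
    using x(3) \<xi>(3) by (simp add: algebra_simps)
  \<comment> \<open>\<open>q\<close> and its inverse \<open>e\<close> are the weights in Young's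
    inequality for the product F w. They are tuned to make e Q2^2 at most 1/4, so that the energy
    hidden in \<open>f2\<close> costs only half of k + g and can be moved to the left.\<close>
  define q where "q = 4 * (Q2 \<xi>)\<^sup>2 + 1"
  have q: "q \<ge> 1" by (simp add: q_def)
  define e where "e = 1 / q"
  have e: "0 < e" "e \<le> 1" "e * (Q2 \<xi>)\<^sup>2 \<le> 1 / 4" proof -
    show "0 < e" "e \<le> 1" using q by (simp_all add: e_def)
    have "4 * (Q2 \<xi>)\<^sup>2 \<le> 1 * q" by (simp add: q_def)
    moreover have "q > 0" using q by linarith
    ultimately have "4 * (Q2 \<xi>)\<^sup>2 / q \<le> 1" by (simp only: pos_divide_le_eq)
    then show "e * (Q2 \<xi>)\<^sup>2 \<le> 1 / 4" by (simp add: e_def mult.commute)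
  qed
  have s: "- s \<xi> \<le> e * f2 \<xi> / 2 + q * m \<xi> / 2"
  proof -
    have "0 \<le> (q / 2) * (e\<^sup>2 * f2 \<xi> + m \<xi> + 2 * e * s \<xi>)"
      using quad[OF t\<xi>, of e 0 1] q by simp
    also have "\<dots> = (q * e) * (e * f2 \<xi> / 2 + s \<xi>) + q * m \<xi> / 2"
      by (simp add: field_simps power2_eq_square)
    also have "q * e = 1" using q by (simp add: e_def)
    finally show ?thesis by simp
  qed
  have f: "e * f2 \<xi> / 2 \<le> (Q1 \<xi>)\<^sup>2 * m \<xi> + (k \<xi> + g \<xi>) / 2 + c * m \<xi> / 2"
  proof -
    have "e * f2 \<xi> \<le> e * (2 * (Q1 \<xi>)\<^sup>2 * m \<xi> + 2 * (Q2 \<xi>)\<^sup>2 * (2 * k \<xi> + 2 * c * m \<xi> + g \<xi>))"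
      using f2_le[OF t\<xi>] e by (intro mult_left_mono) auto
    also have "\<dots> = e * (2 * (Q1 \<xi>)\<^sup>2 * m \<xi>) + 2 * (e * (Q2 \<xi>)\<^sup>2) * (2 * k \<xi> + 2 * c * m \<xi> + g \<xi>)"
      by (simp add: algebra_simps)
    also have "\<dots> \<le> 1 * (2 * (Q1 \<xi>)\<^sup>2 * m \<xi>) + 2 * (1 / 4) * (2 * k \<xi> + 2 * c * m \<xi> + g \<xi>)"
      using e pos c by (intro add_mono mult_right_mono mult_left_mono) auto
    finally show ?thesis using pos by (simp add: field_simps)
  qed
  have "k \<xi> + g \<xi> \<le> m t + m (t + 2) + 2 * ((Q1 \<xi>)\<^sup>2 + 2 * (Q2 \<xi>)\<^sup>2 + 1) * m \<xi>"
  proof -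
    have "m (t + 1) \<ge> 0" using m_nonneg t by simp
    moreover have "c * m \<xi> \<ge> 0" using c pos by simp
    ultimately have "k \<xi> + g \<xi> \<le> m t + m (t + 2) + 2 * ((Q1 \<xi>)\<^sup>2 * m \<xi>) + q * m \<xi>"
      using eq s f by (simp add: field_simps)
    also have "\<dots> \<le> m t + m (t + 2) + 2 * ((Q1 \<xi>)\<^sup>2 + 2 * (Q2 \<xi>)\<^sup>2 + 1) * m \<xi>"
      using pos by (simp add: q_def algebra_simps)
    finally show ?thesis .
  qed
  moreover have "t < \<xi>" "\<xi> < t + 2" using \<xi> x by linarith+
  ultimately show thesis by (rule that[rotated 2])
qed

text \<open>Powers of \<phi>' and \<phi>'' are bounded by powers of exp \<phi>, hence a sufficiently
  fast decay of \<open>m\<close> beats them together with exp (2 \<tau> \<phi>). The energy at \<xi>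
  is controlled by \<open>m\<close> at an earlier time, where \<phi> may be smaller;
  \<open>\<phi>_shift\<close> limits this loss to the factor \<open>B\<close>.\<close>

lemma Z_small_somewhere:
  assumes \<tau>: "\<tau> > 0" and \<epsilon>: "\<epsilon> > 0"
  obtains \<xi> where "T < \<xi>" "t1 < \<xi>" "\<bar>Z \<tau> \<xi>\<bar> < \<epsilon>"
proof -
  \<comment> \<open>\<open>B\<close> pays for the earlier time. Of the rate 2 \<tau> + 10, the part
    2 \<tau> cancels exp (2 \<tau> \<phi>), 3 is spent on the energy bound and 3 on the coefficients
    of \<open>Y\<close>, and 4 is left over.\<close>
  define \<sigma> where "\<sigma> = B * (2 * \<tau> + 10)"
  have \<sigma>: "\<sigma> > 0" using \<tau> B by (simp add: \<sigma>_def)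
  obtain C' where C': "\<forall>\<^sub>F t in at_top. m t \<le> C' * exp (- \<sigma> * \<phi> t)" using decay[OF \<sigma>] by blast
  define C where "C = max C' 0"
  have C0: "C \<ge> 0" by (simp add: C_def)
  have evC: "\<forall>\<^sub>F t in at_top. m t \<le> C * exp (- \<sigma> * \<phi> t)"
    using C'
  proof eventually_elim
    case (elim t)
    have "C' * exp (- \<sigma> * \<phi> t) \<le> C * exp (- \<sigma> * \<phi> t)" by (intro mult_right_mono) (auto simp: C_def)
    then show ?case using elim by linarith
  qed
  \<comment> \<open>In units of exp (3 \<phi>(\<xi>)), \<open>M1\<close> bounds the factor of
    m(\<xi>) in the energy estimate and \<open>M2\<close> the sum of the coefficients of
    \<open>Y\<close>.\<close>
  define M1 where "M1 = 2 * (A * B ^ 3 + 2 * (A * B) + 1)"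
  define M2 where "M2 = 2 * \<tau> * B + (4 * \<tau>\<^sup>2 * B\<^sup>2 + 4 * \<tau> * B) + (4 * \<tau> ^ 3 * B ^ 3 + 2 * c * \<tau> * B + 4 * \<tau>\<^sup>2 * B\<^sup>2)"
  have M: "M1 \<ge> 0" "M2 \<ge> 0" using A B c \<tau> by (simp_all add: M1_def M2_def)
  have "((\<lambda>t. M2 * (3 + M1) * C * exp (- 4 * \<phi> t)) \<longlongrightarrow> M2 * (3 + M1) * C * 0) at_top"
  proof (intro tendsto_mult tendsto_const)
    have "filterlim (\<lambda>t. - 4 * \<phi> t) at_bot at_top"
      using filterlim_tendsto_neg_mult_at_bot[OF tendsto_const[of "-4"] _ \<phi>_top] by simp
    then show "((\<lambda>t. exp (- 4 * \<phi> t)) \<longlongrightarrow> 0) at_top"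
      by (rule filterlim_compose[OF exp_at_bot])
  qed
  then have ev\<epsilon>: "\<forall>\<^sub>F t in at_top. M2 * (3 + M1) * C * exp (- 4 * \<phi> t) < \<epsilon>"
    using \<epsilon> by (simp add: order_tendstoD)
  obtain T0 where T0: "\<And>t. t \<ge> T0 \<Longrightarrow> m t \<le> C * exp (- \<sigma> * \<phi> t)"
    "\<And>t. t \<ge> T0 \<Longrightarrow> M2 * (3 + M1) * C * exp (- 4 * \<phi> t) < \<epsilon>"
    using eventually_conj[OF evC ev\<epsilon>] by (auto simp: eventually_at_top_linorder)
  define t where "t = max (max T T0) (t1 + 1)"
  have t: "t > t1" "t \<ge> T" "t \<ge> T0" by (auto simp: t_def)
  obtain \<xi> where \<xi>: "t < \<xi>" "\<xi> < t + 2"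
    "k \<xi> + g \<xi> \<le> m t + m (t + 2) + 2 * ((Q1 \<xi>)\<^sup>2 + 2 * (Q2 \<xi>)\<^sup>2 + 1) * m \<xi>"
    using energy_small_somewhere[OF t(1)] by blast
  have t\<xi>: "t1 < \<xi>" using t \<xi> by simp
  note pos = m_nonneg[OF t\<xi>] k_nonneg[OF t\<xi>] g_nonneg[OF t\<xi>] \<phi>1_pos[OF t\<xi>] \<phi>2_pos[OF t\<xi>]
  define E e where Ee: "E = \<phi> \<xi>" "e = exp E"
  have E: "0 \<le> E" "E \<le> \<phi> (t + 2)" "\<phi> t \<le> E" "E \<le> B * \<phi> t"
    using \<phi>_nonneg[OF t\<xi>] \<phi>_mono[of \<xi> "t + 2"] \<phi>_mono[of t \<xi>] \<phi>_shift[OF t(1)] t \<xi> by (auto simp: Ee)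
  have e1: "e \<ge> 1" using E(1) by (simp add: Ee(2))
  define D where "D = C * exp (- (2 * \<tau> + 10) * E)"
  have D0: "D \<ge> 0" using C0 by (simp add: D_def)
  have decay_D: "m x \<le> D" if "x \<ge> T0" "E \<le> B * \<phi> x" for x
  proof -
    have "(2 * \<tau> + 10) * E \<le> \<sigma> * \<phi> x"
      using mult_left_mono[OF that(2), of "2 * \<tau> + 10"] \<tau> by (simp add: \<sigma>_def mult_ac)
    then have "exp (- \<sigma> * \<phi> x) \<le> exp (- (2 * \<tau> + 10) * E)"
      by (simp only: mult_minus_left neg_le_iff_le exp_le_cancel_iff)
    then have "C * exp (- \<sigma> * \<phi> x) \<le> D" unfolding D_def using C0 by (rule mult_left_mono)
    then show ?thesis using T0(1)[OF that(1)] by linarith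
  qed
  have le_B: "E \<le> B * \<phi> x" if "E \<le> \<phi> x" for x
    using that E(1) B mult_right_mono[of 1 B "\<phi> x"] by simp
  have mD: "m t \<le> D" "m (t + 2) \<le> D" "m \<xi> \<le> D"
    using decay_D[of t] decay_D[of "t + 2"] decay_D[of \<xi>] E t \<xi> le_B[of "t + 2"] le_B[of \<xi>] by (auto simp: Ee)
  have ph: "\<phi>1 \<xi> \<le> B * e" "\<phi>2 \<xi> \<le> B * e"
    using \<phi>1_exp[OF t\<xi>] \<phi>2_exp[OF t\<xi>] by (auto simp: Ee)
  have e_pow: "e \<le> e ^ 3" "e\<^sup>2 \<le> e ^ 3" "1 \<le> e ^ 3"
    using e1 power_increasing[of 1 3 e] power_increasing[of 2 3 e] by auto
  have p2: "(\<phi>1 \<xi>)\<^sup>2 \<le> B\<^sup>2 * e\<^sup>2" "(\<phi>1 \<xi>) ^ 3 \<le> B ^ 3 * e ^ 3"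
    using power_mono[OF ph(1), of 2] power_mono[OF ph(1), of 3] pos by (auto simp: power_mult_distrib)
  have p12: "\<phi>2 \<xi> * \<phi>1 \<xi> \<le> B\<^sup>2 * e\<^sup>2"
    using mult_mono[OF ph(2,1)] pos B e1 by (simp add: power2_eq_square mult_ac)
  have p3: "\<phi>2 \<xi> * (\<phi>1 \<xi>)\<^sup>2 \<le> B ^ 3 * e ^ 3"
  proof -
    have "\<phi>2 \<xi> * (\<phi>1 \<xi>)\<^sup>2 \<le> (B * e) * (B\<^sup>2 * e\<^sup>2)"
      using pos B e1 by (intro mult_mono ph p2) auto
    then show ?thesis by (simp add: power2_eq_square power3_eq_cube mult_ac)
  qed
  have q: "2 * ((Q1 \<xi>)\<^sup>2 + 2 * (Q2 \<xi>)\<^sup>2 + 1) \<le> M1 * e ^ 3"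
  proof -
    have "(Q1 \<xi>)\<^sup>2 \<le> A * (B ^ 3 * e ^ 3)"
    proof -
      have "(Q1 \<xi>)\<^sup>2 \<le> A * (\<phi>2 \<xi> * (\<phi>1 \<xi>)\<^sup>2)" using Q1_le[OF t\<xi>] by (simp only: mult.assoc)
      also have "\<dots> \<le> A * (B ^ 3 * e ^ 3)" using p3 A by (intro mult_left_mono) auto
      finally show ?thesis .
    qed
    moreover have "(Q2 \<xi>)\<^sup>2 \<le> A * (B * e ^ 3)"
    proof -
      have "(Q2 \<xi>)\<^sup>2 \<le> A * \<phi>2 \<xi>" by (rule Q2_le[OF t\<xi>])
      also have "\<dots> \<le> A * (B * e)" using ph(2) A by (intro mult_left_mono) auto
      also have "\<dots> \<le> A * (B * e ^ 3)" using A B e_pow by (intro mult_left_mono) auto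
      finally show ?thesis .
    qed
    ultimately have "2 * ((Q1 \<xi>)\<^sup>2 + 2 * (Q2 \<xi>)\<^sup>2 + 1) \<le> 2 * (A * (B ^ 3 * e ^ 3) + 2 * (A * (B * e ^ 3)) + e ^ 3)"
      using e_pow(3) by (intro mult_left_mono add_mono) auto
    also have "\<dots> = M1 * e ^ 3" by (simp add: M1_def algebra_simps)
    finally show ?thesis .
  qed
  have energy: "k \<xi> + g \<xi> + m \<xi> \<le> (3 + M1) * e ^ 3 * D"
  proof -
    have "2 * ((Q1 \<xi>)\<^sup>2 + 2 * (Q2 \<xi>)\<^sup>2 + 1) * m \<xi> \<le> (M1 * e ^ 3) * D"
      by (rule mult_mono[OF q mD(3)]) (use pos M e1 in auto)
    then have "k \<xi> + g \<xi> + m \<xi> \<le> 3 * (1 * D) + M1 * e ^ 3 * D" using \<xi>(3) mD by linarith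
    also have "\<dots> \<le> 3 * (e ^ 3 * D) + M1 * e ^ 3 * D"
      using e_pow D0 by (intro add_right_mono mult_left_mono mult_right_mono) auto
    finally show ?thesis by (simp add: algebra_simps)
  qed
  define X where "X = k \<xi> + g \<xi> + m \<xi>"
  have X: "\<bar>k \<xi> - g \<xi>\<bar> \<le> X" "\<bar>p \<xi>\<bar> \<le> X" "\<bar>m \<xi>\<bar> \<le> X" "0 \<le> X"
    using pos p_le[OF t\<xi>] by (auto simp: X_def)
  have aux: "w * z \<le> w' * X" if "w \<le> w'" "z \<le> X" "0 \<le> w" "0 \<le> z" for w w' z
    using that by (intro mult_mono) auto
  have Y_le: "\<bar>Y \<tau> \<xi>\<bar> \<le> M2 * e ^ 3 * X"
  proof -
    have "\<bar>Y \<tau> \<xi>\<bar> \<le> \<bar>2 * (\<tau> * \<phi>1 \<xi>) * (k \<xi> - g \<xi>)\<bar> + \<bar>4 * (\<tau> * \<phi>1 \<xi>)\<^sup>2 * p \<xi>\<bar> + \<bar>4 * (\<tau> * \<phi>1 \<xi>) ^ 3 * m \<xi>\<bar>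
        + \<bar>2 * c * (\<tau> * \<phi>1 \<xi>) * m \<xi>\<bar> + \<bar>4 * (\<tau> * \<phi>2 \<xi>) * p \<xi>\<bar> + \<bar>4 * (\<tau> * \<phi>2 \<xi>) * (\<tau> * \<phi>1 \<xi>) * m \<xi>\<bar>"
      unfolding Y_def by linarith
    also have "\<dots> = (2 * \<tau> * \<phi>1 \<xi>) * \<bar>k \<xi> - g \<xi>\<bar> + (4 * \<tau>\<^sup>2 * (\<phi>1 \<xi>)\<^sup>2) * \<bar>p \<xi>\<bar> + (4 * \<tau> ^ 3 * (\<phi>1 \<xi>) ^ 3) * \<bar>m \<xi>\<bar>
        + (2 * c * \<tau> * \<phi>1 \<xi>) * \<bar>m \<xi>\<bar> + (4 * \<tau> * \<phi>2 \<xi>) * \<bar>p \<xi>\<bar> + (4 * \<tau>\<^sup>2 * (\<phi>2 \<xi> * \<phi>1 \<xi>)) * \<bar>m \<xi>\<bar>"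
      using pos \<tau> c by (simp add: abs_mult power_mult_distrib power2_eq_square)
    also have "\<dots> \<le> (2 * \<tau> * (B * e)) * X + (4 * \<tau>\<^sup>2 * (B\<^sup>2 * e\<^sup>2)) * X + (4 * \<tau> ^ 3 * (B ^ 3 * e ^ 3)) * X
        + (2 * c * \<tau> * (B * e)) * X + (4 * \<tau> * (B * e)) * X + (4 * \<tau>\<^sup>2 * (B\<^sup>2 * e\<^sup>2)) * X"
      using X ph p2 p12 \<tau> c pos B e1 by (intro add_mono aux) (auto intro!: mult_left_mono)
    also have "\<dots> \<le> (2 * \<tau> * (B * e ^ 3)) * X + (4 * \<tau>\<^sup>2 * (B\<^sup>2 * e ^ 3)) * X + (4 * \<tau> ^ 3 * (B ^ 3 * e ^ 3)) * X
        + (2 * c * \<tau> * (B * e ^ 3)) * X + (4 * \<tau> * (B * e ^ 3)) * X + (4 * \<tau>\<^sup>2 * (B\<^sup>2 * e ^ 3)) * X"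
      using X e_pow \<tau> c B by (intro add_mono mult_right_mono mult_left_mono) auto
    also have "\<dots> = M2 * e ^ 3 * X" by (simp add: M2_def algebra_simps)
    finally show ?thesis .
  qed
  have "\<bar>Z \<tau> \<xi>\<bar> = exp (2 * (\<tau> * E)) * \<bar>Y \<tau> \<xi>\<bar>" by (simp add: Z_def abs_mult Ee)
  also have "\<dots> \<le> exp (2 * (\<tau> * E)) * (M2 * e ^ 3 * ((3 + M1) * e ^ 3 * D))"
  proof (intro mult_left_mono)
    have "M2 * e ^ 3 * X \<le> M2 * e ^ 3 * ((3 + M1) * e ^ 3 * D)"
      using energy M e1 unfolding X_def by (intro mult_left_mono) auto
    then show "\<bar>Y \<tau> \<xi>\<bar> \<le> M2 * e ^ 3 * ((3 + M1) * e ^ 3 * D)" using Y_le by linarith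
  qed simp
  also have "\<dots> = M2 * (3 + M1) * C * (exp (2 * (\<tau> * E)) * (e ^ 3 * e ^ 3 * exp (- (2 * \<tau> + 10) * E)))"
    by (simp add: D_def mult_ac)
  also have "exp (2 * (\<tau> * E)) * (e ^ 3 * e ^ 3 * exp (- (2 * \<tau> + 10) * E)) = exp (- 4 * E)"
    by (simp add: Ee(2) exp_of_nat_mult[symmetric] exp_add[symmetric] algebra_simps)
  also have "M2 * (3 + M1) * C * exp (- 4 * E) < \<epsilon>"
    using T0(2)[of \<xi>] t \<xi> by (simp add: Ee)
  finally show thesis using that[of \<xi>] t \<xi> t\<xi> by auto
qed

lemma Z_nonneg:
  assumes "\<tau> \<ge> \<tau>0" "\<tau> > 0" "t > t1"
  shows "Z \<tau> t \<ge> 0"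
proof (rule ccontr)
  assume neg: "\<not> Z \<tau> t \<ge> 0"
  obtain \<xi> where \<xi>: "t < \<xi>" "\<bar>Z \<tau> \<xi>\<bar> < - Z \<tau> t"
    using Z_small_somewhere[OF assms(2), of "- Z \<tau> t" t] neg by force
  have "Z \<tau> \<xi> \<le> Z \<tau> t" by (rule Z_antimono[OF assms(1,3)]) (use \<xi> in auto)
  then show False using \<xi> neg by linarith
qed

text \<open>\<open>Y \<tau> t\<close> is a polynomial in \<open>\<tau>\<close> with leading term \<open>- 4 \<tau>\<^sup>3 \<phi>'\<^sup>3 m\<close>, and it is nonnegative for all large \<open>\<tau>\<close>.\<close>

theorem m_eq_0:
  assumes t: "t > t1"
  shows "m t = 0"
proof (rule ccontr)
  assume "m t \<noteq> 0"
  then have mpos: "m t > 0" using m_nonneg[OF t] by simp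
  note pos = \<phi>1_pos[OF t] \<phi>2_pos[OF t]
  \<comment> \<open>\<open>L\<close> majorizes the coefficients of all terms of \<open>Y\<close>
    other than the cubic one; the last term of \<open>Y\<close> is negative and is dropped. With
    \<tau> chosen next, the cubic term exceeds \<tau>^2 (L + 1), so that \<open>Y\<close> would be
    negative.\<close>
  define L where "L = 2 * \<phi>1 t * \<bar>k t - g t\<bar> + 4 * (\<phi>1 t)\<^sup>2 * \<bar>p t\<bar> + 2 * c * \<phi>1 t * m t + 4 * \<phi>2 t * \<bar>p t\<bar>"
  define \<tau> where "\<tau> = max (max \<tau>0 1) ((L + 1) / (4 * (\<phi>1 t) ^ 3 * m t))"
  have \<tau>: "\<tau> \<ge> \<tau>0" "\<tau> \<ge> 1" "(L + 1) / (4 * (\<phi>1 t) ^ 3 * m t) \<le> \<tau>" by (auto simp: \<tau>_def)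
  have den: "4 * (\<phi>1 t) ^ 3 * m t > 0" using pos mpos by simp
  then have big: "L + 1 \<le> \<tau> * (4 * (\<phi>1 t) ^ 3 * m t)" using \<tau>(3) by (simp add: pos_divide_le_eq)
  have "Y \<tau> t \<ge> 0"
    using Z_nonneg[OF \<tau>(1) _ t] \<tau>(2) by (simp add: Z_def zero_le_mult_iff)
  have \<tau>2: "\<tau> \<le> \<tau>\<^sup>2" using \<tau>(2) by (simp add: power2_eq_square)
  have aux: "\<tau> * (w * z) \<le> \<tau>\<^sup>2 * (w * z')" if "0 \<le> w" "z \<le> z'" "0 \<le> z'" for w z z' :: real
  proof -
    have "\<tau> * (w * z) \<le> \<tau> * (w * z')" using that \<tau>(2) by (intro mult_left_mono) auto
    also have "\<dots> \<le> \<tau>\<^sup>2 * (w * z')" using that \<tau>2 by (intro mult_right_mono) auto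
    finally show ?thesis .
  qed
  have "Y \<tau> t + \<tau> ^ 3 * (4 * (\<phi>1 t) ^ 3 * m t) \<le> \<tau>\<^sup>2 * L"
  proof -
    have "\<tau> * (2 * \<phi>1 t * (g t - k t)) \<le> \<tau>\<^sup>2 * (2 * \<phi>1 t * \<bar>k t - g t\<bar>)"
      using pos by (intro aux) auto
    moreover have "\<tau>\<^sup>2 * (4 * (\<phi>1 t)\<^sup>2 * (- p t)) \<le> \<tau>\<^sup>2 * (4 * (\<phi>1 t)\<^sup>2 * \<bar>p t\<bar>)"
      by (intro mult_left_mono) auto
    moreover have "\<tau> * (2 * c * \<phi>1 t * m t) \<le> \<tau>\<^sup>2 * (2 * c * \<phi>1 t * m t)"
      using \<tau>2 c pos mpos by (intro mult_right_mono) auto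
    moreover have "\<tau> * (4 * \<phi>2 t * (- p t)) \<le> \<tau>\<^sup>2 * (4 * \<phi>2 t * \<bar>p t\<bar>)"
      using pos by (intro aux) auto
    moreover have "\<tau>\<^sup>2 * (4 * \<phi>2 t * \<phi>1 t * m t) \<ge> 0" using pos mpos by simp
    moreover have "Y \<tau> t + \<tau> ^ 3 * (4 * (\<phi>1 t) ^ 3 * m t) = \<tau> * (2 * \<phi>1 t * (g t - k t)) + \<tau>\<^sup>2 * (4 * (\<phi>1 t)\<^sup>2 * (- p t))
        + \<tau> * (2 * c * \<phi>1 t * m t) + \<tau> * (4 * \<phi>2 t * (- p t)) - \<tau>\<^sup>2 * (4 * \<phi>2 t * \<phi>1 t * m t)"
      by (simp add: Y_def power_mult_distrib algebra_simps power2_eq_square)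
    ultimately have "Y \<tau> t + \<tau> ^ 3 * (4 * (\<phi>1 t) ^ 3 * m t) \<le> \<tau>\<^sup>2 * (2 * \<phi>1 t * \<bar>k t - g t\<bar>)
        + \<tau>\<^sup>2 * (4 * (\<phi>1 t)\<^sup>2 * \<bar>p t\<bar>) + \<tau>\<^sup>2 * (2 * c * \<phi>1 t * m t) + \<tau>\<^sup>2 * (4 * \<phi>2 t * \<bar>p t\<bar>)"
      by linarith
    also have "\<dots> = \<tau>\<^sup>2 * L" by (simp add: L_def algebra_simps)
    finally show ?thesis .
  qed
  moreover have "\<tau> ^ 3 * (4 * (\<phi>1 t) ^ 3 * m t) \<ge> \<tau>\<^sup>2 * (L + 1)"
    using mult_left_mono[OF big, of "\<tau>\<^sup>2"] by (simp add: power2_eq_square power3_eq_cube mult_ac)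
  moreover have "\<tau>\<^sup>2 * (L + 1) = \<tau>\<^sup>2 * L + \<tau>\<^sup>2" by (simp add: algebra_simps)
  ultimately have "\<tau>\<^sup>2 \<le> 0" using \<open>Y \<tau> t \<ge> 0\<close> by linarith
  then show False using \<tau>(2) by simp
qed

end

lemma Basis_real_prod: "(Basis :: (real \<times> 'e::euclidean_space) set) = insert (1, 0) (Pair 0 ` Basis)"
  by (auto simp: Basis_prod_def)

text \<open>The Gram matrix is block diagonal. A permutation that moves the radial basis vector
  \<open>(1, 0)\<close> contributes a zero factor; the others fix it with factor 1 and permute the
  tangential basis, where each entry carries a factor \<open>c\<close>.\<close>

lemma bdet_cone:
  fixes G :: "'e::euclidean_space \<Rightarrow> 'e \<Rightarrow> real"
  assumes "G 0 0 = 0" "\<And>v. G 0 v = 0"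
  shows "bdet (\<lambda>(a, v) (b, w). a * b + c * G v w) = c ^ DIM('e) * bdet G"
proof -
  let ?S = "Pair 0 ` (Basis :: 'e set) :: (real \<times> 'e) set" and ?e = "(1, 0) :: real \<times> 'e"
  let ?B = "\<lambda>(a, v) (b, w). a * b + c * G v w"
  have fin: "finite ?S" and notin: "?e \<notin> ?S" by auto
  have bij: "bij_betw (Pair 0) (Basis :: 'e set) ?S" by (auto simp: bij_betw_def inj_on_def)
  have "bdet ?B = (\<Sum>\<pi> | \<pi> permutes (insert ?e ?S). of_int (sign \<pi>) * (\<Prod>b\<in>insert ?e ?S. ?B b (\<pi> b)))"
    unfolding bdet_def Basis_real_prod ..
  also have "\<dots> = (\<Sum>\<pi> | \<pi> permutes ?S. of_int (sign \<pi>) * (\<Prod>b\<in>insert ?e ?S. ?B b (\<pi> b)))"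
  proof (rule sum.mono_neutral_right)
    show "finite {\<pi>. \<pi> permutes insert ?e ?S}" using fin by (intro finite_permutations) auto
    show "{\<pi>. \<pi> permutes ?S} \<subseteq> {\<pi>. \<pi> permutes insert ?e ?S}"
      by (auto intro: permutes_subset)
    show "\<forall>\<pi>\<in>{\<pi>. \<pi> permutes insert ?e ?S} - {\<pi>. \<pi> permutes ?S}.
        of_int (sign \<pi>) * (\<Prod>b\<in>insert ?e ?S. ?B b (\<pi> b)) = 0"
    proof
      fix \<pi> assume \<pi>: "\<pi> \<in> {\<pi>. \<pi> permutes insert ?e ?S} - {\<pi>. \<pi> permutes ?S}"
      have "\<pi> ?e \<noteq> ?e"
      proof
        assume fixed: "\<pi> ?e = ?e"
        have "\<pi> permutes ?S"
          by (rule permutes_superset[of \<pi> "insert ?e ?S"]) (use \<pi> fixed in auto)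
        then show False using \<pi> by blast
      qed
      moreover have "\<pi> ?e \<in> insert ?e ?S" using \<pi> permutes_in_image by fastforce
      ultimately obtain b where "\<pi> ?e = (0, b)" by auto
      then have "?B ?e (\<pi> ?e) = 0" using assms by simp
      then show "of_int (sign \<pi>) * (\<Prod>b\<in>insert ?e ?S. ?B b (\<pi> b)) = 0"
        by (simp only: prod.insert[OF fin notin] mult_zero_left mult_zero_right)
    qed
  qed
  also have "\<dots> = (\<Sum>\<pi> | \<pi> permutes ?S. of_int (sign \<pi>) * (\<Prod>b\<in>?S. ?B b (\<pi> b)))"
  proof (rule sum.cong)
    fix \<pi> assume "\<pi> \<in> {\<pi>. \<pi> permutes ?S}"
    then have "\<pi> ?e = ?e" using notin permutes_not_in by (metis mem_Collect_eq)
    then have "?B ?e (\<pi> ?e) = 1" using assms by simp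
    then show "of_int (sign \<pi>) * (\<Prod>b\<in>insert ?e ?S. ?B b (\<pi> b)) = of_int (sign \<pi>) * (\<Prod>b\<in>?S. ?B b (\<pi> b))"
      by (simp only: prod.insert[OF fin notin] mult_1_left)
  qed simp
  also have "\<dots> = (\<Sum>\<pi> | \<pi> permutes Basis. of_int (sign \<pi>) * (\<Prod>b\<in>Basis. ?B (0, b) (0, \<pi> b)))"
    by (rule leibniz_reindex[OF bij]) simp
  also have "\<dots> = c ^ DIM('e) * bdet G"
    by (simp add: bdet_def prod.distrib sum_distrib_left mult_ac)
  finally show ?thesis .
qed

section \<open>Second derivatives: symmetry and the transfer of C^2 regularity\<close>

lemma C1_on_open_line:
  fixes f :: "'e::euclidean_space \<Rightarrow> real"
  assumes "C1_on S f" "z + s *\<^sub>R v \<in> S"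
  shows "((\<lambda>s. f (z + s *\<^sub>R v)) has_real_derivative frechet_derivative f (at (z + s *\<^sub>R v)) v) (at s)"
proof -
  note D = C1_on_has_derivative[OF assms]
  have "((\<lambda>s. f (z + s *\<^sub>R v)) has_derivative (\<lambda>h. frechet_derivative f (at (z + s *\<^sub>R v)) (h *\<^sub>R v))) (at s)"
    by (rule has_derivative_compose[where f = "\<lambda>s. z + s *\<^sub>R v", OF _ D]) (auto intro!: derivative_eq_intros)
  then show ?thesis
    using linear_cmul[OF has_derivative_linear[OF D]]
    by (simp add: has_field_derivative_def mult.commute[of _ "frechet_derivative f _ v"])
qed

text \<open>Both iterated derivatives are limits of the second difference quotient in the directions \<open>v\<close> and \<open>w\<close>.\<close>

lemma second_difference_mvt:
  fixes f :: "'e::euclidean_space \<Rightarrow> real"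
  assumes f: "C2_on S f" and h: "h > 0"
    and seg: "\<And>a b. 0 \<le> a \<Longrightarrow> a \<le> h \<Longrightarrow> 0 \<le> b \<Longrightarrow> b \<le> h \<Longrightarrow> z + a *\<^sub>R v + b *\<^sub>R w \<in> S"
  obtains a b where "0 \<le> a" "a \<le> h" "0 \<le> b" "b \<le> h"
    "f (z + h *\<^sub>R v + h *\<^sub>R w) - f (z + h *\<^sub>R v) - f (z + h *\<^sub>R w) + f z
      = h * h * frechet_derivative (\<lambda>y. frechet_derivative f (at y) v) (at (z + a *\<^sub>R v + b *\<^sub>R w)) w"
proof -
  let ?Df = "\<lambda>y. frechet_derivative f (at y) v"
  have C1: "C1_on S f" "C1_on S ?Df" using f by (auto simp: C2_on_def)
  have d1: "((\<lambda>s. f (z + s *\<^sub>R v + h *\<^sub>R w) - f (z + s *\<^sub>R v)) has_real_derivative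
      ?Df (z + s *\<^sub>R v + h *\<^sub>R w) - ?Df (z + s *\<^sub>R v)) (at s)" if "0 \<le> s" "s \<le> h" for s
  proof (rule DERIV_diff)
    show "((\<lambda>s. f (z + s *\<^sub>R v)) has_real_derivative ?Df (z + s *\<^sub>R v)) (at s)"
      by (rule C1_on_open_line[OF C1(1)]) (use seg[of s 0] that h in auto)
    have "((\<lambda>s. f ((z + h *\<^sub>R w) + s *\<^sub>R v)) has_real_derivative ?Df ((z + h *\<^sub>R w) + s *\<^sub>R v)) (at s)"
      by (rule C1_on_open_line[OF C1(1)]) (use seg[of s h] that h in \<open>auto simp: add_ac\<close>)
    then show "((\<lambda>s. f (z + s *\<^sub>R v + h *\<^sub>R w)) has_real_derivative ?Df (z + s *\<^sub>R v + h *\<^sub>R w)) (at s)"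
      by (simp add: add_ac)
  qed
  obtain a where a: "0 < a" "a < h"
    "(f (z + h *\<^sub>R v + h *\<^sub>R w) - f (z + h *\<^sub>R v)) - (f (z + 0 *\<^sub>R v + h *\<^sub>R w) - f (z + 0 *\<^sub>R v))
      = (h - 0) * (?Df (z + a *\<^sub>R v + h *\<^sub>R w) - ?Df (z + a *\<^sub>R v))"
    using MVT2[OF h d1] by blast
  have d2: "((\<lambda>b. ?Df ((z + a *\<^sub>R v) + b *\<^sub>R w)) has_real_derivative
      frechet_derivative ?Df (at ((z + a *\<^sub>R v) + b *\<^sub>R w)) w) (at b)" if "0 \<le> b" "b \<le> h" for b
    by (rule C1_on_open_line[OF C1(2)]) (use seg[of a b] that a in auto)
  obtain b where b: "0 < b" "b < h"
    "?Df ((z + a *\<^sub>R v) + h *\<^sub>R w) - ?Df ((z + a *\<^sub>R v) + 0 *\<^sub>R w)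
      = (h - 0) * frechet_derivative ?Df (at ((z + a *\<^sub>R v) + b *\<^sub>R w)) w"
    using MVT2[OF h d2] by blast
  show thesis
  proof (rule that)
    show "f (z + h *\<^sub>R v + h *\<^sub>R w) - f (z + h *\<^sub>R v) - f (z + h *\<^sub>R w) + f z
      = h * h * frechet_derivative ?Df (at (z + a *\<^sub>R v + b *\<^sub>R w)) w"
      using a(3) b(3) by (simp add: algebra_simps)
  qed (use a b in auto)
qed

text \<open>For one radial and one tangential direction this exchanges the derivative in r with the
  differential along N.\<close>

lemma C2_on_symmetric:
  fixes f :: "'e::euclidean_space \<Rightarrow> real"
  assumes S: "open S" and f: "C2_on S f" and z: "z \<in> S"
  shows "frechet_derivative (\<lambda>y. frechet_derivative f (at y) v) (at z) w
    = frechet_derivative (\<lambda>y. frechet_derivative f (at y) w) (at z) v"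
proof -
  let ?A = "\<lambda>v w y. frechet_derivative (\<lambda>y. frechet_derivative f (at y) v) (at y) w"
  have cont: "isCont (?A v w) z" for v w
  proof -
    have "continuous_on S (?A v w)"
      using f by (intro C1_on_continuous_deriv) (auto simp: C2_on_def)
    then show ?thesis using S z by (simp add: continuous_on_eq_continuous_at)
  qed
  have "dist (?A v w z) (?A w v z) \<le> e" if e: "e > 0" for e
  proof -
    obtain d1 where d1: "d1 > 0" "\<And>y. dist y z < d1 \<Longrightarrow> dist (?A v w y) (?A v w z) < e / 2"
      using cont[of v w, unfolded continuous_at_eps_delta, rule_format, of "e / 2"] e by (auto simp: dist_norm)
    obtain d2 where d2: "d2 > 0" "\<And>y. dist y z < d2 \<Longrightarrow> dist (?A w v y) (?A w v z) < e / 2"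
      using cont[of w v, unfolded continuous_at_eps_delta, rule_format, of "e / 2"] e by (auto simp: dist_norm)
    obtain d3 where d3: "d3 > 0" "ball z d3 \<subseteq> S" using S z open_contains_ball by blast
    define d where "d = min d1 (min d2 d3)"
    define q where "q = norm v + norm w + 1"
    \<comment> \<open>Since \<open>q\<close> exceeds norm v + norm w, the parallelogram at
      \<open>z\<close> with sides \<open>h *\<^sub>R v\<close> and \<open>h *\<^sub>R w\<close>
      stays at distance less than \<open>d\<close> from \<open>z\<close>.\<close>
    define h where "h = d / 2 / q"
    have nn: "q > 0" by (simp add: q_def add_nonneg_pos)
    have dpos: "d > 0" using d1 d2 d3 by (simp add: d_def)
    then have h: "h > 0" using nn by (simp add: h_def)
    have near: "dist (z + a *\<^sub>R x + b *\<^sub>R y) z < d"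
      if "0 \<le> a" "a \<le> h" "0 \<le> b" "b \<le> h" "norm x + norm y = norm v + norm w" for a b x y
    proof -
      have "dist (z + a *\<^sub>R x + b *\<^sub>R y) z = norm (a *\<^sub>R x + b *\<^sub>R y)" by (simp add: dist_norm algebra_simps)
      also have "\<dots> \<le> a * norm x + b * norm y" using that by (intro norm_triangle_le) simp
      also have "\<dots> \<le> h * norm x + h * norm y" using that by (intro add_mono mult_right_mono) auto
      also have "\<dots> = h * (norm v + norm w)" using that(5) by (metis distrib_left)
      also have "\<dots> \<le> h * q" using h by (intro mult_left_mono) (auto simp: q_def)
      also have "\<dots> < d" using nn dpos by (simp add: h_def)
      finally show ?thesis .
    qed
    have inS: "y \<in> S" if "dist y z < d" for y
      using that d3 by (auto simp: d_def dist_commute)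
    obtain a b where ab: "0 \<le> a" "a \<le> h" "0 \<le> b" "b \<le> h"
      "f (z + h *\<^sub>R v + h *\<^sub>R w) - f (z + h *\<^sub>R v) - f (z + h *\<^sub>R w) + f z = h * h * ?A v w (z + a *\<^sub>R v + b *\<^sub>R w)"
      by (rule second_difference_mvt[OF f h, of z v w]) (use inS near in auto)
    obtain a' b' where ab': "0 \<le> a'" "a' \<le> h" "0 \<le> b'" "b' \<le> h"
      "f (z + h *\<^sub>R w + h *\<^sub>R v) - f (z + h *\<^sub>R w) - f (z + h *\<^sub>R v) + f z = h * h * ?A w v (z + a' *\<^sub>R w + b' *\<^sub>R v)"
      by (rule second_difference_mvt[OF f h, of z w v]) (use inS near in \<open>auto simp: add.commute\<close>)
    have "z + h *\<^sub>R w + h *\<^sub>R v = z + h *\<^sub>R v + h *\<^sub>R w" by (simp add: add_ac)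
    from ab(5) ab'(5)[unfolded this] have "h * h * ?A v w (z + a *\<^sub>R v + b *\<^sub>R w) = h * h * ?A w v (z + a' *\<^sub>R w + b' *\<^sub>R v)"
      by linarith
    then have eq: "?A v w (z + a *\<^sub>R v + b *\<^sub>R w) = ?A w v (z + a' *\<^sub>R w + b' *\<^sub>R v)" using h by simp
    have "dist (?A v w (z + a *\<^sub>R v + b *\<^sub>R w)) (?A v w z) < e / 2"
      by (rule d1(2)) (use near[OF ab(1-4), of v w] in \<open>simp add: d_def\<close>)
    moreover have "dist (?A w v (z + a' *\<^sub>R w + b' *\<^sub>R v)) (?A w v z) < e / 2"
      by (rule d2(2)) (use near[OF ab'(1-4), of w v] in \<open>simp add: d_def add.commute\<close>)
    ultimately show ?thesis unfolding eq dist_real_def by linarith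
  qed
  then have "dist (?A v w z) (?A w v z) \<le> 0" by (rule field_le_epsilon) simp
  then show ?thesis by simp
qed

lemma Ck_on_2_imp_C2_on:
  fixes f :: "'e::euclidean_space \<Rightarrow> real"
  assumes "Ck_on 2 f S" shows "C2_on S f"
proof -
  have "Ck_on (Suc (Suc 0)) f S" using assms by (simp add: numeral_2_eq_2)
  then have f: "\<And>y. y \<in> S \<Longrightarrow> f differentiable (at y)" "\<And>v. C1_on S (\<lambda>y. frechet_derivative f (at y) v)"
    unfolding C1_on_iff_Ck_on by (simp_all only: Ck_on.simps(2)) auto
  have "C1_on S f"
    by (rule C1_onI[where f' = "\<lambda>y. frechet_derivative f (at y)"])
      (use f in \<open>auto simp: frechet_derivative_works[symmetric] intro: C1_on_continuous\<close>)
  then show ?thesis using f by (simp add: C2_on_def)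
qed

lemma frechet_derivative_cong_open:
  assumes "open S" "z \<in> S" "\<And>y. y \<in> S \<Longrightarrow> f y = g y"
  shows "frechet_derivative f (at z) = frechet_derivative g (at z)"
proof -
  have "(f has_derivative D) (at z) \<longleftrightarrow> (g has_derivative D) (at z)" for D
    using has_derivative_transform_within_open[OF _ assms(1,2), of f D UNIV g]
      has_derivative_transform_within_open[OF _ assms(1,2), of g D UNIV f] assms(3) by auto
  then show ?thesis by (simp add: frechet_derivative_def)
qed

lemma C2_on_cong:
  assumes f: "C2_on S f" and S: "open S" and eq: "\<And>y. y \<in> S \<Longrightarrow> g y = f y"
  shows "C2_on S g"
  unfolding C2_on_def
proof (intro conjI allI)
  show "C1_on S g" using C1_on_cong[OF _ S eq] f by (auto simp: C2_on_def)
  show "C1_on S (\<lambda>y. frechet_derivative g (at y) v)" for v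
  proof (rule C1_on_cong[OF _ S])
    show "C1_on S (\<lambda>y. frechet_derivative f (at y) v)" using f by (auto simp: C2_on_def)
    show "frechet_derivative g (at y) v = frechet_derivative f (at y) v" if "y \<in> S" for y
      using frechet_derivative_cong_open[OF S that eq] by simp
  qed
qed

section \<open>Radial and tangential slices of a function on a product\<close>

context
  fixes g :: "real \<times> 'e::euclidean_space \<Rightarrow> real" and r0 :: real and V :: "'e set"
  assumes g: "C1_on ({r0<..} \<times> V) g"
begin

lemma slice_radial:
  assumes "r > r0" "y \<in> V"
  shows "((\<lambda>s. g (s, y)) has_real_derivative frechet_derivative g (at (r, y)) (1, 0)) (at r)"
proof -
  have mem: "(r, y) \<in> {r0<..} \<times> V" using assms by simp
  note D = C1_on_has_derivative[OF g mem]
  have "((\<lambda>s. g (s, y)) has_derivative (\<lambda>h. frechet_derivative g (at (r, y)) (h, 0))) (at r)"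
    by (rule has_derivative_compose[where f = "\<lambda>s. (s, y)", OF _ D]) (auto intro!: derivative_eq_intros)
  moreover have "(\<lambda>h. frechet_derivative g (at (r, y)) (h, 0)) = (*) (frechet_derivative g (at (r, y)) (1, 0))"
  proof
    fix h :: real
    show "frechet_derivative g (at (r, y)) (h, 0) = frechet_derivative g (at (r, y)) (1, 0) * h"
      using linear_cmul[OF has_derivative_linear[OF D], of h "(1, 0)"] by simp
  qed
  ultimately show ?thesis by (simp only: has_field_derivative_def)
qed

lemma slice_tangential:
  assumes "r > r0" "y \<in> V"
  shows "((\<lambda>y. g (r, y)) has_derivative (\<lambda>v. frechet_derivative g (at (r, y)) (0, v))) (at y)"
proof -
  note D = C1_on_has_derivative[OF g, of "(r, y)"]
  show ?thesis
    by (rule has_derivative_compose[where f = "\<lambda>y. (r, y)", OF _ D])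
      (use assms in \<open>auto intro!: derivative_eq_intros\<close>)
qed

lemma slice_tangential_C1:
  assumes "r > r0"
  shows "C1_on V (\<lambda>y. g (r, y))"
proof (rule C1_onI[OF slice_tangential[OF assms]])
  show "continuous_on V (\<lambda>y. frechet_derivative g (at (r, y)) (0, v))" for v
    by (rule continuous_on_compose2[OF C1_on_continuous_deriv[OF g]])
      (use assms in \<open>auto intro!: continuous_intros\<close>)
qed

lemma slice_frechet:
  assumes "r > r0" "y \<in> V"
  shows "frechet_derivative (\<lambda>y. g (r, y)) (at y) v = frechet_derivative g (at (r, y)) (0, v)"
  using frechet_derivative_at[OF slice_tangential[OF assms]] by metis

end

section \<open>Functions on a conical end\<close>

locale cone_fun = compact_riem_pou N A \<theta> K \<iota>
  for N :: "('i, 'a::{t2_space, second_countable_topology}, 'e::euclidean_space) riem" and A \<theta> K \<iota> +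
  fixes r0 :: real and u :: "real \<times> 'a \<Rightarrow> real"
  assumes r0: "r0 \<ge> 0" and u_C2: "Ck_function 2 (conical_end N r0) u"
begin

abbreviation E where "E \<equiv> conical_end N r0"

lemma points_E: "points E = {r0<..} \<times> points N"
  using r0 by (auto simp: conical_end_def open_submanifold_def eucl_cone_def)

lemma idx_E: "idx E = idx N"
  by (simp add: conical_end_def open_submanifold_def eucl_cone_def)

lemma patch_E: "i \<in> idx N \<Longrightarrow> patch E i = {r0<..} \<times> patch N i"
  using r0 patch_subset[of i] by (auto simp: conical_end_def open_submanifold_def eucl_cone_def)

lemma chart_E: "chart E i (r, x) = (r, chart N i x)"
  by (simp add: conical_end_def open_submanifold_def eucl_cone_def)

lemma metric_E: "metric E i (r, x) = (\<lambda>(a, v) (b, w). a * b + r\<^sup>2 * metric N i x v w)"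
  by (simp add: conical_end_def open_submanifold_def eucl_cone_def)

lemma chart_E_image: "i \<in> idx N \<Longrightarrow> chart E i ` patch E i = {r0<..} \<times> U i"
  by (force simp: patch_E chart_E image_iff)

lemma chart_inv_E:
  assumes i: "i \<in> idx N" and "r > r0" "y \<in> U i"
  shows "chart_inv E i (r, y) = (r, chart_inv N i y)"
  unfolding chart_inv_def[of E]
proof (rule inv_into_f_eq)
  show "inj_on (chart E i) (patch E i)"
  proof (rule inj_onI)
    fix p q assume "p \<in> patch E i" "q \<in> patch E i" "chart E i p = chart E i q"
    then show "p = q"
      using chart_inv_chart[OF i] by (cases p; cases q) (auto simp: patch_E[OF i] chart_E, metis)
  qed
qed (use assms in \<open>auto simp: patch_E chart_E\<close>)

text \<open>On \<open>S i\<close> this agrees with \<open>u \<circ> chart_inv E i\<close>, but it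
  avoids the \<open>inv_into\<close> of the cone chart by inverting only the chart of N.\<close>

definition W :: "'i \<Rightarrow> real \<times> 'e \<Rightarrow> real" where
  "W i z = u (fst z, chart_inv N i (snd z))"

abbreviation S where "S i \<equiv> {r0<..} \<times> U i"

lemma open_S: "i \<in> idx N \<Longrightarrow> open (S i)"
  by (intro open_Times open_U) auto

lemma W_C2: assumes i: "i \<in> idx N" shows "C2_on (S i) (W i)"
proof (rule C2_on_cong[OF Ck_on_2_imp_C2_on open_S[OF i]])
  show "Ck_on 2 (u \<circ> chart_inv E i) (S i)"
    using u_C2 i unfolding Ck_function_def idx_E chart_E_image[OF i, symmetric] by blast
  show "W i z = (u \<circ> chart_inv E i) z" if "z \<in> S i" for z
    using that chart_inv_E[OF i, of "fst z" "snd z"] by (auto simp: W_def)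
qed

lemma W_C1: "i \<in> idx N \<Longrightarrow> C1_on (S i) (W i)"
  and DW_C1: "i \<in> idx N \<Longrightarrow> C1_on (S i) (\<lambda>z. frechet_derivative (W i) (at z) v)"
  using W_C2[of i] unfolding C2_on_def by blast+

text \<open>The radial derivatives \<open>u1\<close> and \<open>u2\<close> are taken with the point
  of N held fixed and therefore involve no chart; \<open>u1_chart\<close> and
  \<open>u2_chart\<close> express them by derivatives of \<open>W\<close>.\<close>

definition u0 :: "real \<Rightarrow> 'a \<Rightarrow> real" where "u0 r p = u (r, p)"
definition u1 :: "real \<Rightarrow> 'a \<Rightarrow> real" where "u1 r p = deriv (\<lambda>s. u0 s p) r"
definition u2 :: "real \<Rightarrow> 'a \<Rightarrow> real" where "u2 r p = deriv (\<lambda>s. u1 s p) r"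

abbreviation W1 where "W1 i z \<equiv> frechet_derivative (W i) (at z) (1, 0)"

context
  fixes i assumes i: "i \<in> idx N"
begin

lemma u0_chart: "u0 r (chart_inv N i y) = W i (r, y)"
  by (simp add: u0_def W_def)

lemma u0_has_derivative_chart:
  assumes "r > r0" "p \<in> patch N i"
  shows "((\<lambda>s. u0 s p) has_real_derivative W1 i (r, chart N i p)) (at r)"
  using slice_radial[OF W_C1[OF i] assms(1), of "chart N i p"] assms i by (simp add: W_def u0_def)

lemma u1_chart:
  assumes "r > r0" "p \<in> patch N i" shows "u1 r p = W1 i (r, chart N i p)"
  unfolding u1_def by (rule DERIV_imp_deriv[OF u0_has_derivative_chart[OF assms]])

lemma u1_has_derivative_chart:
  assumes r: "r > r0" and p: "p \<in> patch N i"
  shows "((\<lambda>s. u1 s p) has_real_derivative frechet_derivative (W1 i) (at (r, chart N i p)) (1, 0)) (at r)"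
proof -
  have "((\<lambda>s. W1 i (s, chart N i p)) has_real_derivative frechet_derivative (W1 i) (at (r, chart N i p)) (1, 0)) (at r)"
    by (rule slice_radial[OF DW_C1[OF i]]) (use r p in auto)
  then show ?thesis
    by (rule has_field_derivative_transform_within_open[of _ _ _ "{r0<..}"])
      (use r p u1_chart in auto)
qed

lemma u2_chart:
  assumes "r > r0" "p \<in> patch N i"
  shows "u2 r p = frechet_derivative (W1 i) (at (r, chart N i p)) (1, 0)"
  unfolding u2_def by (rule DERIV_imp_deriv[OF u1_has_derivative_chart[OF assms]])

lemma u0_comp: "u0 r \<circ> chart_inv N i = (\<lambda>y. W i (r, y))"
  by (simp add: fun_eq_iff u0_chart)

lemma dd_u0:
  assumes "r > r0" "p \<in> patch N i"
  shows "dd i (u0 r) p v = frechet_derivative (W i) (at (r, chart N i p)) (0, v)"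
  unfolding dd_def u0_comp by (rule slice_frechet[OF W_C1[OF i]]) (use assms in auto)

lemma u0_C2_chart:
  assumes r: "r > r0" shows "C2_on (U i) (u0 r \<circ> chart_inv N i)"
  unfolding C2_on_def u0_comp
proof (intro conjI allI)
  show "C1_on (U i) (\<lambda>y. W i (r, y))" by (rule slice_tangential_C1[OF W_C1[OF i] r])
  show "C1_on (U i) (\<lambda>y. frechet_derivative (\<lambda>y. W i (r, y)) (at y) v)" for v
    by (rule C1_on_cong[OF slice_tangential_C1[OF DW_C1[OF i, of "(0, v)"] r] open_U[OF i]])
      (rule slice_frechet[OF W_C1[OF i] r])
qed

lemma u1_C1_chart:
  assumes r: "r > r0" shows "C1_on (U i) (u1 r \<circ> chart_inv N i)"
  by (rule C1_on_cong[OF slice_tangential_C1[OF DW_C1[OF i, of "(1, 0)"] r] open_U[OF i]])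
    (use u1_chart[OF r] i in auto)

lemma dd_u1:
  assumes r: "r > r0" and p: "p \<in> patch N i"
  shows "dd i (u1 r) p v = frechet_derivative (W1 i) (at (r, chart N i p)) (0, v)"
proof -
  have "frechet_derivative (u1 r \<circ> chart_inv N i) (at (chart N i p)) = frechet_derivative (\<lambda>y. W1 i (r, y)) (at (chart N i p))"
    by (rule frechet_derivative_cong_open[OF open_U[OF i]]) (use u1_chart[OF r] i p in auto)
  then show ?thesis
    unfolding dd_def using slice_frechet[OF DW_C1[OF i, of "(1, 0)"] r, of "chart N i p" v] p by simp
qed

text \<open>Symmetry of the second derivatives of \<open>W i\<close>, for a radial and a tangential
  direction.\<close>

lemma dd_u0_has_derivative:
  assumes r: "r > r0" and p: "p \<in> patch N i"
  shows "((\<lambda>s. dd i (u0 s) p v) has_real_derivative dd i (u1 r) p v) (at r)"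
proof -
  let ?z = "(r, chart N i p)"
  have "((\<lambda>s. frechet_derivative (W i) (at (s, chart N i p)) (0, v)) has_real_derivative
      frechet_derivative (\<lambda>z. frechet_derivative (W i) (at z) (0, v)) (at ?z) (1, 0)) (at r)"
    by (rule slice_radial[OF DW_C1[OF i]]) (use r p in auto)
  also have "frechet_derivative (\<lambda>z. frechet_derivative (W i) (at z) (0, v)) (at ?z) (1, 0) = dd i (u1 r) p v"
    unfolding dd_u1[OF r p]
    by (rule C2_on_symmetric[OF open_S[OF i] W_C2[OF i]]) (use r p in auto)
  finally show ?thesis
    by (rule has_field_derivative_transform_within_open[of _ _ _ "{r0<..}"])
      (use r p dd_u0 in auto)
qed

lemma continuous_on_joint_chart:
  assumes "continuous_on (S i) f"
  shows "continuous_on ({r0<..} \<times> patch N i) (\<lambda>(r, p). f (r, chart N i p))"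
proof -
  have "continuous_on ({r0<..} \<times> patch N i) (\<lambda>z. chart N i (snd z))"
    by (rule continuous_on_compose2[OF continuous_chart[OF i]]) (auto intro: continuous_intros)
  then have c: "continuous_on ({r0<..} \<times> patch N i) (\<lambda>z. (fst z, chart N i (snd z)))"
    by (intro continuous_intros)
  have "continuous_on ({r0<..} \<times> patch N i) (\<lambda>z. f (fst z, chart N i (snd z)))"
    by (rule continuous_on_compose2[OF assms c]) auto
  then show ?thesis by (simp add: case_prod_unfold)
qed

end

lemma continuous_on_joint:
  fixes f :: "real \<times> 'a \<Rightarrow> real"
  assumes "\<And>i. i \<in> idx N \<Longrightarrow> continuous_on ({r0<..} \<times> patch N i) f"
  shows "continuous_on ({r0<..} \<times> points N) f"
  unfolding continuous_on_eq_continuous_within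
proof
  fix z assume z: "z \<in> {r0<..} \<times> points N"
  then obtain i where i: "i \<in> idx N" "snd z \<in> patch N i" by (auto simp: points_eq)
  obtain T where T: "open T" "patch N i = points N \<inter> T"
    using openin_patch[OF i(1)] by (auto simp: openin_open)
  have op: "open ((UNIV :: real set) \<times> T)" by (intro open_Times open_UNIV T(1))
  have "at z within {r0<..} \<times> points N = at z within {r0<..} \<times> patch N i"
    by (rule at_within_nhd[OF _ op]) (use z i T in \<open>auto simp: mem_Times_iff\<close>)
  moreover have "continuous (at z within {r0<..} \<times> patch N i) f"
    using assms[OF i(1)] z i(2) by (cases z) (auto simp: continuous_on_eq_continuous_within mem_Times_iff)
  ultimately show "continuous (at z within {r0<..} \<times> points N) f" by simp
qed

lemma u0_C2_fun: "r > r0 \<Longrightarrow> C2_fun (u0 r)"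
  unfolding C2_fun_def using u0_C2_chart by blast

lemma u0_C1_fun: "r > r0 \<Longrightarrow> C1_fun (u0 r)"
  by (intro C2_fun_C1_fun u0_C2_fun)

lemma u1_C1_fun: "r > r0 \<Longrightarrow> C1_fun (u1 r)"
  unfolding C1_fun_def using u1_C1_chart by blast

lemma u0_has_derivative: "r > r0 \<Longrightarrow> p \<in> points N \<Longrightarrow> ((\<lambda>s. u0 s p) has_real_derivative u1 r p) (at r)"
  using chart_at[of p] u0_has_derivative_chart u1_chart by metis

lemma u1_has_derivative: "r > r0 \<Longrightarrow> p \<in> points N \<Longrightarrow> ((\<lambda>s. u1 s p) has_real_derivative u2 r p) (at r)"
  using chart_at[of p] u1_has_derivative_chart u2_chart by metis

text \<open>Continuity jointly in radius and point, here and for \<open>u1\<close> and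
  \<open>u2\<close>, is what differentiation under the integral sign over N relies on.\<close>

lemma u0_joint: "continuous_on ({r0<..} \<times> points N) (\<lambda>(r, p). u0 r p)"
proof (rule continuous_on_joint)
  fix i assume i: "i \<in> idx N"
  show "continuous_on ({r0<..} \<times> patch N i) (\<lambda>(r, p). u0 r p)"
    by (rule continuous_on_eq[OF continuous_on_joint_chart[OF i C1_on_continuous[OF W_C1[OF i]]]])
      (use i in \<open>auto simp: W_def u0_def\<close>)
qed

lemma u1_joint: "continuous_on ({r0<..} \<times> points N) (\<lambda>(r, p). u1 r p)"
proof (rule continuous_on_joint)
  fix i assume i: "i \<in> idx N"
  show "continuous_on ({r0<..} \<times> patch N i) (\<lambda>(r, p). u1 r p)"
    by (rule continuous_on_eq[OF continuous_on_joint_chart[OF i C1_on_continuous[OF DW_C1[OF i, of "(1, 0)"]]]])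
      (use u1_chart[OF i] in auto)
qed

lemma u2_joint: "continuous_on ({r0<..} \<times> points N) (\<lambda>(r, p). u2 r p)"
proof (rule continuous_on_joint)
  fix i assume i: "i \<in> idx N"
  show "continuous_on ({r0<..} \<times> patch N i) (\<lambda>(r, p). u2 r p)"
    by (rule continuous_on_eq[OF continuous_on_joint_chart[OF i
            C1_on_continuous_deriv[OF DW_C1[OF i, of "(1, 0)"], of "(1, 0)"]]])
      (use u2_chart[OF i] in auto)
qed

lemma pairing_sym:
  assumes "C1_fun f" "C1_fun h" "i \<in> idx N" "p \<in> patch N i"
  shows "pairing i f h p = pairing i h f p"
  unfolding pairing_def
  by (simp only: gradient_metric[OF assms(1,3,4), symmetric] gradient_metric[OF assms(2,3,4), symmetric]
      metric_sym[OF assms(3,4), of "gradient N f i p"])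

text \<open>The inverse metric of N does not depend on r, so in a fixed chart the squared gradient
  is a quadratic form with constant coefficients in the differential of \<open>u0 r\<close>.\<close>

lemma prN_u0_has_derivative:
  assumes r: "r > r0" and p: "p \<in> points N"
  shows "((\<lambda>s. prN (u0 s) (u0 s) p) has_real_derivative 2 * prN (u1 r) (u0 r) p) (at r)"
proof -
  let ?i = "chart_at N p"
  have i: "?i \<in> idx N" and pi: "p \<in> patch N ?i" using chart_at[OF p] by auto
  note d = dd_u0_has_derivative[OF i r pi]
  have "((\<lambda>s. \<Sum>b\<in>Basis. \<Sum>c\<in>Basis. dd ?i (u0 s) p b * dd ?i (u0 s) p c * (covec ?i c p \<bullet> b)) has_real_derivative
      (\<Sum>b\<in>Basis. \<Sum>c\<in>Basis. (dd ?i (u1 r) p b * dd ?i (u0 r) p c + dd ?i (u1 r) p c * dd ?i (u0 r) p b) * (covec ?i c p \<bullet> b))) (at r)"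
    by (intro DERIV_sum DERIV_cmult_right DERIV_mult d)
  also have "(\<Sum>b\<in>Basis. \<Sum>c\<in>Basis. (dd ?i (u1 r) p b * dd ?i (u0 r) p c + dd ?i (u1 r) p c * dd ?i (u0 r) p b) * (covec ?i c p \<bullet> b))
      = pairing ?i (u1 r) (u0 r) p + pairing ?i (u0 r) (u1 r) p"
    unfolding pairing_eq[OF u1_C1_fun[OF r] u0_C1_fun[OF r] i pi] pairing_eq[OF u0_C1_fun[OF r] u1_C1_fun[OF r] i pi]
    by (simp add: sum.distrib[symmetric] algebra_simps)
  also have "\<dots> = 2 * prN (u1 r) (u0 r) p"
    using pairing_sym[OF u1_C1_fun[OF r] u0_C1_fun[OF r] i pi] by (simp add: prN_def)
  finally show ?thesis
    by (rule has_field_derivative_transform_within_open[of _ _ _ "{r0<..}"])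
      (use r pairing_eq[OF u0_C1_fun u0_C1_fun i pi] in \<open>auto simp: prN_def\<close>)
qed

lemma prN_joint: "continuous_on ({r0<..} \<times> points N) (\<lambda>(r, p). prN (u1 r) (u0 r) p)"
proof (rule continuous_on_joint)
  fix i assume i: "i \<in> idx N"
  let ?J = "{r0<..} \<times> patch N i"
  have c1: "continuous_on ?J (\<lambda>z. dd i (u1 (fst z)) (snd z) b)" for b
    by (rule continuous_on_eq[OF continuous_on_joint_chart[OF i
            C1_on_continuous_deriv[OF DW_C1[OF i, of "(1, 0)"], of "(0, b)"]]])
      (use dd_u1[OF i] in auto)
  have c0: "continuous_on ?J (\<lambda>z. dd i (u0 (fst z)) (snd z) b)" for b
    by (rule continuous_on_eq[OF continuous_on_joint_chart[OF i C1_on_continuous_deriv[OF W_C1[OF i], of "(0, b)"]]])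
      (use dd_u0[OF i] in auto)
  have cc: "continuous_on ?J (\<lambda>z. covec i b (snd z))" for b
  proof -
    have "continuous_on ?J (\<lambda>z. covec i b (chart_inv N i (chart N i (snd z))))"
      by (intro continuous_on_compose2[OF C1_on_continuous[OF covec_C1[OF i]]]
          continuous_on_compose2[OF continuous_chart[OF i]] continuous_intros) auto
    then show ?thesis by (rule continuous_on_eq) (use i in auto)
  qed
  have "continuous_on ?J (\<lambda>z. \<Sum>b\<in>Basis. \<Sum>c\<in>Basis. dd i (u1 (fst z)) (snd z) b * dd i (u0 (fst z)) (snd z) c * (covec i c (snd z) \<bullet> b))"
    by (intro continuous_intros c1 c0 cc)
  then show "continuous_on ?J (\<lambda>(r, p). prN (u1 r) (u0 r) p)"
  proof (rule continuous_on_eq)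
    fix z assume "z \<in> ?J"
    then have z: "fst z > r0" "snd z \<in> patch N i" by auto
    show "(\<Sum>b\<in>Basis. \<Sum>c\<in>Basis. dd i (u1 (fst z)) (snd z) b * dd i (u0 (fst z)) (snd z) c * (covec i c (snd z) \<bullet> b))
        = (case z of (r, p) \<Rightarrow> prN (u1 r) (u0 r) p)"
      using pairing_eq[OF u1_C1_fun[OF z(1)] u0_C1_fun[OF z(1)] i z(2)]
        prN_eq[OF u1_C1_fun[OF z(1)] u0_C1_fun[OF z(1)] i z(2)] by (simp add: case_prod_unfold)
  qed
qed

lemma joint_slice: "continuous_on ({r0<..} \<times> points N) (\<lambda>(r, p). f r p) \<Longrightarrow> r > r0 \<Longrightarrow> continuous_on (points N) (f r)"
proof -
  assume f: "continuous_on ({r0<..} \<times> points N) (\<lambda>(r, p). f r p)" and r: "r > r0"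
  have "continuous_on (points N) (\<lambda>p. (r, p))" by (intro continuous_intros)
  from continuous_on_compose2[OF f this] r show ?thesis by auto
qed

lemma u0_cont: "r > r0 \<Longrightarrow> continuous_on (points N) (u0 r)"
  and u1_cont: "r > r0 \<Longrightarrow> continuous_on (points N) (u1 r)"
  and u2_cont: "r > r0 \<Longrightarrow> continuous_on (points N) (u2 r)"
  using joint_slice[OF u0_joint] joint_slice[OF u1_joint] joint_slice[OF u2_joint] by auto

subsection \<open>Gradient and Laplacian of the cone\<close>

text \<open>The cone metric is block diagonal with blocks 1 and r^2 g_N, so raising the index of du
  keeps the radial component and divides the tangential one by r^2. Testing with purely radial and
  purely tangential vectors yields uniqueness.\<close>

lemma gradient_E:
  assumes i: "i \<in> idx N" and r: "r > r0" and p: "p \<in> patch N i"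
  shows "gradient E u i (r, p) = (u1 r p, (1 / r\<^sup>2) *\<^sub>R gradient N (u0 r) i p)"
proof -
  have rpos: "r > 0" using r r0 by simp
  have z: "(r, chart N i p) \<in> S i" using r p by auto
  let ?D = "frechet_derivative (W i) (at (r, chart N i p))"
  have D: "frechet_derivative (u \<circ> chart_inv E i) (at (chart E i (r, p))) = ?D"
    unfolding chart_E
    by (rule frechet_derivative_cong_open[OF open_S[OF i] z]) (use chart_inv_E[OF i] in \<open>auto simp: W_def\<close>)
  have split: "?D (b, w) = b * u1 r p + dd i (u0 r) p w" for b w
  proof -
    have lin: "linear ?D" using C1_on_has_derivative[OF W_C1[OF i] z] has_derivative_linear by blast
    have "?D (b *\<^sub>R (1, 0) + (0, w)) = b * u1 r p + dd i (u0 r) p w"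
      unfolding linear_add[OF lin] linear_cmul[OF lin] u1_chart[OF i r p] dd_u0[OF i r p] by simp
    then show ?thesis by simp
  qed
  note bil = metric_bilinear[OF i p]
  note rep = gradient_metric[OF u0_C1_fun[OF r] i p]
  note lin = dd_linear[OF u0_C1_fun[OF r] i p]
  show ?thesis
    unfolding gradient_def[of E] D
  proof (rule the_equality)
    show "\<forall>w. metric E i (r, p) (u1 r p, (1 / r\<^sup>2) *\<^sub>R gradient N (u0 r) i p) w = ?D w"
      using rpos by (auto simp: metric_E split bilinear_lmul[OF bil] rep mult.commute)
  next
    fix v assume v: "\<forall>w. metric E i (r, p) v w = ?D w"
    obtain a v' where av: "v = (a, v')" by (cases v)
    have "a = u1 r p"
      using v[rule_format, of "(1, 0)"] linear_0[OF lin] bilinear_rzero[OF bil]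
      by (simp add: av metric_E split)
    moreover have "metric N i p (r\<^sup>2 *\<^sub>R v') w = dd i (u0 r) p w" for w
      using v[rule_format, of "(0, w)"] by (simp add: av metric_E split bilinear_lmul[OF bil])
    then have "r\<^sup>2 *\<^sub>R v' = gradient N (u0 r) i p"
      using representing_vector[OF i p lin] rep by blast
    then have "v' = (1 / r\<^sup>2) *\<^sub>R gradient N (u0 r) i p" using rpos by (metis divide_self_if power_not_zero scaleR_one scaleR_scaleR times_divide_eq_left less_irrefl mult_1)
    ultimately show "v = (u1 r p, (1 / r\<^sup>2) *\<^sub>R gradient N (u0 r) i p)" by (simp add: av)
  qed
qed

lemma chart_at_E: "r > r0 \<Longrightarrow> p \<in> points N \<Longrightarrow> chart_at E (r, p) = chart_at N p"
proof -
  assume "r > r0" "p \<in> points N"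
  then have "(\<lambda>i. i \<in> idx E \<and> (r, p) \<in> patch E i) = (\<lambda>i. i \<in> idx N \<and> p \<in> patch N i)"
    by (auto simp: fun_eq_iff idx_E patch_E)
  then show ?thesis unfolding chart_at_def by simp
qed

lemma grad_norm_E:
  assumes r: "r > r0" and p: "p \<in> points N"
  shows "(grad_norm E u (r, p))\<^sup>2 = (u1 r p)\<^sup>2 + prN (u0 r) (u0 r) p / r\<^sup>2" "grad_norm E u (r, p) \<ge> 0"
proof -
  let ?i = "chart_at N p"
  have i: "?i \<in> idx N" and pi: "p \<in> patch N ?i" using chart_at[OF p] by auto
  have rpos: "r > 0" using r r0 by simp
  note bil = metric_bilinear[OF i pi]
  let ?g = "gradient N (u0 r) ?i p"
  have G: "metric N ?i p ?g ?g = prN (u0 r) (u0 r) p"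
    by (simp add: prN_def pairing_def gradient_metric[OF u0_C1_fun[OF r] i pi])
  have eq: "grad_norm E u (r, p) = sqrt ((u1 r p)\<^sup>2 + prN (u0 r) (u0 r) p / r\<^sup>2)"
    unfolding grad_norm_def Let_def chart_at_E[OF r p] gradient_E[OF i r pi] metric_E
    using rpos by (simp add: bilinear_lmul[OF bil] bilinear_rmul[OF bil] G power2_eq_square)
  have nn: "(u1 r p)\<^sup>2 + prN (u0 r) (u0 r) p / r\<^sup>2 \<ge> 0"
    using prN_self_nonneg[OF u0_C1_fun[OF r] p] by simp
  show "(grad_norm E u (r, p))\<^sup>2 = (u1 r p)\<^sup>2 + prN (u0 r) (u0 r) p / r\<^sup>2" using nn by (simp add: eq)
  show "grad_norm E u (r, p) \<ge> 0" using nn by (simp add: eq)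
qed

lemma vol_density_E:
  assumes i: "i \<in> idx N" and r: "r > r0" and p: "p \<in> patch N i"
  shows "vol_density E i (r, p) = r ^ DIM('e) * vol_density N i p"
proof -
  have rpos: "r > 0" using r r0 by simp
  have "gram_det E i (r, p) = bdet (metric E i (r, p))" by (simp add: gram_det_def bdet_def)
  also have "\<dots> = (r\<^sup>2) ^ DIM('e) * bdet (metric N i p)"
    unfolding metric_E
    by (rule bdet_cone) (use bilinear_lzero[OF metric_bilinear[OF i p]] in auto)
  also have "(r\<^sup>2) ^ DIM('e) = (r ^ DIM('e))\<^sup>2" by (simp add: power_mult[symmetric] mult.commute)
  finally show ?thesis
    using rpos by (simp add: vol_density_def real_sqrt_mult gram_det_eq[OF i])
qed

text \<open>The first-order coefficient comes from differentiating the density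
  \<open>r ^ DIM('e)\<close>, where \<open>DIM('e)\<close> is n - 1. For the tangential components
  the radius is a constant, and only the factor 1 / r^2 of the gradient remains in front of the
  Laplacian of N.\<close>

lemma laplacian_E:
  assumes r: "r > r0" and p: "p \<in> points N"
  shows "laplacian E u (r, p) = u2 r p + real DIM('e) / r * u1 r p + lapN (u0 r) p / r\<^sup>2"
proof -
  let ?i = "chart_at N p" and ?d = "DIM('e)"
  have i: "?i \<in> idx N" and pi: "p \<in> patch N ?i" using chart_at[OF p] by auto
  have rpos: "r > 0" using r r0 by simp
  let ?y = "chart N ?i p" and ?k = "chart_inv N ?i"
  have z: "(r, ?y) \<in> S ?i" using r pi by auto
  define vol where "vol y = vol_density N ?i (?k y)" for y
  define X where "X b s y = vol y * (gradient N (u0 s) ?i (?k y) \<bullet> b)" for b s y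
  define F where "F b z = vol_density E ?i (chart_inv E ?i z) * (gradient E u ?i (chart_inv E ?i z) \<bullet> b)" for b z
  have Fe: "F (1, 0) (s, y) = s ^ ?d * (vol y * W1 ?i (s, y))" if "(s, y) \<in> S ?i" for s y
    using that i by (auto simp: F_def chart_inv_E vol_density_E gradient_E vol_def u1_chart)
  have Fb: "F (0, b) (s, y) = (s ^ ?d * (1 / s\<^sup>2)) * X b s y" if "(s, y) \<in> S ?i" for s y b
    using that i by (auto simp: F_def chart_inv_E vol_density_E gradient_E vol_def X_def)
  have volC: "C1_on (S ?i) (\<lambda>z. vol (snd z))"
    using C1_on_compose[OF vol_C1[OF i] C1_on_linear[OF linear_snd], of "S ?i"] by (auto simp: vol_def)
  have idC: "C1_on (S ?i) (\<lambda>z. fst z)" by (rule C1_on_linear[OF linear_fst])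
  have powC: "C1_on (S ?i) (\<lambda>z. (fst z) ^ n)" for n
    using C1_on_prod[of "{..<n}" "S ?i" "\<lambda>_ z. fst z"] idC by simp
  have FeC: "C1_on (S ?i) (F (1, 0))"
    by (rule C1_on_cong[OF C1_on_mult[OF powC[of ?d] C1_on_mult[OF volC DW_C1[OF i, of "(1, 0)"]]] open_S[OF i]])
      (use Fe in auto)
  \<comment> \<open>Differentiability along N alone would not do: \<open>divergence\<close> takes
    derivatives in the full product, and the slice lemmas need joint regularity.\<close>
  have XC: "C1_on (S ?i) (\<lambda>z. X b (fst z) (snd z))" for b
  proof -
    have cov: "C1_on (S ?i) (\<lambda>z. covec ?i c (?k (snd z)) \<bullet> b)" for c
      using C1_on_compose[OF C1_on_inner[OF covec_C1[OF i]] C1_on_linear[OF linear_snd], of "S ?i" c b] by auto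
    have "C1_on (S ?i) (\<lambda>z. vol (snd z) * (\<Sum>c\<in>Basis. frechet_derivative (W ?i) (at z) (0, c) * (covec ?i c (?k (snd z)) \<bullet> b)))"
      by (intro C1_on_mult C1_on_sum volC DW_C1 i cov)
    then show ?thesis
    proof (rule C1_on_cong[OF _ open_S[OF i]])
      fix z assume "z \<in> S ?i"
      then have z: "fst z > r0" "snd z \<in> U ?i" by auto
      then have k: "?k (snd z) \<in> patch N ?i" using i by simp
      show "X b (fst z) (snd z) = vol (snd z) * (\<Sum>c\<in>Basis. frechet_derivative (W ?i) (at z) (0, c) * (covec ?i c (?k (snd z)) \<bullet> b))"
        using z i by (simp add: X_def gradient_eq[OF u0_C1_fun[OF z(1)] i k] inner_sum_left dd_u0[OF i z(1) k])
    qed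
  qed
  have FbC: "C1_on (S ?i) (F (0, b))" for b
  proof -
    have "C1_on (S ?i) (\<lambda>z. ((fst z) ^ ?d * (1 / (fst z)\<^sup>2)) * X b (fst z) (snd z))"
    proof (intro C1_on_mult powC C1_on_divide C1_on_const XC)
      show "(fst z)\<^sup>2 \<noteq> 0" if "z \<in> S ?i" for z using that r0 by auto
    qed
    then show ?thesis by (rule C1_on_cong[OF _ open_S[OF i]]) (use Fb in auto)
  qed
  have e: "frechet_derivative (F (1, 0)) (at (r, ?y)) (1, 0)
      = vol ?y * (real ?d * r ^ (?d - 1) * u1 r p + r ^ ?d * u2 r p)"
  proof -
    have "((\<lambda>s. F (1, 0) (s, ?y)) has_real_derivative frechet_derivative (F (1, 0)) (at (r, ?y)) (1, 0)) (at r)"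
      by (rule slice_radial[OF FeC r]) (use pi in auto)
    moreover have "((\<lambda>s. s ^ ?d * (vol ?y * W1 ?i (s, ?y))) has_real_derivative
        (real ?d * r ^ (?d - 1)) * (vol ?y * W1 ?i (r, ?y)) + (vol ?y * frechet_derivative (W1 ?i) (at (r, ?y)) (1, 0)) * r ^ ?d) (at r)"
      using slice_radial[OF DW_C1[OF i, of "(1, 0)"] r, of ?y] pi
      by (intro DERIV_mult DERIV_cmult) (auto intro!: derivative_eq_intros)
    then have "((\<lambda>s. F (1, 0) (s, ?y)) has_real_derivative
        (real ?d * r ^ (?d - 1)) * (vol ?y * W1 ?i (r, ?y)) + (vol ?y * frechet_derivative (W1 ?i) (at (r, ?y)) (1, 0)) * r ^ ?d) (at r)"
      by (rule has_field_derivative_transform_within_open[of _ _ _ "{r0<..}"]) (use Fe r pi in auto)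
    ultimately have "frechet_derivative (F (1, 0)) (at (r, ?y)) (1, 0) =
        (real ?d * r ^ (?d - 1)) * (vol ?y * W1 ?i (r, ?y)) + (vol ?y * frechet_derivative (W1 ?i) (at (r, ?y)) (1, 0)) * r ^ ?d"
      by (rule DERIV_unique)
    then show ?thesis by (simp add: u1_chart[OF i r pi] u2_chart[OF i r pi] algebra_simps)
  qed
  have t: "frechet_derivative (F (0, b)) (at (r, ?y)) (0, b)
      = (r ^ ?d * (1 / r\<^sup>2)) * frechet_derivative (X b r) (at ?y) b" for b
  proof -
    have XD: "(X b r has_derivative frechet_derivative (X b r) (at ?y)) (at ?y)"
    proof -
      have "C1_on (U ?i) (\<lambda>y. X b r y)"
        using slice_tangential_C1[OF XC[of b] r] by simp
      then show ?thesis by (rule C1_on_has_derivative) (use pi in auto)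
    qed
    have "frechet_derivative (F (0, b)) (at (r, ?y)) (0, b) = frechet_derivative (\<lambda>y. F (0, b) (r, y)) (at ?y) b"
      by (rule slice_frechet[OF FbC r, symmetric]) (use pi in auto)
    also have "frechet_derivative (\<lambda>y. F (0, b) (r, y)) (at ?y) = frechet_derivative (\<lambda>y. (r ^ ?d * (1 / r\<^sup>2)) * X b r y) (at ?y)"
      by (rule frechet_derivative_cong_open[OF open_U[OF i]]) (use Fb r pi in auto)
    also have "\<dots> = (\<lambda>v. (r ^ ?d * (1 / r\<^sup>2)) * frechet_derivative (X b r) (at ?y) v)"
      by (rule frechet_derivative_at[symmetric, OF has_derivative_mult_right[OF XD]])
    finally show ?thesis by simp
  qed
  have vE: "vol_density E ?i (r, p) = r ^ ?d * vol ?y"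
    using vol_density_E[OF i r pi] pi i by (simp add: vol_def)
  have volpos: "vol ?y > 0" using vol_pos[OF i pi] pi i by (simp add: vol_def)
  have d1: "r ^ ?d = r * r ^ (?d - 1)"
    by (metis DIM_positive power_eq_if less_irrefl mult.commute)
  have "laplacian E u (r, p) = (\<Sum>b\<in>Basis. frechet_derivative (F b) (at (r, ?y)) b) / (r ^ ?d * vol ?y)"
    unfolding laplacian_def divergence_def Let_def chart_at_E[OF r p] vE F_def chart_E ..
  also have "(\<Sum>b\<in>Basis. frechet_derivative (F b) (at (r, ?y)) b)
      = frechet_derivative (F (1, 0)) (at (r, ?y)) (1, 0) + (\<Sum>b\<in>Basis. frechet_derivative (F (0, b)) (at (r, ?y)) (0, b))"
  proof -
    have "(1 :: real, 0 :: 'e) \<notin> Pair 0 ` Basis" by auto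
    then show ?thesis
      unfolding Basis_real_prod by (simp add: sum.reindex inj_on_def)
  qed
  also have "\<dots> = vol ?y * (real ?d * r ^ (?d - 1) * u1 r p + r ^ ?d * u2 r p)
      + (r ^ ?d * (1 / r\<^sup>2)) * (\<Sum>b\<in>Basis. frechet_derivative (X b r) (at ?y) b)"
    by (simp only: e t sum_distrib_left)
  also have "(\<Sum>b\<in>Basis. frechet_derivative (X b r) (at ?y) b) = lapN (u0 r) p * vol ?y"
    using volpos vol_pos[OF i pi] pi i by (simp add: lapN_def lap_def X_def[abs_def] vol_def)
  also have "(vol ?y * (real ?d * r ^ (?d - 1) * u1 r p + r ^ ?d * u2 r p) + r ^ ?d * (1 / r\<^sup>2) * (lapN (u0 r) p * vol ?y)) / (r ^ ?d * vol ?y)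
      = u2 r p + real ?d / r * u1 r p + lapN (u0 r) p / r\<^sup>2"
    using volpos rpos unfolding d1 by (simp add: field_simps power2_eq_square)
  finally show ?thesis .
qed

end

lemma radial_bigoD:
  assumes "radial_bigo S v f" "\<And>r. f r > 0"
  shows "\<exists>C. \<forall>\<^sub>F r in at_top. \<forall>x\<in>S. \<bar>v (r, x)\<bar> \<le> C * f r"
proof -
  obtain C :: real where C: "Limsup at_top (\<lambda>r. SUP x\<in>S. ereal \<bar>v (r, x) / f r\<bar>) < ereal C"
    using ereal_dense2[OF assms(1)[unfolded radial_bigo_def]] by blast
  have "\<forall>\<^sub>F r in at_top. (SUP x\<in>S. ereal \<bar>v (r, x) / f r\<bar>) < ereal C"
    by (rule Limsup_lessD[OF C])
  then have "\<forall>\<^sub>F r in at_top. \<forall>x\<in>S. \<bar>v (r, x)\<bar> \<le> C * f r"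
  proof eventually_elim
    case (elim r)
    show ?case
    proof
      fix x assume x: "x \<in> S"
      have "ereal \<bar>v (r, x) / f r\<bar> \<le> (SUP x\<in>S. ereal \<bar>v (r, x) / f r\<bar>)"
        by (rule SUP_upper[OF x])
      also note elim
      finally have "\<bar>v (r, x)\<bar> / f r < C" using assms(2)[of r] by (simp add: abs_divide)
      then show "\<bar>v (r, x)\<bar> \<le> C * f r" using assms(2)[of r] by (simp add: divide_less_eq)
    qed
  qed
  then show ?thesis by blast
qed

section \<open>Integrals over the cross-section as functions of the radius\<close>

context cone_fun
begin

text \<open>In the variable t = ln r this is the cylindrical operator applied to u: the second
  derivative in t, plus n - 2 times the first, plus the Laplacian of N.\<close>

definition e0 :: "real \<Rightarrow> 'a \<Rightarrow> real" where
  "e0 r p = r\<^sup>2 * laplacian E u (r, p)"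

text \<open>These seven are the counterparts of \<open>m\<close>, \<open>p\<close>,
  \<open>k\<close>, \<open>g\<close>, \<open>s\<close>, \<open>h\<close> and \<open>f2\<close>
  before the change of variables: \<open>u\<close> stands for w, the derivative in r for that in t,
  and \<open>e0\<close> for F.\<close>

definition IM where "IM r = I (\<lambda>p. u0 r p * u0 r p)"
definition IP where "IP r = I (\<lambda>p. u0 r p * u1 r p)"
definition IK where "IK r = I (\<lambda>p. u1 r p * u1 r p)"
definition IG where "IG r = I (\<lambda>p. prN (u0 r) (u0 r) p)"
definition H0 where "H0 r = I (\<lambda>p. e0 r p * u0 r p)"
definition H1 where "H1 r = I (\<lambda>p. e0 r p * u1 r p)"
definition H2 where "H2 r = I (\<lambda>p. e0 r p * e0 r p)"

context
  fixes r assumes r: "r > r0"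
begin

lemma r_pos: "r > 0" using r r0 by simp

lemma e0_eq: "p \<in> points N \<Longrightarrow> e0 r p = r\<^sup>2 * u2 r p + real DIM('e) * r * u1 r p + lapN (u0 r) p"
  using r_pos by (simp add: e0_def laplacian_E[OF r] field_simps power2_eq_square)

lemma lapN_u0_cont: "continuous_on (points N) (lapN (u0 r))"
  by (rule lapN_continuous[OF u0_C2_fun[OF r]])

lemma e0_cont: "continuous_on (points N) (e0 r)"
proof -
  have "continuous_on (points N) (\<lambda>p. r\<^sup>2 * u2 r p + real DIM('e) * r * u1 r p + lapN (u0 r) p)"
    by (intro continuous_intros u0_cont u1_cont u2_cont lapN_u0_cont r)
  then show ?thesis by (rule continuous_on_eq) (simp add: e0_eq)
qed

lemmas conts = u0_cont[OF r] u1_cont[OF r] u2_cont[OF r] lapN_u0_cont e0_cont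

text \<open>The formula for \<open>e0\<close> solved for the second radial derivative, so that u''
  can be traded for the equation and for the Laplacian of N, to which Green's formula
  applies.\<close>

lemma mult_u2:
  assumes f: "continuous_on (points N) f"
  shows "r\<^sup>2 * I (\<lambda>p. f p * u2 r p) = I (\<lambda>p. e0 r p * f p) - real DIM('e) * r * I (\<lambda>p. f p * u1 r p)
    - I (\<lambda>p. f p * lapN (u0 r) p)"
proof -
  have "I (\<lambda>p. e0 r p * f p) = I (\<lambda>p. (r\<^sup>2 * (f p * u2 r p) + (real DIM('e) * r) * (f p * u1 r p)) + f p * lapN (u0 r) p)"
    by (rule I_cong) (simp add: e0_eq algebra_simps)
  also have "\<dots> = (r\<^sup>2 * I (\<lambda>p. f p * u2 r p) + (real DIM('e) * r) * I (\<lambda>p. f p * u1 r p)) + I (\<lambda>p. f p * lapN (u0 r) p)"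
    by (subst I_add, (intro continuous_intros conts f)+, subst I_add, (intro continuous_intros conts f)+)
      (simp only: I_cmult)
  finally show ?thesis by simp
qed

lemma Green_u0: "I (\<lambda>p. u0 r p * lapN (u0 r) p) = - IG r"
  unfolding IG_def by (rule Green[OF u0_C1_fun[OF r] u0_C2_fun[OF r]])

lemma Green_u1: "I (\<lambda>p. u1 r p * lapN (u0 r) p) = - I (prN (u1 r) (u0 r))"
  by (rule Green[OF u1_C1_fun[OF r] u0_C2_fun[OF r]])

lemma IM_deriv: "(IM has_real_derivative 2 * IP r) (at r)"
proof -
  have "((\<lambda>s. I (\<lambda>p. u0 s p * u0 s p)) has_real_derivative I (\<lambda>p. 2 * (u0 r p * u1 r p))) (at r)"
  proof (rule I_has_real_derivative[of "{r0<..}"])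
    show "((\<lambda>s. u0 s p * u0 s p) has_real_derivative 2 * (u0 s p * u1 s p)) (at s)"
      if "s \<in> {r0<..}" "p \<in> points N" for s p
      using DERIV_mult[OF u0_has_derivative[of s p] u0_has_derivative[of s p]] that by (simp add: mult.commute)
    show "continuous_on (points N) (\<lambda>p. u0 s p * u0 s p)" if "s \<in> {r0<..}" for s
      using that by (intro continuous_intros u0_cont) auto
    show "continuous_on ({r0<..} \<times> points N) (\<lambda>(s, p). 2 * (u0 s p * u1 s p))"
      using u0_joint u1_joint unfolding case_prod_unfold by (intro continuous_intros)
  qed (use r in auto)
  then show ?thesis by (simp only: I_cmult IM_def[abs_def] IP_def)
qed

lemma IP_deriv: "(IP has_real_derivative IK r + (H0 r - real DIM('e) * r * IP r + IG r) / r\<^sup>2) (at r)"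
proof -
  have "((\<lambda>s. I (\<lambda>p. u0 s p * u1 s p)) has_real_derivative I (\<lambda>p. u1 r p * u1 r p + u0 r p * u2 r p)) (at r)"
  proof (rule I_has_real_derivative[of "{r0<..}"])
    show "((\<lambda>s. u0 s p * u1 s p) has_real_derivative u1 s p * u1 s p + u0 s p * u2 s p) (at s)"
      if "s \<in> {r0<..}" "p \<in> points N" for s p
      using DERIV_mult[OF u0_has_derivative[of s p] u1_has_derivative[of s p]] that by (simp add: mult.commute)
    show "continuous_on (points N) (\<lambda>p. u0 s p * u1 s p)" if "s \<in> {r0<..}" for s
      using that by (intro continuous_intros u0_cont u1_cont) auto
    show "continuous_on ({r0<..} \<times> points N) (\<lambda>(s, p). u1 s p * u1 s p + u0 s p * u2 s p)"
      using u0_joint u1_joint u2_joint unfolding case_prod_unfold by (intro continuous_intros)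
  qed (use r in auto)
  moreover have "I (\<lambda>p. u1 r p * u1 r p + u0 r p * u2 r p) = IK r + I (\<lambda>p. u0 r p * u2 r p)"
    unfolding IK_def by (rule I_add) (intro continuous_intros conts)+
  moreover have "I (\<lambda>p. u0 r p * u2 r p) = (H0 r - real DIM('e) * r * IP r + IG r) / r\<^sup>2"
    using mult_u2[OF conts(1)] Green_u0 r_pos unfolding H0_def[symmetric] IP_def[symmetric]
    by (simp add: field_simps)
  ultimately show ?thesis by (simp only: IP_def[abs_def])
qed

text \<open>The integral of g(\<nabla>u1, \<nabla>u0) arises from \<open>IG\<close> directly and
  from \<open>r\<^sup>2 * IK r\<close> through Green's formula, and cancels. In the last
  coefficient, 2 comes from differentiating r^2 and the rest from the first-order term of
  \<open>e0\<close>.\<close>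

lemma IK_IG_deriv:
  "((\<lambda>r. r\<^sup>2 * IK r - IG r) has_real_derivative 2 * H1 r + (2 - 2 * real DIM('e)) * r * IK r) (at r)"
proof -
  have K: "(IK has_real_derivative 2 * I (\<lambda>p. u1 r p * u2 r p)) (at r)"
  proof -
    have "((\<lambda>s. I (\<lambda>p. u1 s p * u1 s p)) has_real_derivative I (\<lambda>p. 2 * (u1 r p * u2 r p))) (at r)"
    proof (rule I_has_real_derivative[of "{r0<..}"])
      show "((\<lambda>s. u1 s p * u1 s p) has_real_derivative 2 * (u1 s p * u2 s p)) (at s)"
        if "s \<in> {r0<..}" "p \<in> points N" for s p
        using DERIV_mult[OF u1_has_derivative[of s p] u1_has_derivative[of s p]] that by (simp add: mult.commute)
      show "continuous_on (points N) (\<lambda>p. u1 s p * u1 s p)" if "s \<in> {r0<..}" for s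
        using that by (intro continuous_intros u1_cont) auto
      show "continuous_on ({r0<..} \<times> points N) (\<lambda>(s, p). 2 * (u1 s p * u2 s p))"
        using u1_joint u2_joint unfolding case_prod_unfold by (intro continuous_intros)
    qed (use r in auto)
    then show ?thesis by (simp only: I_cmult IK_def[abs_def])
  qed
  have G: "(IG has_real_derivative 2 * I (prN (u1 r) (u0 r))) (at r)"
  proof -
    have "((\<lambda>s. I (\<lambda>p. prN (u0 s) (u0 s) p)) has_real_derivative I (\<lambda>p. 2 * prN (u1 r) (u0 r) p)) (at r)"
    proof (rule I_has_real_derivative[of "{r0<..}"])
      show "((\<lambda>s. prN (u0 s) (u0 s) p) has_real_derivative 2 * prN (u1 s) (u0 s) p) (at s)"
        if "s \<in> {r0<..}" "p \<in> points N" for s p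
        using prN_u0_has_derivative[of s p] that by simp
      show "continuous_on (points N) (\<lambda>p. prN (u0 s) (u0 s) p)" if "s \<in> {r0<..}" for s
        using that by (intro prN_continuous u0_C1_fun) auto
      show "continuous_on ({r0<..} \<times> points N) (\<lambda>(s, p). 2 * prN (u1 s) (u0 s) p)"
        using prN_joint unfolding case_prod_unfold by (intro continuous_intros)
    qed (use r in auto)
    then show ?thesis by (simp only: I_cmult IG_def[abs_def])
  qed
  have eq: "r\<^sup>2 * I (\<lambda>p. u1 r p * u2 r p) = H1 r - real DIM('e) * r * IK r + I (prN (u1 r) (u0 r))"
    using mult_u2[OF conts(2)] Green_u1 by (simp add: H1_def IK_def)
  have "((\<lambda>r. r\<^sup>2 * IK r - IG r) has_real_derivative
      2 * r * IK r + r\<^sup>2 * (2 * I (\<lambda>p. u1 r p * u2 r p)) - 2 * I (prN (u1 r) (u0 r))) (at r)"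
    by (rule derivative_eq_intros K G refl)+ simp
  also have "2 * r * IK r + r\<^sup>2 * (2 * I (\<lambda>p. u1 r p * u2 r p)) - 2 * I (prN (u1 r) (u0 r))
      = 2 * H1 r + (2 - 2 * real DIM('e)) * r * IK r"
    using eq by (simp add: algebra_simps)
  finally show ?thesis .
qed

lemma quadratic_form:
  "I (\<lambda>p. (x * e0 r p + y * u1 r p + z * u0 r p)\<^sup>2)
    = x\<^sup>2 * H2 r + y\<^sup>2 * IK r + z\<^sup>2 * IM r + 2 * x * y * H1 r + 2 * x * z * H0 r + 2 * y * z * IP r"
proof -
  have "I (\<lambda>p. (x * e0 r p + y * u1 r p + z * u0 r p)\<^sup>2)
      = I (\<lambda>p. x\<^sup>2 * (e0 r p * e0 r p) + (y\<^sup>2 * (u1 r p * u1 r p) + (z\<^sup>2 * (u0 r p * u0 r p)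
          + ((2 * x * y) * (e0 r p * u1 r p) + ((2 * x * z) * (e0 r p * u0 r p) + (2 * y * z) * (u0 r p * u1 r p))))))"
    by (rule I_cong) (simp add: power2_eq_square algebra_simps)
  also have "\<dots> = x\<^sup>2 * H2 r + (y\<^sup>2 * IK r + (z\<^sup>2 * IM r + ((2 * x * y) * H1 r + ((2 * x * z) * H0 r + (2 * y * z) * IP r))))"
    unfolding H2_def IK_def IM_def H1_def H0_def IP_def
    by (subst I_add, (intro continuous_intros conts)+)+ (simp only: I_cmult)
  finally show ?thesis by simp
qed

lemma quadratic_form_nonneg:
  "0 \<le> x\<^sup>2 * H2 r + y\<^sup>2 * IK r + z\<^sup>2 * IM r + 2 * x * y * H1 r + 2 * x * z * H0 r + 2 * y * z * IP r"
  unfolding quadratic_form[symmetric]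
  by (rule I_nonneg) (intro continuous_intros conts, simp)

lemma IG_nonneg: "0 \<le> IG r"
  unfolding IG_def
  by (rule I_nonneg[OF prN_continuous[OF u0_C1_fun[OF r] u0_C1_fun[OF r]] prN_self_nonneg[OF u0_C1_fun[OF r]]])

text \<open>The differential inequality is squared, with (x + y)^2 \<le> 2 x^2 + 2 y^2, and
  multiplied by r^4. One factor r^2 goes to the gradient: r^2 |\<nabla>u|^2 is r^2 u1^2 plus the
  squared gradient along N.\<close>

lemma H2_le:
  assumes ineq: "\<And>p. p \<in> points N \<Longrightarrow> \<bar>laplacian E u (r, p)\<bar> \<le> b1 * \<bar>u (r, p)\<bar> + b2 * grad_norm E u (r, p)"
  shows "H2 r \<le> 2 * (r\<^sup>2 * b1)\<^sup>2 * IM r + 2 * (r * b2)\<^sup>2 * (r\<^sup>2 * IK r + IG r)"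
proof -
  have Gc: "continuous_on (points N) (\<lambda>p. prN (u0 r) (u0 r) p)"
    by (rule prN_continuous[OF u0_C1_fun[OF r] u0_C1_fun[OF r]])
  have "H2 r \<le> I (\<lambda>p. (2 * (r\<^sup>2 * b1)\<^sup>2) * (u0 r p * u0 r p) + (2 * (r * b2)\<^sup>2) * (r\<^sup>2 * (u1 r p * u1 r p) + prN (u0 r) (u0 r) p))"
    unfolding H2_def
  proof (rule I_mono)
    fix p assume p: "p \<in> points N"
    let ?g = "grad_norm E u (r, p)"
    have g2: "r\<^sup>2 * ?g\<^sup>2 = r\<^sup>2 * (u1 r p * u1 r p) + prN (u0 r) (u0 r) p"
      unfolding grad_norm_E(1)[OF r p] using r_pos by (simp add: field_simps power2_eq_square)
    have "\<bar>laplacian E u (r, p)\<bar>\<^sup>2 \<le> (b1 * \<bar>u (r, p)\<bar> + b2 * ?g)\<^sup>2"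
      by (rule power_mono[OF ineq[OF p]]) simp
    also have "\<dots> \<le> 2 * (b1 * \<bar>u (r, p)\<bar>)\<^sup>2 + 2 * (b2 * ?g)\<^sup>2"
      using sum_squares_bound[of "b1 * \<bar>u (r, p)\<bar>" "b2 * ?g"] by (simp add: power2_eq_square algebra_simps)
    finally have "(laplacian E u (r, p))\<^sup>2 \<le> 2 * (b1 * \<bar>u (r, p)\<bar>)\<^sup>2 + 2 * (b2 * ?g)\<^sup>2" by simp
    then have "(r\<^sup>2)\<^sup>2 * (laplacian E u (r, p))\<^sup>2 \<le> (r\<^sup>2)\<^sup>2 * (2 * (b1 * \<bar>u (r, p)\<bar>)\<^sup>2 + 2 * (b2 * ?g)\<^sup>2)"
      by (rule mult_left_mono) simp
    also have "\<dots> = (2 * (r\<^sup>2 * b1)\<^sup>2) * (u0 r p * u0 r p) + (2 * (r * b2)\<^sup>2) * (r\<^sup>2 * ?g\<^sup>2)"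
    proof -
      have "(b1 * \<bar>u (r, p)\<bar>)\<^sup>2 = b1\<^sup>2 * (u0 r p * u0 r p)"
        by (simp add: u0_def power_mult_distrib power2_eq_square)
      then show ?thesis by algebra
    qed
    finally show "e0 r p * e0 r p \<le> (2 * (r\<^sup>2 * b1)\<^sup>2) * (u0 r p * u0 r p) + (2 * (r * b2)\<^sup>2) * (r\<^sup>2 * (u1 r p * u1 r p) + prN (u0 r) (u0 r) p)"
      unfolding g2 by (simp add: e0_def power2_eq_square mult_ac)
  qed (intro continuous_intros conts Gc)+
  also have "\<dots> = (2 * (r\<^sup>2 * b1)\<^sup>2) * IM r + (2 * (r * b2)\<^sup>2) * (r\<^sup>2 * IK r + IG r)"
    unfolding IM_def IK_def IG_def
    by (subst I_add, (intro continuous_intros conts Gc)+, subst I_cmult, subst I_cmult, subst I_add, (intro continuous_intros conts Gc)+, subst I_cmult) simp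
  finally show ?thesis by simp
qed

lemma IM_le:
  assumes "\<And>p. p \<in> points N \<Longrightarrow> \<bar>u (r, p)\<bar> \<le> b"
  shows "IM r \<le> b\<^sup>2 * I (\<lambda>_. 1)"
proof -
  have "IM r \<le> I (\<lambda>p. b\<^sup>2 * 1)"
    unfolding IM_def
  proof (rule I_mono)
    fix p assume "p \<in> points N"
    from power_mono[OF assms[OF this] abs_ge_zero, of 2]
    show "u0 r p * u0 r p \<le> b\<^sup>2 * 1" by (simp add: u0_def power2_eq_square)
  qed (intro continuous_intros conts)+
  then show ?thesis unfolding I_cmult .
qed

lemma IM_eq_0_imp:
  assumes "IM r = 0" "p \<in> points N"
  shows "u (r, p) = 0"
proof -
  have "u0 r p * u0 r p = 0"
    by (rule I_zero_imp[OF _ _ assms(1)[unfolded IM_def] assms(2)]) (intro continuous_intros conts, simp)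
  then show ?thesis by (simp add: u0_def)
qed

end

text \<open>The change of variables \<open>r = exp t\<close>, \<open>w = exp (a t / 2) u\<close> with \<open>a = n - 2\<close> removes the first-order
  term of the cylindrical Laplacian at the cost of the constant potential \<open>a\<^sup>2 / 4\<close>.\<close>

theorem vanishing_criterion:
  fixes \<phi> \<phi>1 \<phi>2 \<phi>3 Q1 Q2 :: "real \<Rightarrow> real" and q1 q2 :: "real \<times> 'a \<Rightarrow> real" and t1 AA B \<kappa> :: real
  assumes t1: "exp t1 \<ge> r0"
    and ineq: "\<And>z. z \<in> points E \<Longrightarrow> \<bar>laplacian E u z\<bar> \<le> q1 z * \<bar>u z\<bar> + q2 z * grad_norm E u z"
    and q1: "\<And>t p. t > t1 \<Longrightarrow> p \<in> points N \<Longrightarrow> (exp t)\<^sup>2 * q1 (exp t, p) = Q1 t"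
    and q2: "\<And>t p. t > t1 \<Longrightarrow> p \<in> points N \<Longrightarrow> exp t * q2 (exp t, p) = Q2 t"
    and d\<phi>: "\<And>t. t > t1 \<Longrightarrow> (\<phi> has_real_derivative \<phi>1 t) (at t)"
    and d\<phi>1: "\<And>t. t > t1 \<Longrightarrow> (\<phi>1 has_real_derivative \<phi>2 t) (at t)"
    and d\<phi>2: "\<And>t. t > t1 \<Longrightarrow> (\<phi>2 has_real_derivative \<phi>3 t) (at t)"
    and A: "AA > 0" and B: "B \<ge> 1"
    and \<phi>_nonneg: "\<And>t. t > t1 \<Longrightarrow> \<phi> t \<ge> 0"
    and \<phi>1_pos: "\<And>t. t > t1 \<Longrightarrow> \<phi>1 t > 0" and \<phi>2_pos: "\<And>t. t > t1 \<Longrightarrow> \<phi>2 t > 0"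
    and \<phi>2_le: "\<And>t. t > t1 \<Longrightarrow> \<phi>2 t \<le> AA * (\<phi>1 t)\<^sup>2"
    and \<phi>3_le: "\<And>t. t > t1 \<Longrightarrow> \<bar>\<phi>3 t\<bar> \<le> AA * \<phi>2 t * \<phi>1 t"
    and \<phi>1_ge: "\<And>t. t > t1 \<Longrightarrow> 1 \<le> AA * \<phi>1 t"
    and Q1_le: "\<And>t. t > t1 \<Longrightarrow> (Q1 t)\<^sup>2 \<le> AA * \<phi>2 t * (\<phi>1 t)\<^sup>2"
    and Q2_le: "\<And>t. t > t1 \<Longrightarrow> (Q2 t)\<^sup>2 \<le> AA * \<phi>2 t"
    and \<phi>_shift: "\<And>t. t > t1 \<Longrightarrow> \<phi> (t + 2) \<le> B * \<phi> t"
    and \<phi>1_exp: "\<And>t. t > t1 \<Longrightarrow> \<phi>1 t \<le> B * exp (\<phi> t)"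
    and \<phi>2_exp: "\<And>t. t > t1 \<Longrightarrow> \<phi>2 t \<le> B * exp (\<phi> t)"
    and \<phi>_top: "filterlim \<phi> at_top at_top"
    and \<kappa>: "\<kappa> \<ge> 0" "\<And>t. t > t1 \<Longrightarrow> t \<le> \<kappa> * \<phi> t"
    and decay: "\<forall>\<^sub>F \<tau> in at_top. radial_bigo (points N) u (\<lambda>r. exp (- \<tau> * \<phi> (ln r)))"
    and t: "t > t1" and x: "x \<in> points N"
  shows "u (exp t, x) = 0"
proof -
  \<comment> \<open>\<open>DIM('e)\<close> is n - 1, so \<open>a\<close> is n - 2, and it is
    nonnegative because N has dimension at least 1.\<close>
  define a where "a = real DIM('e) - 1"
  have a: "a \<ge> 0" using DIM_positive[where 'a='e] by (simp add: a_def Suc_leI)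
  have rt: "exp t > r0" if "t > t1" for t using that t1 by (meson exp_less_mono le_less_trans)
  define m where "m t = exp (a * t) * IM (exp t)" for t
  \<comment> \<open>The derivative in t of w = exp (a t / 2) u is exp (a t / 2) (r u1 + (a / 2) u0).
    Hence the shape of \<open>P\<close>, \<open>k\<close> and \<open>h\<close>.\<close>
  define P where "P t = exp (a * t) * (exp t * IP (exp t) + a / 2 * IM (exp t))" for t
  define k where "k t = exp (a * t) * ((exp t)\<^sup>2 * IK (exp t) + a * exp t * IP (exp t) + a\<^sup>2 / 4 * IM (exp t))" for t
  define g where "g t = exp (a * t) * IG (exp t)" for t
  define s where "s t = exp (a * t) * H0 (exp t)" for t
  define h where "h t = exp (a * t) * (exp t * H1 (exp t) + a / 2 * H0 (exp t))" for t
  define f2 where "f2 t = exp (a * t) * H2 (exp t)" for t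
  define c where "c = a\<^sup>2 / 4"
  have dexp: "(exp has_real_derivative exp t) (at t)" for t :: real by (rule DERIV_exp)
  interpret ode: carleman_ode m P k g h s f2 \<phi> \<phi>1 \<phi>2 \<phi>3 Q1 Q2 c t1 AA B
  proof
    fix t :: real assume t: "t > t1"
    note r = rt[OF t]
    let ?r = "exp t"
    note dM = DERIV_chain2[OF IM_deriv[OF r] dexp]
    note dP = DERIV_chain2[OF IP_deriv[OF r] dexp]
    note dKG = DERIV_chain2[OF IK_IG_deriv[OF r] dexp]
    have dim: "real DIM('e) = a + 1" by (simp add: a_def)
    show "(m has_real_derivative 2 * P t) (at t)"
      unfolding m_def[abs_def] P_def
      by (rule derivative_eq_intros dM refl)+ (simp add: algebra_simps)
    show "((\<lambda>t. k t - g t) has_real_derivative 2 * h t + 2 * c * P t) (at t)"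
    proof -
      have eq: "(\<lambda>t. k t - g t) = (\<lambda>t. exp (a * t) * (((exp t)\<^sup>2 * IK (exp t) - IG (exp t)) + a * (exp t * IP (exp t)) + a\<^sup>2 / 4 * IM (exp t)))"
        by (auto simp: k_def g_def algebra_simps)
      show ?thesis
        unfolding eq h_def P_def c_def
        by (rule derivative_eq_intros dM dP dKG refl)+
          (simp add: dim field_simps power2_eq_square power3_eq_cube)
    qed
    show "(P has_real_derivative k t + g t + s t + c * m t) (at t)"
      unfolding P_def[abs_def] k_def g_def s_def m_def c_def
      by (rule derivative_eq_intros dM dP refl)+
        (simp add: dim field_simps power2_eq_square)
    show "0 \<le> \<alpha>\<^sup>2 * f2 t + \<beta>\<^sup>2 * k t + \<delta>\<^sup>2 * m t + 2 * \<alpha> * \<beta> * h t + 2 * \<alpha> * \<delta> * s t + 2 * \<beta> * \<delta> * P t"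
      for \<alpha> \<beta> \<delta>
    proof -
      \<comment> \<open>In terms of u, the combination \<alpha> F + \<beta> w' + \<delta> w is exp
        (a t / 2) times \<alpha> e0 + \<beta> r u1 + (\<beta> a / 2 + \<delta>) u0.\<close>
      have "0 \<le> exp (a * t) * (\<alpha>\<^sup>2 * H2 ?r + (\<beta> * ?r)\<^sup>2 * IK ?r + (\<beta> * a / 2 + \<delta>)\<^sup>2 * IM ?r + 2 * \<alpha> * (\<beta> * ?r) * H1 ?r
        + 2 * \<alpha> * (\<beta> * a / 2 + \<delta>) * H0 ?r + 2 * (\<beta> * ?r) * (\<beta> * a / 2 + \<delta>) * IP ?r)"
        by (intro mult_nonneg_nonneg quadratic_form_nonneg[OF r]) simp
      also have "\<dots> = \<alpha>\<^sup>2 * f2 t + \<beta>\<^sup>2 * k t + \<delta>\<^sup>2 * m t + 2 * \<alpha> * \<beta> * h t + 2 * \<alpha> * \<delta> * s t + 2 * \<beta> * \<delta> * P t"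
        by (simp add: f2_def k_def m_def h_def s_def P_def field_simps power2_eq_square)
      finally show ?thesis .
    qed
    show "0 \<le> g t" using IG_nonneg[OF r] by (simp add: g_def)
    show "f2 t \<le> 2 * (Q1 t)\<^sup>2 * m t + 2 * (Q2 t)\<^sup>2 * (2 * k t + 2 * c * m t + g t)"
    \<comment> \<open>The functions \<open>Q1\<close> and \<open>Q2\<close> are tied to
      \<open>q1\<close> and \<open>q2\<close> through points of N. If there are none, every integral
      is zero.\<close>
    proof (cases "points N = {}")
      case True
      have "I f = 0" for f using I_cong[of f "\<lambda>_. 0"] I_zero True by simp
      then show ?thesis
        by (simp add: f2_def m_def k_def g_def H2_def IM_def IK_def IP_def IG_def)
    next
      case False
      then obtain p where p: "p \<in> points N" by blast
      have b: "?r\<^sup>2 * q1 (?r, p) = Q1 t" "?r * q2 (?r, p) = Q2 t" using q1[OF t p] q2[OF t p] by auto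
      have "H2 ?r \<le> 2 * (?r\<^sup>2 * q1 (?r, p))\<^sup>2 * IM ?r + 2 * (?r * q2 (?r, p))\<^sup>2 * (?r\<^sup>2 * IK ?r + IG ?r)"
      proof (rule H2_le[OF r])
        fix y assume y: "y \<in> points N"
        have "?r\<^sup>2 * q1 (?r, y) = ?r\<^sup>2 * q1 (?r, p)" "?r * q2 (?r, y) = ?r * q2 (?r, p)"
          by (simp_all only: q1[OF t y] q1[OF t p] q2[OF t y] q2[OF t p])
        then have "q1 (?r, y) = q1 (?r, p)" "q2 (?r, y) = q2 (?r, p)"
          by simp_all
        then show "\<bar>laplacian E u (?r, y)\<bar> \<le> q1 (?r, p) * \<bar>u (?r, y)\<bar> + q2 (?r, p) * grad_norm E u (?r, y)"
          using ineq[of "(?r, y)"] y r by (simp add: points_E)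
      qed
      then have "f2 t \<le> exp (a * t) * (2 * (Q1 t)\<^sup>2 * IM ?r + 2 * (Q2 t)\<^sup>2 * (?r\<^sup>2 * IK ?r + IG ?r))"
        unfolding b f2_def by (intro mult_left_mono) auto
      also have "\<dots> = 2 * (Q1 t)\<^sup>2 * m t + 2 * (Q2 t)\<^sup>2 * (exp (a * t) * (?r\<^sup>2 * IK ?r) + g t)"
        by (simp add: m_def g_def algebra_simps)
      also have "\<dots> \<le> 2 * (Q1 t)\<^sup>2 * m t + 2 * (Q2 t)\<^sup>2 * (2 * k t + 2 * c * m t + g t)"
      proof (intro add_left_mono mult_left_mono add_right_mono)
        \<comment> \<open>This is \<integral> (w' + (a / 2) w)^2 \<ge> 0. It bounds the square of r
          u1 exp (a t / 2) = w' - (a / 2) w by 2 w'^2 + 2 c w^2, whence the term 2 k + 2 c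
          m.\<close>
        have "0 \<le> exp (a * t) * (?r\<^sup>2 * IK ?r + a\<^sup>2 * IM ?r + 2 * ?r * a * IP ?r)"
          using quadratic_form_nonneg[OF r, of 0 ?r a] by simp
        also have "\<dots> = 2 * k t + 2 * c * m t - exp (a * t) * (?r\<^sup>2 * IK ?r)"
          by (simp add: k_def m_def c_def field_simps power2_eq_square)
        finally show "exp (a * t) * (?r\<^sup>2 * IK ?r) \<le> 2 * k t + 2 * c * m t" by simp
      qed auto
      finally show ?thesis .
    qed
  next
    fix \<sigma> :: real assume \<sigma>: "\<sigma> > 0"
    obtain \<tau>1 where \<tau>1: "\<And>\<tau>. \<tau> \<ge> \<tau>1 \<Longrightarrow> radial_bigo (points N) u (\<lambda>r. exp (- \<tau> * \<phi> (ln r)))"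
      using decay by (auto simp: eventually_at_top_linorder)
    \<comment> \<open>The square of the bound on u decays at rate 2 \<tau>; the part a \<kappa>
      compensates the factor exp (a t) in \<open>m\<close>, as t \<le> \<kappa> \<phi>(t), and
      \<sigma> is left.\<close>
    obtain \<tau> where \<tau>: "\<tau> \<ge> \<tau>1" "2 * \<tau> \<ge> \<sigma> + a * \<kappa>"
    proof (rule that)
      show "\<tau>1 \<le> max \<tau>1 ((\<sigma> + a * \<kappa>) / 2)" by simp
      have "x \<le> 2 * max y (x / 2)" for x y :: real by (simp add: max_def)
      then show "\<sigma> + a * \<kappa> \<le> 2 * max \<tau>1 ((\<sigma> + a * \<kappa>) / 2)" .
    qed
    obtain C where C: "\<forall>\<^sub>F r in at_top. \<forall>x\<in>points N. \<bar>u (r, x)\<bar> \<le> C * exp (- \<tau> * \<phi> (ln r))"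
      using radial_bigoD[OF \<tau>1[OF \<tau>(1)]] by auto
    have "\<forall>\<^sub>F t in at_top. \<forall>x\<in>points N. \<bar>u (exp t, x)\<bar> \<le> C * exp (- \<tau> * \<phi> (ln (exp t)))"
      by (rule eventually_compose_filterlim[OF C exp_at_top])
    then have "\<forall>\<^sub>F t in at_top. m t \<le> C\<^sup>2 * I (\<lambda>_. 1) * exp (- \<sigma> * \<phi> t)"
      using eventually_gt_at_top[of t1]
    proof eventually_elim
      case (elim t)
      have I1: "I (\<lambda>_. 1) \<ge> 0" by (rule I_nonneg) auto
      have "IM (exp t) \<le> (C * exp (- \<tau> * \<phi> t))\<^sup>2 * I (\<lambda>_. 1)"
        by (rule IM_le[OF rt[OF elim(2)]]) (use elim(1) in auto)
      then have "m t \<le> exp (a * t) * ((C * exp (- \<tau> * \<phi> t))\<^sup>2 * I (\<lambda>_. 1))"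
        unfolding m_def by (intro mult_left_mono) auto
      also have "\<dots> = C\<^sup>2 * I (\<lambda>_. 1) * exp (a * t - 2 * \<tau> * \<phi> t)"
        by (simp add: power_mult_distrib exp_diff exp_minus power2_eq_square exp_double[symmetric] field_simps)
          (simp add: exp_add[symmetric])
      also have "\<dots> \<le> C\<^sup>2 * I (\<lambda>_. 1) * exp (- \<sigma> * \<phi> t)"
      proof (intro mult_left_mono)
        have "a * t \<le> a * (\<kappa> * \<phi> t)" using \<kappa>(2)[OF elim(2)] a by (rule mult_left_mono)
        moreover have "(\<sigma> + a * \<kappa>) * \<phi> t \<le> (2 * \<tau>) * \<phi> t"
          using \<tau>(2) \<phi>_nonneg[OF elim(2)] by (rule mult_right_mono)
        ultimately have "a * t - 2 * \<tau> * \<phi> t \<le> - \<sigma> * \<phi> t" by (simp add: algebra_simps)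
        then show "exp (a * t - 2 * \<tau> * \<phi> t) \<le> exp (- \<sigma> * \<phi> t)" by simp
      qed (use I1 in auto)
      finally show ?case .
    qed
    then show "\<exists>C. \<forall>\<^sub>F t in at_top. m t \<le> C * exp (- \<sigma> * \<phi> t)" by blast
  qed (use assms in \<open>auto simp: c_def\<close>)
  have "m t = 0" by (rule ode.m_eq_0[OF t])
  then have "IM (exp t) = 0" by (simp add: m_def)
  then show ?thesis by (rule IM_eq_0_imp[OF rt[OF t] _ x])
qed

end

section \<open>The power weights and the logarithmic weights\<close>

context cone_fun
begin

text \<open>For \<phi> = X = exp (\<beta> t), which is r^\<beta>, every derivative is a multiple of
  X. Then Q1^2 = C1^2 X^3 against \<phi>'' \<phi>'^2 = \<beta>^4 X^3, and Q2^2 = C2^2 X against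
  \<phi>'' = \<beta>^2 X, so the required bounds hold with constant ratios.\<close>

lemma vanishing_exp_weight:
  fixes q1 q2 :: "real \<times> 'a \<Rightarrow> real" and \<beta> C1 C2 :: real
  assumes ineq: "\<And>z. z \<in> points E \<Longrightarrow> \<bar>laplacian E u z\<bar> \<le> q1 z * \<bar>u z\<bar> + q2 z * grad_norm E u z"
    and \<beta>: "\<beta> > 0"
    and q1: "\<And>r x. (r, x) \<in> points E \<Longrightarrow> q1 (r, x) = C1 * r powr (- (2 - 3 / 2 * \<beta>))"
    and q2: "\<And>r x. (r, x) \<in> points E \<Longrightarrow> q2 (r, x) = C2 * r powr (- (1 - 1 / 2 * \<beta>))"
    and decay: "\<forall>\<^sub>F \<tau> in at_top. radial_bigo (points N) u (\<lambda>r. exp (- \<tau> * r powr \<beta>))"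
    and z: "z \<in> points E"
  shows "u z = 0"
proof -
  obtain r x where rx: "z = (r, x)" "r > r0" "x \<in> points N" using z by (auto simp: points_E)
  \<comment> \<open>Starting halfway between \<open>r0\<close> and the given radius keeps X away
    from 0 on the half-line, also when \<open>r0\<close> is 0, while the given point still lies
    beyond \<open>t1\<close>.\<close>
  define t1 where "t1 = ln ((r + r0) / 2)"
  have mid: "(r + r0) / 2 > 0" "(r + r0) / 2 < r" "(r + r0) / 2 \<ge> r0" using rx r0 by auto
  have et1: "exp t1 = (r + r0) / 2" using mid by (simp add: t1_def)
  have pts: "(exp t, p) \<in> points E" if "t > t1" "p \<in> points N" for t p
  proof -
    have "exp t1 < exp t" using that by simp
    then show ?thesis using that mid by (simp add: points_E et1)
  qed
  define e where "e = exp (\<beta> * t1)"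
  have e: "e > 0" by (simp add: e_def)
  define X where "X t = exp (\<beta> * t)" for t
  have X: "X t > 0" "t > t1 \<Longrightarrow> e \<le> X t" for t
    using \<beta> by (auto simp: X_def e_def)
  \<comment> \<open>One summand per condition: the first bounds \<phi>'' and \<phi>''' by means of 1
    \<le> AA X, the second bounds \<phi>' from below, the last two control Q1 and Q2.\<close>
  define AA where "AA = 1 / e + 1 / (\<beta> * e) + C1\<^sup>2 / \<beta> ^ 4 + C2\<^sup>2 / \<beta>\<^sup>2"
  have AA: "AA > 0" "1 / e \<le> AA" "1 / (\<beta> * e) \<le> AA" "C1\<^sup>2 / \<beta> ^ 4 \<le> AA" "C2\<^sup>2 / \<beta>\<^sup>2 \<le> AA"
  proof -
    have "1 / e > 0" "1 / (\<beta> * e) > 0" "C1\<^sup>2 / \<beta> ^ 4 \<ge> 0" "C2\<^sup>2 / \<beta>\<^sup>2 \<ge> 0" using e \<beta> by simp_all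
    then show "AA > 0" "1 / e \<le> AA" "1 / (\<beta> * e) \<le> AA" "C1\<^sup>2 / \<beta> ^ 4 \<le> AA" "C2\<^sup>2 / \<beta>\<^sup>2 \<le> AA"
      unfolding AA_def by linarith+
  qed
  have AX: "1 \<le> AA * X t" if "t > t1" for t
  proof -
    have "1 = 1 / e * e" using e by simp
    also have "\<dots> \<le> AA * X t" using AA X(2)[OF that] e by (intro mult_mono) auto
    finally show ?thesis .
  qed
  \<comment> \<open>exp (2 \<beta>) is the ratio of X (t + 2) to X t; \<beta> and \<beta>^2 are the
    factors in \<phi>' and \<phi>'', and X is at most exp X.\<close>
  define B where "B = 1 + exp (2 * \<beta>) + \<beta> + \<beta>\<^sup>2"
  have "u (exp (ln r), x) = 0"
  proof (rule vanishing_criterion[where ?t1.0 = t1 and \<phi> = X and ?\<phi>1.0 = "\<lambda>t. \<beta> * X t" and ?\<phi>2.0 = "\<lambda>t. \<beta>\<^sup>2 * X t"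
        and ?\<phi>3.0 = "\<lambda>t. \<beta> ^ 3 * X t" and ?Q1.0 = "\<lambda>t. C1 * exp (3 / 2 * \<beta> * t)" and ?Q2.0 = "\<lambda>t. C2 * exp (\<beta> / 2 * t)"
        and AA = AA and B = B and \<kappa> = "1 / \<beta>", OF _ ineq])
    show "r0 \<le> exp t1" using mid by (simp add: et1)
    show "t1 < ln r" using mid by (simp add: t1_def)
    show "AA > 0" "B \<ge> 1" "1 / \<beta> \<ge> 0" "x \<in> points N" using AA \<beta> rx by (auto simp: B_def)
    show "filterlim X at_top at_top"
      unfolding X_def
      by (rule filterlim_compose[OF exp_at_top filterlim_tendsto_pos_mult_at_top[OF tendsto_const \<beta> filterlim_ident]])
    show "\<forall>\<^sub>F \<tau> in at_top. radial_bigo (points N) u (\<lambda>r. exp (- \<tau> * X (ln r)))"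
      using decay
    proof eventually_elim
      case (elim \<tau>)
      have "\<forall>\<^sub>F r in at_top. (SUP x\<in>points N. ereal \<bar>u (r, x) / exp (- \<tau> * r powr \<beta>)\<bar>) = (SUP x\<in>points N. ereal \<bar>u (r, x) / exp (- \<tau> * X (ln r))\<bar>)"
        using eventually_gt_at_top[of 0] by eventually_elim (simp add: X_def powr_def)
      from Limsup_eq[OF this] elim show ?case by (simp add: radial_bigo_def)
    qed
  next
    fix t assume t: "t > t1"
    note Xt = X(1)[of t]
    show "(exp t)\<^sup>2 * q1 (exp t, p) = C1 * exp (3 / 2 * \<beta> * t)" if "p \<in> points N" for p
      using q1[OF pts[OF t that]] by (simp add: powr_def exp_add[symmetric] exp_double[symmetric] algebra_simps)
    show "exp t * q2 (exp t, p) = C2 * exp (\<beta> / 2 * t)" if "p \<in> points N" for p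
      using q2[OF pts[OF t that]] by (simp add: powr_def exp_add[symmetric] algebra_simps)
    have dX: "(X has_real_derivative \<beta> * X t) (at t)"
      unfolding X_def[abs_def] by (auto intro!: derivative_eq_intros)
    show "(X has_real_derivative \<beta> * X t) (at t)" by (rule dX)
    show "((\<lambda>t. \<beta> * X t) has_real_derivative \<beta>\<^sup>2 * X t) (at t)"
      using DERIV_cmult[OF dX, of \<beta>] by (simp add: power2_eq_square mult.assoc)
    show "((\<lambda>t. \<beta>\<^sup>2 * X t) has_real_derivative \<beta> ^ 3 * X t) (at t)"
      using DERIV_cmult[OF dX, of "\<beta>\<^sup>2"] by (simp add: power2_eq_square power3_eq_cube mult.assoc)
    show "X t \<ge> 0" "\<beta> * X t > 0" "\<beta>\<^sup>2 * X t > 0" using Xt \<beta> by auto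
    have bX: "\<beta>\<^sup>2 * X t * 1 \<le> \<beta>\<^sup>2 * X t * (AA * X t)"
      using AX[OF t] Xt by (intro mult_left_mono) auto
    then show "\<beta>\<^sup>2 * X t \<le> AA * (\<beta> * X t)\<^sup>2"
      by (simp add: power2_eq_square mult_ac)
    have "\<beta> * (\<beta>\<^sup>2 * X t * 1) \<le> \<beta> * (\<beta>\<^sup>2 * X t * (AA * X t))"
      by (rule mult_left_mono[OF bX]) (use \<beta> in simp)
    then show "\<bar>\<beta> ^ 3 * X t\<bar> \<le> AA * (\<beta>\<^sup>2 * X t) * (\<beta> * X t)"
      using Xt \<beta> by (simp add: power2_eq_square power3_eq_cube mult_ac abs_mult)
    show "1 \<le> AA * (\<beta> * X t)"
    proof -
      have "1 = 1 / (\<beta> * e) * (\<beta> * e)" using e \<beta> by simp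
      also have "\<dots> \<le> AA * (\<beta> * X t)" using AA X(2)[OF t] e \<beta> by (intro mult_mono) auto
      finally show ?thesis .
    qed
    show "(C1 * exp (3 / 2 * \<beta> * t))\<^sup>2 \<le> AA * (\<beta>\<^sup>2 * X t) * (\<beta> * X t)\<^sup>2"
    proof -
      have "(C1 * exp (3 / 2 * \<beta> * t))\<^sup>2 = C1\<^sup>2 * exp (2 * (3 / 2 * \<beta> * t))"
        by (simp only: power_mult_distrib exp_double)
      also have "2 * (3 / 2 * \<beta> * t) = real 3 * (\<beta> * t)" by simp
      also have "exp (real 3 * (\<beta> * t)) = X t ^ 3" unfolding X_def by (rule exp_of_nat_mult)
      also have "C1\<^sup>2 * X t ^ 3 = (C1\<^sup>2 / \<beta> ^ 4) * (\<beta> ^ 4 * X t ^ 3)" using \<beta> by simp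
      also have "\<dots> \<le> AA * (\<beta> ^ 4 * X t ^ 3)" using AA Xt \<beta> by (intro mult_right_mono) auto
      also have "\<dots> = AA * (\<beta>\<^sup>2 * X t) * (\<beta> * X t)\<^sup>2"
        by (simp add: power_mult_distrib power3_eq_cube power4_eq_xxxx power2_eq_square mult_ac)
      finally show ?thesis .
    qed
    show "(C2 * exp (\<beta> / 2 * t))\<^sup>2 \<le> AA * (\<beta>\<^sup>2 * X t)"
    proof -
      have "(C2 * exp (\<beta> / 2 * t))\<^sup>2 = C2\<^sup>2 * exp (2 * (\<beta> / 2 * t))"
        by (simp only: power_mult_distrib exp_double)
      also have "2 * (\<beta> / 2 * t) = \<beta> * t" by simp
      also have "C2\<^sup>2 * exp (\<beta> * t) = (C2\<^sup>2 / \<beta>\<^sup>2) * (\<beta>\<^sup>2 * X t)" using \<beta> by (simp add: X_def)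
      also have "\<dots> \<le> AA * (\<beta>\<^sup>2 * X t)" using AA Xt \<beta> by (intro mult_right_mono) auto
      finally show ?thesis .
    qed
    have Bge: "exp (2 * \<beta>) \<le> B" "\<beta> \<le> B" "\<beta>\<^sup>2 \<le> B" using \<beta> by (auto simp: B_def add_nonneg_nonneg)
    have "X (t + 2) = exp (2 * \<beta>) * X t" by (simp add: X_def exp_add[symmetric] algebra_simps)
    then show "X (t + 2) \<le> B * X t" using Bge Xt by (simp add: mult_right_mono)
    have XE: "X t \<le> exp (X t)" using exp_ge_add_one_self[of "X t"] by linarith
    show "\<beta> * X t \<le> B * exp (X t)" using Bge XE Xt \<beta> by (intro mult_mono) auto
    show "\<beta>\<^sup>2 * X t \<le> B * exp (X t)" using Bge XE Xt \<beta> by (intro mult_mono) (auto simp: B_def)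
    show "t \<le> 1 / \<beta> * X t"
    proof -
      have "\<beta> * t \<le> X t" using exp_ge_add_one_self[of "\<beta> * t"] unfolding X_def by linarith
      then show ?thesis using \<beta> by (simp add: field_simps)
    qed
  qed
  moreover have "exp (ln r) = r" using rx r0 by simp
  ultimately show ?thesis by (simp add: rx)
qed

text \<open>For \<phi> = t^\<gamma> one has \<phi>'' \<phi>'^2 = \<gamma>^3 (\<gamma> - 1) t^(3
  \<gamma> - 4) and \<phi>'' = \<gamma> (\<gamma> - 1) t^(\<gamma> - 2), the powers of t in Q1^2 and
  Q2^2. Convexity of the weight is where \<gamma> > 1 enters, and \<open>r0 \<ge> 1\<close> keeps t
  positive.\<close>

lemma vanishing_log_weight:
  fixes q1 q2 :: "real \<times> 'a \<Rightarrow> real" and \<gamma> C1 C2 :: real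
  assumes ineq: "\<And>z. z \<in> points E \<Longrightarrow> \<bar>laplacian E u z\<bar> \<le> q1 z * \<bar>u z\<bar> + q2 z * grad_norm E u z"
    and \<gamma>: "\<gamma> > 1" and r01: "r0 \<ge> 1"
    and q1: "\<And>r x. (r, x) \<in> points E \<Longrightarrow> q1 (r, x) = C1 * r powr (- 2) * (ln r) powr (- (2 - 3 / 2 * \<gamma>))"
    and q2: "\<And>r x. (r, x) \<in> points E \<Longrightarrow> q2 (r, x) = C2 * r powr (- 1) * (ln r) powr (- (1 - 1 / 2 * \<gamma>))"
    and decay: "\<forall>\<^sub>F \<tau> in at_top. radial_bigo (points N) u (\<lambda>r. exp (- \<tau> * (ln r) powr \<gamma>))"
    and z: "z \<in> points E"
  shows "u z = 0"
proof -
  obtain r x where rx: "z = (r, x)" "r > r0" "x \<in> points N" using z by (auto simp: points_E)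
  define t1 where "t1 = ln ((r + r0) / 2)"
  have mid: "(r + r0) / 2 > 1" "(r + r0) / 2 < r" "(r + r0) / 2 \<ge> r0" using rx r01 by auto
  have et1: "exp t1 = (r + r0) / 2" using mid by (simp add: t1_def)
  have t1: "t1 > 0" unfolding t1_def using mid(1) by (rule ln_gt_zero)
  have pts: "(exp t, p) \<in> points E" if "t > t1" "p \<in> points N" for t p
  proof -
    have "exp t1 < exp t" using that by simp
    then show ?thesis using that mid by (simp add: points_E et1)
  qed
  define X where "X t = t powr \<gamma>" for t :: real
  \<comment> \<open>X t / t = t^(\<gamma> - 1) is nondecreasing, so its value at \<open>t1\<close>
    is a lower bound. It bounds \<phi>' from below and also yields t \<le> X t / D.\<close>
  define D where "D = X t1 / t1"
  have D: "D > 0" using t1 by (simp add: D_def X_def)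
  have X: "X t > 0" "t > 0" "D \<le> X t / t" "X t1 \<le> X t" if "t > t1" for t
  proof -
    show t: "t > 0" using that t1 by simp
    then show "X t > 0" by (simp add: X_def)
    show "X t1 \<le> X t" unfolding X_def using that t1 \<gamma> by (intro powr_mono2) auto
    have "X s / s = s powr (\<gamma> - 1)" if "s > 0" for s using that by (simp add: X_def powr_diff)
    moreover have "t1 powr (\<gamma> - 1) \<le> t powr (\<gamma> - 1)" using that t1 \<gamma> by (intro powr_mono2) auto
    ultimately show "D \<le> X t / t" using t t1 by (simp add: D_def)
  qed
  have X1: "X t1 > 0" using t1 by (simp add: X_def)
  \<comment> \<open>The first summand makes \<open>AA * X t\<close> at least 1 + |\<gamma> - 2|,
    which serves \<phi>'' and the factor \<gamma> - 2 of \<phi>'''; the others serve the lower bound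
    on \<phi>', then Q1 and Q2.\<close>
  define AA where "AA = (1 + \<bar>\<gamma> - 2\<bar>) / X t1 + 1 / D + C1\<^sup>2 / (\<gamma> ^ 3 * (\<gamma> - 1)) + C2\<^sup>2 / (\<gamma> * (\<gamma> - 1))"
  have AA: "AA > 0" "(1 + \<bar>\<gamma> - 2\<bar>) / X t1 \<le> AA" "1 / D \<le> AA" "C1\<^sup>2 / (\<gamma> ^ 3 * (\<gamma> - 1)) \<le> AA" "C2\<^sup>2 / (\<gamma> * (\<gamma> - 1)) \<le> AA"
  proof -
    have "(1 + \<bar>\<gamma> - 2\<bar>) / X t1 > 0" "1 / D > 0" "C1\<^sup>2 / (\<gamma> ^ 3 * (\<gamma> - 1)) \<ge> 0" "C2\<^sup>2 / (\<gamma> * (\<gamma> - 1)) \<ge> 0"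
      using X1 D \<gamma> by (simp_all add: add_pos_nonneg)
    then show "AA > 0" "(1 + \<bar>\<gamma> - 2\<bar>) / X t1 \<le> AA" "1 / D \<le> AA" "C1\<^sup>2 / (\<gamma> ^ 3 * (\<gamma> - 1)) \<le> AA" "C2\<^sup>2 / (\<gamma> * (\<gamma> - 1)) \<le> AA"
      unfolding AA_def by linarith+
  qed
  have AX: "1 + \<bar>\<gamma> - 2\<bar> \<le> AA * X t" if "t > t1" for t
  proof -
    have "1 + \<bar>\<gamma> - 2\<bar> = (1 + \<bar>\<gamma> - 2\<bar>) / X t1 * X t1" using X1 by simp
    also have "\<dots> \<le> AA * X t" using AA(1,2) X(4)[OF that] X1 by (intro mult_mono) auto
    finally show ?thesis .
  qed
  define c1 c2 where "c1 = \<gamma> / t1" and "c2 = \<gamma> * (\<gamma> - 1) / t1\<^sup>2"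
  have c12: "c1 \<ge> 0" "c2 \<ge> 0" using \<gamma> t1 by (auto simp: c1_def c2_def)
  \<comment> \<open>The ratio (t + 2) / t is largest at \<open>t1\<close>; \<open>c1\<close> and
    \<open>c2\<close> bound \<gamma> / t and \<gamma> (\<gamma> - 1) / t^2, the quotients of \<phi>'
    and \<phi>'' by X.\<close>
  define B where "B = 1 + ((t1 + 2) / t1) powr \<gamma> + c1 + c2"
  have Bge: "1 \<le> B" "((t1 + 2) / t1) powr \<gamma> \<le> B" "c1 \<le> B" "c2 \<le> B" using c12 by (auto simp: B_def)
  have dpow: "((\<lambda>t. t powr s) has_real_derivative s * (t powr s / t)) (at t)" if "t > 0" for s t :: real
    using has_real_derivative_powr[OF that, of s] that by (simp add: powr_diff)
  have sq: "(t powr s)\<^sup>2 = t powr (2 * s)" for t s :: real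
    by (simp add: power2_eq_square powr_add[symmetric])
  have Xpow: "X t / t = t powr (\<gamma> - 1)" "X t / t\<^sup>2 = t powr (\<gamma> - 2)" "X t / t ^ 3 = t powr (\<gamma> - 3)"
    if "t > 0" for t
    using that by (simp_all add: X_def powr_diff)
  have "u (exp (ln r), x) = 0"
  proof (rule vanishing_criterion[where ?t1.0 = t1 and \<phi> = X and ?\<phi>1.0 = "\<lambda>t. \<gamma> * t powr (\<gamma> - 1)"
        and ?\<phi>2.0 = "\<lambda>t. \<gamma> * (\<gamma> - 1) * t powr (\<gamma> - 2)" and ?\<phi>3.0 = "\<lambda>t. \<gamma> * (\<gamma> - 1) * (\<gamma> - 2) * t powr (\<gamma> - 3)"
        and ?Q1.0 = "\<lambda>t. C1 * t powr (- (2 - 3 / 2 * \<gamma>))" and ?Q2.0 = "\<lambda>t. C2 * t powr (- (1 - 1 / 2 * \<gamma>))"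
        and AA = AA and B = B and \<kappa> = "1 / D", OF _ ineq])
    show "r0 \<le> exp t1" using mid by (simp add: et1)
    show "t1 < ln r" using mid by (simp add: t1_def)
    show "AA > 0" "B \<ge> 1" "1 / D \<ge> 0" "x \<in> points N" using AA D rx Bge by auto
    show "filterlim X at_top at_top"
    proof (rule filterlim_at_top_mono[OF filterlim_ident])
      show "\<forall>\<^sub>F t in at_top. t \<le> X t"
        using eventually_ge_at_top[of 1]
      proof eventually_elim
        case (elim t)
        then show ?case using powr_mono[of 1 \<gamma> t] \<gamma> by (simp add: X_def)
      qed
    qed
    show "\<forall>\<^sub>F \<tau> in at_top. radial_bigo (points N) u (\<lambda>r. exp (- \<tau> * X (ln r)))"
      using decay by (simp add: X_def)
  next
    fix t assume t: "t > t1"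
    note Xt = X[OF t]
    note Xp = Xpow[OF Xt(2)]
    show "(exp t)\<^sup>2 * q1 (exp t, p) = C1 * t powr (- (2 - 3 / 2 * \<gamma>))" if "p \<in> points N" for p
    proof -
      have "(exp t)\<^sup>2 * (C1 * exp t powr (- 2) * w) = C1 * w" for w
        by (simp add: powr_def exp_minus exp_double)
      then show ?thesis unfolding q1[OF pts[OF t that]] by simp
    qed
    show "exp t * q2 (exp t, p) = C2 * t powr (- (1 - 1 / 2 * \<gamma>))" if "p \<in> points N" for p
    proof -
      have "exp t * (C2 * exp t powr (- 1) * w) = C2 * w" for w
        by (simp add: powr_def exp_minus)
      then show ?thesis unfolding q2[OF pts[OF t that]] by simp
    qed
    show "(X has_real_derivative \<gamma> * t powr (\<gamma> - 1)) (at t)"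
      using dpow[OF Xt(2), of \<gamma>] Xt(2) by (simp add: X_def[abs_def] powr_diff)
    show "((\<lambda>t. \<gamma> * t powr (\<gamma> - 1)) has_real_derivative \<gamma> * (\<gamma> - 1) * t powr (\<gamma> - 2)) (at t)"
      using DERIV_cmult[OF dpow[OF Xt(2), of "\<gamma> - 1"], of \<gamma>] Xt(2)
      by (simp add: powr_diff power2_eq_square mult.assoc)
    show "((\<lambda>t. \<gamma> * (\<gamma> - 1) * t powr (\<gamma> - 2)) has_real_derivative \<gamma> * (\<gamma> - 1) * (\<gamma> - 2) * t powr (\<gamma> - 3)) (at t)"
      using DERIV_cmult[OF dpow[OF Xt(2), of "\<gamma> - 2"], of "\<gamma> * (\<gamma> - 1)"] Xt(2)
      by (simp add: powr_diff power2_eq_square power3_eq_cube mult.assoc)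
    show "X t \<ge> 0" "\<gamma> * t powr (\<gamma> - 1) > 0" "\<gamma> * (\<gamma> - 1) * t powr (\<gamma> - 2) > 0" using Xt \<gamma> by auto
    let ?f1 = "\<gamma> * t powr (\<gamma> - 1)" and ?f2 = "\<gamma> * (\<gamma> - 1) * t powr (\<gamma> - 2)"
    have f2: "?f2 = \<gamma> * (\<gamma> - 1) * X t / t\<^sup>2" and f1: "?f1 = \<gamma> * X t / t" by (simp_all add: Xp[symmetric])
    show "?f2 \<le> AA * ?f1\<^sup>2"
    proof -
      have "(\<gamma> - 1) * 1 \<le> \<gamma> * (AA * X t)" using AX[OF t] \<gamma> by (intro mult_mono) auto
      then have "(\<gamma> * X t / t\<^sup>2) * ((\<gamma> - 1) * 1) \<le> (\<gamma> * X t / t\<^sup>2) * (\<gamma> * (AA * X t))"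
        using Xt \<gamma> by (intro mult_left_mono) auto
      then show ?thesis unfolding f1 f2 by (simp add: power2_eq_square mult_ac)
    qed
    show "\<bar>\<gamma> * (\<gamma> - 1) * (\<gamma> - 2) * t powr (\<gamma> - 3)\<bar> \<le> AA * ?f2 * ?f1"
    proof -
      have "\<bar>\<gamma> - 2\<bar> * 1 \<le> (AA * X t) * \<gamma>" using AX[OF t] \<gamma> by (intro mult_mono) auto
      then have "(\<gamma> * (\<gamma> - 1) * X t / t ^ 3) * (\<bar>\<gamma> - 2\<bar> * 1) \<le> (\<gamma> * (\<gamma> - 1) * X t / t ^ 3) * ((AA * X t) * \<gamma>)"
        using Xt \<gamma> by (intro mult_left_mono) auto
      moreover have "\<bar>\<gamma> * (\<gamma> - 1) * (\<gamma> - 2) * t powr (\<gamma> - 3)\<bar> = (\<gamma> * (\<gamma> - 1) * X t / t ^ 3) * (\<bar>\<gamma> - 2\<bar> * 1)"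
        using Xt \<gamma> unfolding Xp(3)[symmetric] by (simp add: abs_mult)
      moreover have "(\<gamma> * (\<gamma> - 1) * X t / t ^ 3) * ((AA * X t) * \<gamma>) = AA * ?f2 * ?f1"
        unfolding f1 f2 by (simp add: power2_eq_square power3_eq_cube)
      ultimately show ?thesis by linarith
    qed
    show "1 \<le> AA * ?f1"
    proof -
      have "1 = 1 / D * D * 1" using D by simp
      also have "\<dots> \<le> AA * (X t / t) * \<gamma>" using AA(1,3) Xt D \<gamma> by (intro mult_mono) auto
      also have "\<dots> = AA * ?f1" unfolding f1 by simp
      finally show ?thesis .
    qed
    show "(C1 * t powr (- (2 - 3 / 2 * \<gamma>)))\<^sup>2 \<le> AA * ?f2 * ?f1\<^sup>2"
    proof -
      have "(C1 * t powr (- (2 - 3 / 2 * \<gamma>)))\<^sup>2 = C1\<^sup>2 * t powr (3 * \<gamma> - 4)"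
        by (simp add: power_mult_distrib sq algebra_simps)
      also have "\<dots> = (C1\<^sup>2 / (\<gamma> ^ 3 * (\<gamma> - 1))) * (\<gamma> ^ 3 * (\<gamma> - 1) * t powr (3 * \<gamma> - 4))" using \<gamma> by simp
      also have "\<dots> \<le> AA * (\<gamma> ^ 3 * (\<gamma> - 1) * t powr (3 * \<gamma> - 4))" using AA(4) \<gamma> by (intro mult_right_mono) auto
      also have "t powr (3 * \<gamma> - 4) = t powr (\<gamma> - 2) * (t powr (\<gamma> - 1))\<^sup>2"
        by (simp add: sq powr_add[symmetric])
      also have "AA * (\<gamma> ^ 3 * (\<gamma> - 1) * (t powr (\<gamma> - 2) * (t powr (\<gamma> - 1))\<^sup>2)) = AA * ?f2 * ?f1\<^sup>2"
        by (simp add: power2_eq_square power3_eq_cube)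
      finally show ?thesis .
    qed
    show "(C2 * t powr (- (1 - 1 / 2 * \<gamma>)))\<^sup>2 \<le> AA * ?f2"
    proof -
      have "(C2 * t powr (- (1 - 1 / 2 * \<gamma>)))\<^sup>2 = C2\<^sup>2 * t powr (\<gamma> - 2)"
        by (simp add: power_mult_distrib sq algebra_simps)
      also have "\<dots> = (C2\<^sup>2 / (\<gamma> * (\<gamma> - 1))) * ?f2" using \<gamma> by simp
      also have "\<dots> \<le> AA * ?f2" using AA(5) \<gamma> by (intro mult_right_mono) auto
      finally show ?thesis .
    qed
    show "X (t + 2) \<le> B * X t"
    proof -
      have "(t + 2) / t \<le> (t1 + 2) / t1" using t t1 by (simp add: field_simps)
      then have "((t + 2) / t) powr \<gamma> \<le> ((t1 + 2) / t1) powr \<gamma>" using t t1 \<gamma> by (intro powr_mono2) auto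
      then have "((t + 2) / t) powr \<gamma> * X t \<le> B * X t" using Bge Xt by (intro mult_right_mono) auto
      moreover have "((t + 2) / t) powr \<gamma> * X t = X (t + 2)"
        using Xt(2) by (simp add: X_def powr_mult[symmetric])
      ultimately show ?thesis by simp
    qed
    have XE: "X t \<le> exp (X t)" using exp_ge_add_one_self[of "X t"] by linarith
    show "?f1 \<le> B * exp (X t)"
    proof -
      have "?f1 \<le> c1 * X t" unfolding f1 c1_def using t t1 \<gamma> Xt by (simp add: frac_le)
      also have "\<dots> \<le> B * exp (X t)" using Bge XE Xt c12 by (intro mult_mono) auto
      finally show ?thesis .
    qed
    show "?f2 \<le> B * exp (X t)"
    proof -
      have "t1\<^sup>2 \<le> t\<^sup>2" using t t1 by (intro power_mono) auto
      then have "?f2 \<le> c2 * X t" unfolding f2 c2_def using t t1 \<gamma> Xt by (simp add: frac_le)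
      also have "\<dots> \<le> B * exp (X t)" using Bge XE Xt c12 by (intro mult_mono) auto
      finally show ?thesis .
    qed
    show "t \<le> 1 / D * X t"
      using Xt(2,3) D by (simp add: field_simps)
  qed
  moreover have "exp (ln r) = r" using rx r0 by simp
  ultimately show ?thesis by (simp add: rx)
qed

end

theorem corollary9:
  fixes N :: "('i, 'a::{t2_space, second_countable_topology}, 'e::euclidean_space) riem"
    and r0 C1 C2 :: real
    and u q1 q2 :: "real \<times> 'a \<Rightarrow> real"
  defines "E \<equiv> conical_end N r0"
  assumes N: "riemannian_manifold N" "compact (points N)"
    and r0: "r0 \<ge> 0"
    and u: "Ck_function 2 E u"
    and q1: "continuous_on (points E) q1" "\<forall>p\<in>points E. 0 \<le> q1 p"
    and q2: "continuous_on (points E) q2" "\<forall>p\<in>points E. 0 \<le> q2 p"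
    and ineq: "\<forall>p\<in>points E. \<bar>laplacian E u p\<bar> \<le> q1 p * \<bar>u p\<bar> + q2 p * grad_norm E u p"
    and C: "C1 \<ge> 0" "C2 \<ge> 0"
  shows
    "(\<forall>\<beta>. 0 < \<beta> \<and> \<beta> \<le> 2
        \<and> (\<forall>(r, x)\<in>points E. q1 (r, x) = C1 * r powr (- (2 - 3 / 2 * \<beta>)))
        \<and> (\<forall>(r, x)\<in>points E. q2 (r, x) = C2 * r powr (- (1 - 1 / 2 * \<beta>)))
        \<and> (\<forall>\<^sub>F \<tau> in at_top. radial_bigo (points N) u (\<lambda>r. exp (- \<tau> * r powr \<beta>)))
        \<longrightarrow> (\<forall>p\<in>points E. u p = 0))
     \<and>
     (\<forall>\<gamma>. r0 \<ge> 1 \<and> \<gamma> > 1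
        \<and> (\<forall>(r, x)\<in>points E.
              q1 (r, x) = C1 * r powr (- 2) * (ln r) powr (- (2 - 3 / 2 * \<gamma>)))
        \<and> (\<forall>(r, x)\<in>points E.
              q2 (r, x) = C2 * r powr (- 1) * (ln r) powr (- (1 - 1 / 2 * \<gamma>)))
        \<and> (\<forall>\<^sub>F \<tau> in at_top. radial_bigo (points N) u (\<lambda>r. exp (- \<tau> * (ln r) powr \<gamma>)))
        \<longrightarrow> (\<forall>p\<in>points E. u p = 0))
     \<and>
     (\<forall>\<beta>. \<beta> > 2
        \<and> (\<forall>(r, x)\<in>points E. q1 (r, x) = C1 * r powr (- (2 - 3 / 2 * \<beta>)))
        \<and> (\<forall>(r, x)\<in>points E. q2 (r, x) = C2 * r powr (- (1 - 1 / 2 * \<beta>)))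
        \<and> (\<forall>\<^sub>F \<tau> in at_top. radial_bigo (points N) u (\<lambda>r. exp (- \<tau> * r powr \<beta>)))
        \<and> (\<forall>\<^sub>F \<tau> in at_top.
              ((\<lambda>r. weighted_energy N r0 u \<beta> \<tau> (2 * r) / ennreal (r\<^sup>2)) \<longlongrightarrow> 0) at_top)
        \<longrightarrow> (\<forall>p\<in>points E. u p = 0))"
proof -
  interpret compact_riem N by unfold_locales (rule N)+
  show ?thesis
  \<comment> \<open>The partition of unity is a parameter of \<open>cone_fun\<close>. It is fixed
    here by elimination, so that the locale can be interpreted with it.\<close>
  proof (rule partition_of_unity)
    fix A :: "'a set" and \<theta> K and \<iota> :: "'a \<Rightarrow> 'i"
    assume pou: "finite A" "\<And>a. a \<in> A \<Longrightarrow> \<iota> a \<in> idx N" "\<And>a. a \<in> A \<Longrightarrow> compact (K a)"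
      "\<And>a. a \<in> A \<Longrightarrow> K a \<subseteq> patch N (\<iota> a)" "\<And>a. a \<in> A \<Longrightarrow> C1_fun (\<theta> a)"
      "\<And>a p. a \<in> A \<Longrightarrow> p \<in> points N - K a \<Longrightarrow> \<theta> a p = 0"
      "\<And>a p. a \<in> A \<Longrightarrow> p \<in> points N \<Longrightarrow> \<theta> a p \<ge> 0"
      "\<And>p. p \<in> points N \<Longrightarrow> (\<Sum>a\<in>A. \<theta> a p) = 1"
    interpret cone_fun N A \<theta> K \<iota> r0 u
      by unfold_locales (use pou r0 u in \<open>auto simp: E_def\<close>)
    have ineq': "\<And>z. z \<in> points (conical_end N r0) \<Longrightarrow>
        \<bar>laplacian (conical_end N r0) u z\<bar> \<le> q1 z * \<bar>u z\<bar> + q2 z * grad_norm (conical_end N r0) u z"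
      using ineq by (simp add: E_def)
    \<comment> \<open>Both situations with the weight r^\<beta> are instances of
      \<open>exp_weight\<close>, the logarithmic one of \<open>log_weight\<close>.\<close>
    note exp_weight = vanishing_exp_weight[OF ineq'] and log_weight = vanishing_log_weight[OF ineq']
    show ?thesis
      unfolding E_def
    proof (intro conjI allI impI ballI, goal_cases)
      case (1 \<beta> z)
      then show ?case by (intro exp_weight[of \<beta> C1 C2]) auto
    next
      case (2 \<gamma> z)
      then show ?case by (intro log_weight[of \<gamma> C1 C2]) auto
    next
      case (3 \<beta> z)
      then show ?case by (intro exp_weight[of \<beta> C1 C2]) auto
    qed
  qed
qed

end
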